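(* Let $K$ be a field. For $n\geq 1$ let $\mathfrak{C}(n)$ denote the set of all weakly connected collections of cells in $\mathbb{Z}^2$ consisting of exactly $n$ cells. Then: (1) For every $\mathcal{C}\in\mathfrak{C}(1)\cup\mathfrak{C}(2)\cup\mathfrak{C}(3)$, the ideal $I_{\mathrm{adj}}(\mathcal{C})$ is radical. (2) There are no minimally non-radical collections of cells in $\mathfrak{C}(5)$. (3) For $n=4$ and for every $n\geq 6$, there exists a minimally non-radical collection of cells in $\mathfrak{C}(n)$.
   Context: A cell of $\mathbb{Z}^2$ is a set $C=[a,b]=\{a,b,c,d\}$ with $a=(i,j)$, $b=a+(1,1)$, $c=(i,j+1)$, $d=(i+1,j)$; $a,b$ are its diagonal corners, $c,d$ its anti-diagonal corners, $V(C)=\{a,b,c,d\}$ its vertices, and $\{a,c\},\{c,b\},\{b,d\},\{a,d\}$ its edges. For a set $\mathcal{C}$ of cells, $V(\mathcal{C})=\bigcup_{C\in\mathcal{C}}V(C)$. $\mathcal{C}$ is weakly connected if any two cells of $\mathcal{C}$ can be joined by a sequence of cells of $\mathcal{C}$ in which consecutive cells share an edge or a vertex. $I_{\mathrm{adj}}(\mathcal{C})$ is the ideal of $S_{\mathcal{C}}=K[x_v\mid v\in V(\mathcal{C})]$ generated by the adjacent $2$-minors $x_ax_b-x_cx_d$, one for each cell of $\mathcal{C}$ (with diagonal corners $a,b$ and anti-diagonal corners $c,d$). A weakly connected collection of cells $\mathcal{C}$ is minimally non-radical if $I_{\mathrm{adj}}(\mathcal{C})$ is not radical and, for every cell $C$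 of $\mathcal{C}$ such that $\mathcal{C}\setminus\{C\}$ is weakly connected, the adjacent $2$-minor ideal of $\mathcal{C}\setminus\{C\}$ is radical. *)

theory Defs
  imports "HOL-Algebra.Ideal" "HOL-Library.Poly_Mapping"
begin

section \<open>Cells and collections of cells\<close>

type_synonym point = "int \<times> int"

text \<open>A cell is represented by its vertex set; the function below sends the lower left
  corner \<open>a\<close> to the cell \<open>[a, a + (1,1)]\<close>, listed as \<open>{a, b, c, d}\<close> with diagonal corners
  \<open>a, b\<close> and anti-diagonal corners \<open>c, d\<close>.\<close>

fun cell :: "point \<Rightarrow> point set" where
  "cell (i, j) = {(i, j), (i + 1, j + 1), (i, j + 1), (i + 1, j)}"

definition cells :: "point set set" where
  "cells = range cell"

text \<open>The edges \<open>{a,c}, {c,b}, {b,d}, {a,d}\<close>. The lower left corner of a cell is unique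
  (lemma \<open>cell_inject\<close>), so the existential is harmless.\<close>

definition edges :: "point set \<Rightarrow> point set set" where
  "edges C = {e. \<exists>i j. C = cell (i, j) \<and>
     e \<in> {{(i, j), (i, j + 1)}, {(i, j + 1), (i + 1, j + 1)},
          {(i + 1, j + 1), (i + 1, j)}, {(i, j), (i + 1, j)}}}"

definition vertices :: "point set set \<Rightarrow> point set" where
  "vertices \<C> = \<Union>\<C>"

definition touching :: "point set \<Rightarrow> point set \<Rightarrow> bool" where
  "touching C D \<longleftrightarrow> edges C \<inter> edges D \<noteq> {} \<or> C \<inter> D \<noteq> {}"

text \<open>The reflexive transitive closure encodes finite sequences of cells of \<open>\<C>\<close>.\<close>

definition weakly_connected :: "point set set \<Rightarrow> bool" where
  "weakly_connected \<C> \<longleftrightarrow>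
     (\<forall>C\<in>\<C>. \<forall>D\<in>\<C>. (C, D) \<in> {(A, B). A \<in> \<C> \<and> B \<in> \<C> \<and> touching A B}\<^sup>*)"

definition collections :: "nat \<Rightarrow> point set set set" where
  "collections n =
     {\<C>. \<C> \<subseteq> cells \<and> finite \<C> \<and> card \<C> = n \<and> weakly_connected \<C>}"

lemma cell_inject: "cell p = cell q \<longleftrightarrow> p = q"
proof
  assume eq: "cell p = cell q"
  obtain i j k l where pq: "p = (i, j)" "q = (k, l)" by fastforce
  have "(i, j) \<in> cell p" "(i + 1, j + 1) \<in> cell p" by (simp_all add: pq)
  then have "(i, j) \<in> cell q" "(i + 1, j + 1) \<in> cell q" by (simp_all only: eq)
  then show "p = q" by (auto simp: pq)
qed simp

section \<open>Polynomial rings and radical ideals\<close>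

text \<open>Monomials are finitely supported exponent functions and polynomials are finitely
  supported coefficient functions on monomials. The ring \<open>K[x\<^sub>v | v \<in> V]\<close> is the subring of
  those polynomials all of whose monomials only involve variables indexed by \<open>V\<close>.\<close>

type_synonym ('v, 'k) mpoly = "('v \<Rightarrow>\<^sub>0 nat) \<Rightarrow>\<^sub>0 'k"

definition poly_var :: "'v \<Rightarrow> ('v, 'k::comm_ring_1) mpoly" where
  "poly_var v = Poly_Mapping.single (Poly_Mapping.single v 1) 1"

definition poly_ring :: "'v set \<Rightarrow> ('v, 'k::comm_ring_1) mpoly ring" where
  "poly_ring V =
     \<lparr>carrier = {p. \<forall>m\<in>Poly_Mapping.keys p. Poly_Mapping.keys m \<subseteq> V},
      monoid.mult = (*), one = 1, zero = 0, add = (+)\<rparr>"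

definition radical_of :: "('a, 'b) ring_scheme \<Rightarrow> 'a set \<Rightarrow> 'a set" where
  "radical_of R I = {f \<in> carrier R. \<exists>n::nat. n \<ge> 1 \<and> f [^]\<^bsub>R\<^esub> n \<in> I}"

definition is_radical :: "('a, 'b) ring_scheme \<Rightarrow> 'a set \<Rightarrow> bool" where
  "is_radical R I \<longleftrightarrow> radical_of R I = I"

lemma poly_ring_cring: "cring (poly_ring V :: ('v, 'k::comm_ring_1) mpoly ring)"
proof -
  let ?P = "{p :: ('v, 'k) mpoly. \<forall>m\<in>Poly_Mapping.keys p. Poly_Mapping.keys m \<subseteq> V}"
  have add: "p + q \<in> ?P" if "p \<in> ?P" "q \<in> ?P" for p q
    using that Poly_Mapping.keys_add[of p q] by blast
  have mult: "p * q \<in> ?P" if p: "p \<in> ?P" and q: "q \<in> ?P" for p q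
  proof (safe)
    fix m x assume m: "m \<in> Poly_Mapping.keys (p * q)" and x: "x \<in> Poly_Mapping.keys m"
    from m keys_mult[of p q] obtain a b where ab:
      "m = a + b" "a \<in> Poly_Mapping.keys p" "b \<in> Poly_Mapping.keys q" by blast
    then have "x \<in> Poly_Mapping.keys a \<union> Poly_Mapping.keys b"
      using x Poly_Mapping.keys_add[of a b] by blast
    then show "x \<in> V" using ab p q by blast
  qed
  have neg: "- p \<in> ?P" if "p \<in> ?P" for p
    using that by (simp add: Poly_Mapping.in_keys_iff)
  have minus: "\<exists>q\<in>?P. q + p = 0" if "p \<in> ?P" for p
    using bexI[of "\<lambda>q. q + p = 0" "- p" ?P] neg[OF that] by simp
  have units: "(0 :: ('v, 'k) mpoly) \<in> ?P" "(1 :: ('v, 'k) mpoly) \<in> ?P" by auto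
  have carr: "carrier (poly_ring V) = ?P"
    and ops: "x \<oplus>\<^bsub>poly_ring V\<^esub> y = x + y" "x \<otimes>\<^bsub>poly_ring V\<^esub> y = x * y"
      "\<zero>\<^bsub>poly_ring V\<^esub> = (0 :: ('v, 'k) mpoly)" "\<one>\<^bsub>poly_ring V\<^esub> = (1 :: ('v, 'k) mpoly)"
    for x y :: "('v, 'k) mpoly"
    by (simp_all add: poly_ring_def)
  have "abelian_group (poly_ring V :: ('v, 'k) mpoly ring)"
    by (rule abelian_groupI; unfold carr ops)
       (rule add units add.assoc add.commute add_0_left minus | assumption)+
  moreover have "comm_monoid (poly_ring V :: ('v, 'k) mpoly ring)"
    by (rule comm_monoidI; unfold carr ops)
       (rule mult units mult.assoc mult.commute mult_1_left | assumption)+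
  ultimately show ?thesis
    by (rule cringI) (simp add: ops distrib_right)
qed

section \<open>Adjacent 2-minor ideals\<close>

definition adj_ring :: "point set set \<Rightarrow> (point, 'k::field) mpoly ring" where
  "adj_ring \<C> = poly_ring (vertices \<C>)"

fun adj_minor :: "point \<Rightarrow> (point, 'k::field) mpoly" where
  "adj_minor (i, j) =
     poly_var (i, j) * poly_var (i + 1, j + 1) - poly_var (i, j + 1) * poly_var (i + 1, j)"

definition adj_ideal :: "point set set \<Rightarrow> (point, 'k::field) mpoly set" where
  "adj_ideal \<C> = Idl\<^bsub>adj_ring \<C>\<^esub> {adj_minor a | a. cell a \<in> \<C>}"

text \<open>The type argument records the coefficient field.\<close>

definition has_radical_adj_ideal :: "'k::field itself \<Rightarrow> point set set \<Rightarrow> bool" where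
  "has_radical_adj_ideal K \<C> \<longleftrightarrow>
     is_radical (adj_ring \<C>) (adj_ideal \<C> :: (point, 'k) mpoly set)"

definition minimally_nonradical :: "'k::field itself \<Rightarrow> point set set \<Rightarrow> bool" where
  "minimally_nonradical K \<C> \<longleftrightarrow>
     \<C> \<subseteq> cells \<and> weakly_connected \<C> \<and> \<not> has_radical_adj_ideal K \<C> \<and>
     (\<forall>C\<in>\<C>. weakly_connected (\<C> - {C}) \<longrightarrow> has_radical_adj_ideal K (\<C> - {C}))"

lemma adj_minor_carrier:
  assumes "cell a \<in> \<C>"
  shows "(adj_minor a :: (point, 'k::field) mpoly) \<in> carrier (adj_ring \<C>)"
proof -
  interpret R: cring "poly_ring (vertices \<C>) :: (point, 'k) mpoly ring"
    by (rule poly_ring_cring)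
  obtain i j where a: "a = (i, j)" by fastforce
  have var: "(poly_var v :: (point, 'k) mpoly) \<in> carrier (poly_ring (vertices \<C>))"
    if "v \<in> cell a" for v
    using that assms by (auto simp: poly_ring_def poly_var_def vertices_def)
  have prods: "(poly_var v * poly_var w :: (point, 'k) mpoly) \<in> carrier (poly_ring (vertices \<C>))"
    if "v \<in> cell a" "w \<in> cell a" for v w
    using R.m_closed[OF var[OF that(1)] var[OF that(2)]] by (simp add: poly_ring_def)
  have diffs: "p - q \<in> carrier (poly_ring (vertices \<C>))"
    if "p \<in> carrier (poly_ring (vertices \<C>))" "q \<in> carrier (poly_ring (vertices \<C>))"
    for p q :: "(point, 'k) mpoly"
  proof -
    have "\<forall>m\<in>Poly_Mapping.keys p \<union> Poly_Mapping.keys q. Poly_Mapping.keys m \<subseteq> vertices \<C>"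
      using that by (simp add: poly_ring_def ball_Un)
    then have "\<forall>m\<in>Poly_Mapping.keys (p - q). Poly_Mapping.keys m \<subseteq> vertices \<C>"
      using keys_diff[of p q] by blast
    then show ?thesis by (simp add: poly_ring_def)
  qed
  have "(i, j) \<in> cell a" "(i + 1, j + 1) \<in> cell a" "(i, j + 1) \<in> cell a" "(i + 1, j) \<in> cell a"
    by (simp_all add: a)
  then show ?thesis
    unfolding adj_ring_def a adj_minor.simps by (intro diffs prods) (simp_all only: a)
qed

end

theory Submission
  imports Defs "HOL-Library.Product_Lexorder"
begin

text \<open>The quotient of the polynomial ring by an adjacent 2-minor ideal is the semigroup algebra of
  the monomials modulo the moves that replace the diagonal of a cell by its anti-diagonal. It is
  reduced if the ideal has a Groebner basis with squarefree initial terms. For this it suffices to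
  choose in each cell the diagonal or the anti-diagonal such that the chosen pairs are disjoint and
  heavier than their counterparts for some weight on the vertices. An enumeration shows that this is
  possible for every connected collection of at most five cells, except for the square and the
  T-tetromino, for the collections of five cells that contain one of these, for the U-pentomino, and
  for a ring of four cells with one more cell in a corner. The last two ideals are radical for
  other reasons. Conversely, monomials \<open>u\<close> and \<open>v\<close> that are not equivalent, while \<open>u\<^sup>2\<close>, \<open>u v\<close> and
  \<open>v\<^sup>2\<close> are, yield a nilpotent \<open>u - v\<close>; such pairs exist for the square and the T-tetromino.

  For \<open>n \<ge> 6\<close>, take a zigzag of cells that meet in vertices, with a corner of three cells at each
  end. The two corners impose opposite choices of diagonals along the zigzag, and the ideal is not
  radical; without any one of the cells the conflict disappears.\<close>

section \<open>Adjacent 2-minor ideals as congruences\<close>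

text \<open>The field is arbitrary, so neither roots nor the characteristic may enter. Reducedness
  therefore rests on leading coefficients, whose powers stay nonzero in a domain, and every
  nilpotent exhibited is a difference of two monomials. Disjoint leads are sufficient but not
  necessary, which is the obstacle at five cells. For the U-pentomino three further binomials
  complete the minors to a Groebner basis with squarefree leads. For the ring with a corner cell,
  nilpotents are detected in two reduced quotients: one kills a variable h, the other is the
  quotient by the saturation at h. The clash on the zigzag comes from its middle row. Each zigzag
  cell has two vertices there, one on each diagonal, so choosing a lead means claiming one of them;
  a corner forces the claim, and the shared vertices hand it on from cell to cell. Weights, bases
  and chains of moves given as constants are certificates: the proof depends only on the checks that
  they pass.\<close>

abbreviation var_exp :: "'v \<Rightarrow> 'v \<Rightarrow>\<^sub>0 nat" where
  "var_exp v \<equiv> Poly_Mapping.single v 1"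

fun diag :: "point \<Rightarrow> point \<Rightarrow>\<^sub>0 nat" where
  "diag (i, j) = var_exp (i, j) + var_exp (i + 1, j + 1)"

fun anti :: "point \<Rightarrow> point \<Rightarrow>\<^sub>0 nat" where
  "anti (i, j) = var_exp (i, j + 1) + var_exp (i + 1, j)"

lemma adj_minor_eq:
  "adj_minor p = Poly_Mapping.single (diag p) 1 - Poly_Mapping.single (anti p) 1"
  by (cases p) (simp add: poly_var_def mult_single)

declare adj_minor.simps [simp del] cell.simps [simp del] diag.simps [simp del] anti.simps [simp del]

section \<open>Coefficient sums over sets of monomials\<close>

definition coeff_sum :: "('m \<Rightarrow> bool) \<Rightarrow> ('m \<Rightarrow>\<^sub>0 'k) \<Rightarrow> 'k::comm_ring_1" where
  "coeff_sum P f = (\<Sum>m\<in>Poly_Mapping.keys f. if P m then Poly_Mapping.lookup f m else 0)"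

lemma coeff_sum_superset:
  assumes "finite B" "Poly_Mapping.keys f \<subseteq> B"
  shows "coeff_sum P f = (\<Sum>m\<in>B. if P m then Poly_Mapping.lookup f m else 0)"
  unfolding coeff_sum_def using assms
  by (intro sum.mono_neutral_left) (auto simp: in_keys_iff)

lemma coeff_sum_add: "coeff_sum P (f + g) = coeff_sum P f + coeff_sum P g"
proof -
  let ?B = "Poly_Mapping.keys f \<union> Poly_Mapping.keys g"
  have "coeff_sum P (f + g) = (\<Sum>m\<in>?B. if P m then Poly_Mapping.lookup (f + g) m else 0)"
    using Poly_Mapping.keys_add[of f g] by (intro coeff_sum_superset) auto
  also have "\<dots> = (\<Sum>m\<in>?B. if P m then Poly_Mapping.lookup f m else 0) +
      (\<Sum>m\<in>?B. if P m then Poly_Mapping.lookup g m else 0)"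
    unfolding sum.distrib[symmetric] by (intro sum.cong) (auto simp: lookup_add)
  also have "\<dots> = coeff_sum P f + coeff_sum P g"
    using coeff_sum_superset[of ?B f P] coeff_sum_superset[of ?B g P] by simp
  finally show ?thesis .
qed

lemma coeff_sum_uminus: "coeff_sum P (- f) = - coeff_sum P f"
  unfolding coeff_sum_def by (simp add: sum_negf[symmetric] if_distrib cong: if_cong)

lemma coeff_sum_diff: "coeff_sum P (f - g) = coeff_sum P f - coeff_sum P g"
  using coeff_sum_add[of P f "- g"] by (simp add: coeff_sum_uminus)

lemma coeff_sum_zero [simp]: "coeff_sum P 0 = 0"
  by (simp add: coeff_sum_def)

lemma coeff_sum_single [simp]: "coeff_sum P (Poly_Mapping.single m c) = (if P m then c else 0)"
  by (simp add: coeff_sum_def)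

lemma coeff_sum_sum: "coeff_sum P (sum g I) = (\<Sum>i\<in>I. coeff_sum P (g i))"
  by (induction I rule: infinite_finite_induct) (simp_all add: coeff_sum_add)

lemma sum_single_lookup:
  "(\<Sum>m\<in>Poly_Mapping.keys f. Poly_Mapping.single m (Poly_Mapping.lookup f m)) = f"
  by (rule poly_mapping_eqI)
     (auto simp: lookup_sum lookup_single when_def sum.delta in_keys_iff)

lemma coeff_sum_single_times:
  fixes f :: "('v, 'k::comm_ring_1) mpoly"
  shows "coeff_sum P (Poly_Mapping.single t c * f) = c * coeff_sum (\<lambda>m. P (t + m)) f"
proof -
  have "Poly_Mapping.single t c * f =
      (\<Sum>m\<in>Poly_Mapping.keys f. Poly_Mapping.single (t + m) (c * Poly_Mapping.lookup f m))"
    by (subst (1) sum_single_lookup[symmetric, of f]) (simp add: sum_distrib_left mult_single)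
  then have "coeff_sum P (Poly_Mapping.single t c * f) =
      (\<Sum>m\<in>Poly_Mapping.keys f. if P (t + m) then c * Poly_Mapping.lookup f m else 0)"
    by (simp add: coeff_sum_sum)
  also have "\<dots> = c * coeff_sum (\<lambda>m. P (t + m)) f"
    unfolding coeff_sum_def sum_distrib_left by (intro sum.cong) auto
  finally show ?thesis .
qed

lemma coeff_sum_times:
  fixes f g :: "('v, 'k::comm_ring_1) mpoly"
  shows "coeff_sum P (f * g) =
    (\<Sum>t\<in>Poly_Mapping.keys f. Poly_Mapping.lookup f t * coeff_sum (\<lambda>m. P (t + m)) g)"
proof -
  have "f * g = (\<Sum>t\<in>Poly_Mapping.keys f. Poly_Mapping.single t (Poly_Mapping.lookup f t) * g)"
    by (subst (1) sum_single_lookup[symmetric, of f]) (simp add: sum_distrib_right)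
  then show ?thesis by (simp add: coeff_sum_sum coeff_sum_single_times)
qed

text \<open>The quotient of the polynomial ring by \<open>adj_ideal\<close> is the semigroup algebra of the
  monomials modulo this congruence.\<close>

inductive cong :: "point set \<Rightarrow> (point \<Rightarrow>\<^sub>0 nat) \<Rightarrow> (point \<Rightarrow>\<^sub>0 nat) \<Rightarrow> bool" for A where
  cong_refl: "cong A u u"
| cong_sym: "cong A u v \<Longrightarrow> cong A v u"
| cong_trans: "cong A u v \<Longrightarrow> cong A v w \<Longrightarrow> cong A u w"
| cong_move: "p \<in> A \<Longrightarrow> cong A (diag p + t) (anti p + t)"

lemma cong_add: "cong A u v \<Longrightarrow> cong A (u + t) (v + t)"
proof (induction rule: cong.induct)
  case (cong_move p s)
  then show ?case using cong.cong_move[of p A "s + t"] by (simp add: add.assoc)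
next
  case (cong_trans u v w)
  show ?case by (rule cong.cong_trans[OF cong_trans.IH])
next
  case (cong_sym u v)
  show ?case by (rule cong.cong_sym[OF cong_sym.IH])
qed (rule cong.cong_refl)

definition move_closed :: "point set \<Rightarrow> ((point \<Rightarrow>\<^sub>0 nat) \<Rightarrow> bool) \<Rightarrow> bool" where
  "move_closed A P \<longleftrightarrow> (\<forall>p\<in>A. \<forall>t. P (diag p + t) \<longleftrightarrow> P (anti p + t))"

lemma move_closed_cong: "move_closed A P \<Longrightarrow> cong A u v \<Longrightarrow> P u \<longleftrightarrow> P v"
proof (rotate_tac 1, induction rule: cong.induct)
  case (cong_move p t)
  then show ?case unfolding move_closed_def by blast
qed simp_all

lemma cong_iff: "cong A u v \<Longrightarrow> cong A m u \<longleftrightarrow> cong A m v"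
  using cong_sym cong_trans by metis

lemma move_closed_class: "move_closed A (cong A m)"
  unfolding move_closed_def using cong_iff[OF cong_move] by blast

text \<open>Closed sets are used instead of single classes because the set of all m with
  \<open>P (t + m)\<close> is again closed, but need not be one class;
  \<open>vanishing_times\<close> depends on this.\<close>

definition vanishing :: "point set \<Rightarrow> (point, 'k::comm_ring_1) mpoly \<Rightarrow> bool" where
  "vanishing A f \<longleftrightarrow> (\<forall>P. move_closed A P \<longrightarrow> coeff_sum P f = 0)"

lemma vanishing_iff_classes: "vanishing A f \<longleftrightarrow> (\<forall>m. coeff_sum (cong A m) f = 0)"
proof
  assume *: "\<forall>m. coeff_sum (cong A m) f = 0"
  show "vanishing A f" unfolding vanishing_def
  proof (intro allI impI)
    fix P assume P: "move_closed A P"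
    define K where "K = {m \<in> Poly_Mapping.keys f. P m}"
    \<comment> \<open>Each class is represented by its trace on the finite set \<open>K\<close>, so
      that the sum can be grouped by classes.\<close>
    define c where "c m = {n \<in> K. cong A m n}" for m
    have "coeff_sum P f = (\<Sum>m\<in>K. Poly_Mapping.lookup f m)"
      unfolding coeff_sum_def K_def by (intro sum.mono_neutral_cong_right) auto
    also have "\<dots> = (\<Sum>y\<in>c ` K. \<Sum>m\<in>{m \<in> K. c m = y}. Poly_Mapping.lookup f m)"
      by (rule sum.image_gen) (simp add: K_def)
    also have "\<dots> = 0"
    proof (rule sum.neutral, safe)
      fix u assume u: "u \<in> K"
      have "{m \<in> K. c m = c u} = {m \<in> Poly_Mapping.keys f. cong A u m}"
      proof (intro equalityI subsetI)
        fix m assume "m \<in> {m \<in> K. c m = c u}"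
        then have m: "m \<in> K" "c m = c u" by auto
        then have "m \<in> c u" using cong_refl[of A m] unfolding c_def by blast
        then show "m \<in> {m \<in> Poly_Mapping.keys f. cong A u m}" by (simp add: c_def K_def)
      next
        fix m assume "m \<in> {m \<in> Poly_Mapping.keys f. cong A u m}"
        then have m: "m \<in> Poly_Mapping.keys f" "cong A u m" by auto
        then have "m \<in> K" using u move_closed_cong[OF P m(2)] by (simp add: K_def)
        moreover have "cong A m n \<longleftrightarrow> cong A u n" for n
          using m(2) cong_sym cong_trans by metis
        ultimately show "m \<in> {m \<in> K. c m = c u}" by (simp add: c_def)
      qed
      then have "(\<Sum>m\<in>{m \<in> K. c m = c u}. Poly_Mapping.lookup f m) = coeff_sum (cong A u) f"
        unfolding coeff_sum_def by (simp, intro sum.mono_neutral_cong_left) auto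
      then show "(\<Sum>m\<in>{m \<in> K. c m = c u}. Poly_Mapping.lookup f m) = 0" using * by simp
    qed
    finally show "coeff_sum P f = 0" .
  qed
qed (use move_closed_class vanishing_def in blast)

section \<open>Membership in the adjacent minor ideal, expressed by coefficient sums\<close>

definition corner_set :: "point set \<Rightarrow> point set" where
  "corner_set A = (\<Union>p\<in>A. cell p)"

lemma vertices_cell_image: "vertices (cell ` A) = corner_set A"
  by (simp add: vertices_def corner_set_def)

lemma keys_add_nat:
  "Poly_Mapping.keys (u + v) = Poly_Mapping.keys u \<union> Poly_Mapping.keys (v :: 'v \<Rightarrow>\<^sub>0 nat)"
  by (auto simp: in_keys_iff lookup_add)

lemma keys_diag: "p \<in> A \<Longrightarrow> Poly_Mapping.keys (diag p) \<subseteq> corner_set A"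
  and keys_anti: "p \<in> A \<Longrightarrow> Poly_Mapping.keys (anti p) \<subseteq> corner_set A"
  by (cases p; force simp: keys_add_nat corner_set_def diag.simps anti.simps cell.simps)+

lemma adj_ideal_image:
  "adj_ideal (cell ` A) = Idl\<^bsub>poly_ring (corner_set A)\<^esub> (adj_minor ` A)"
proof -
  have "{adj_minor a |a. cell a \<in> cell ` A} = (adj_minor ` A :: (point, 'a) mpoly set)"
    by (auto simp: cell_inject image_iff)
  then show ?thesis by (simp add: adj_ideal_def adj_ring_def vertices_cell_image)
qed

lemma poly_ring_simps [simp]:
  "f \<otimes>\<^bsub>poly_ring V\<^esub> g = f * g" "f \<oplus>\<^bsub>poly_ring V\<^esub> g = f + g"
  "\<zero>\<^bsub>poly_ring V\<^esub> = 0" "\<one>\<^bsub>poly_ring V\<^esub> = 1"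
  by (simp_all add: poly_ring_def)

lemma carrier_poly_ring:
  "f \<in> carrier (poly_ring V) \<longleftrightarrow> (\<forall>m\<in>Poly_Mapping.keys f. Poly_Mapping.keys m \<subseteq> V)"
  by (simp add: poly_ring_def)

lemma poly_ring_pow: "f [^]\<^bsub>poly_ring V\<^esub> (n::nat) = f ^ n"
  by (induction n) (simp_all add: mult.commute)

lemma single_carrier: "Poly_Mapping.keys m \<subseteq> V \<Longrightarrow> Poly_Mapping.single m c \<in> carrier (poly_ring V)"
  by (auto simp: carrier_poly_ring)

lemma adj_minor_in_carrier: "adj_minor ` A \<subseteq> carrier (poly_ring (corner_set A))"
  using adj_minor_carrier[of _ "cell ` A"] by (auto simp: adj_ring_def vertices_cell_image)

lemma adj_ideal_ideal:
  "ideal (adj_ideal (cell ` A)) (poly_ring (corner_set A) :: (point, 'k::field) mpoly ring)"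
  unfolding adj_ideal_image
  by (rule ring.genideal_ideal[OF cring.axioms(1)[OF poly_ring_cring] adj_minor_in_carrier])

lemma adj_minor_in_adj_ideal: "p \<in> A \<Longrightarrow> adj_minor p \<in> adj_ideal (cell ` A)"
  unfolding adj_ideal_image
  using ring.genideal_self[OF cring.axioms(1)[OF poly_ring_cring] adj_minor_in_carrier] by blast

lemma poly_ring_a_inv:
  assumes f: "f \<in> carrier (poly_ring V)"
  shows "\<ominus>\<^bsub>poly_ring V\<^esub> f = - f"
proof -
  interpret cring "poly_ring V :: ('a, 'b) mpoly ring" by (rule poly_ring_cring)
  have "- f \<in> carrier (poly_ring V)" using f by (simp add: carrier_poly_ring)
  then show ?thesis using f by (intro minus_equality) simp_all
qed

lemma vanishing_times:
  assumes "vanishing A g" shows "vanishing A (f * g)"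
  unfolding vanishing_def
proof (intro allI impI)
  fix P assume P: "move_closed A P"
  have "move_closed A (\<lambda>m. P (t + m))" for t
    using P unfolding move_closed_def add.left_commute[of t] by blast
  then have "coeff_sum (\<lambda>m. P (t + m)) g = 0" for t
    using assms by (simp add: vanishing_def)
  then show "coeff_sum P (f * g) = 0" by (simp add: coeff_sum_times)
qed

lemma vanishing_adj_minor: "p \<in> A \<Longrightarrow> vanishing A (adj_minor p)"
  unfolding vanishing_def adj_minor_eq
  using move_closed_cong[OF _ cong_move[of p A 0]] by (auto simp: coeff_sum_diff)

lemma adj_ideal_vanishing:
  assumes "f \<in> adj_ideal (cell ` A)" shows "vanishing A f"
proof -
  let ?R = "poly_ring (corner_set A) :: (point, 'a) mpoly ring"
  interpret R: cring ?R by (rule poly_ring_cring)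
  let ?J = "{f \<in> carrier ?R. vanishing A f}"
  have "ideal ?J ?R"
  proof (rule idealI[OF R.ring_axioms])
    show "subgroup ?J (add_monoid ?R)"
    proof (rule R.add.subgroupI)
      show "?J \<noteq> {}" using R.zero_closed by (auto simp: vanishing_def)
      show "\<ominus>\<^bsub>?R\<^esub> a \<in> ?J" if "a \<in> ?J" for a
        using that by (auto simp: poly_ring_a_inv vanishing_def coeff_sum_uminus carrier_poly_ring)
      show "a \<oplus>\<^bsub>?R\<^esub> b \<in> ?J" if "a \<in> ?J" "b \<in> ?J" for a b
        using that R.a_closed[of a b] by (auto simp: vanishing_def coeff_sum_add)
    qed auto
    show "x \<otimes>\<^bsub>?R\<^esub> a \<in> ?J" if "a \<in> ?J" "x \<in> carrier ?R" for a x
      using that R.m_closed[of x a] by (auto intro: vanishing_times)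
    show "a \<otimes>\<^bsub>?R\<^esub> x \<in> ?J" if "a \<in> ?J" "x \<in> carrier ?R" for a x
      using that R.m_closed[of a x] vanishing_times[of A a x] by (auto simp: mult.commute)
  qed
  moreover have "adj_minor ` A \<subseteq> ?J"
    using adj_minor_in_carrier[of A] by (auto simp: vanishing_adj_minor)
  ultimately have "Idl\<^bsub>?R\<^esub> (adj_minor ` A) \<subseteq> ?J" by (rule R.genideal_minimal)
  then show ?thesis using assms by (auto simp: adj_ideal_image)
qed

text \<open>A move multiplies a minor by a cofactor \<open>t\<close>, which must lie in the ring.
  Both diagonals of a cell use vertices of the collection only, so a chain of moves that starts in
  the ring never leaves it. The first conjunct carries this through symmetry and
  transitivity.\<close>

lemma cong_single_diff:
  assumes "cong A u v"
  shows "(Poly_Mapping.keys u \<subseteq> corner_set A \<longleftrightarrow> Poly_Mapping.keys v \<subseteq> corner_set A) \<and>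
    (Poly_Mapping.keys u \<subseteq> corner_set A \<longrightarrow>
      Poly_Mapping.single u c - Poly_Mapping.single v c \<in> (adj_ideal (cell ` A) :: (point, 'k::field) mpoly set))"
proof -
  let ?R = "poly_ring (corner_set A) :: (point, 'k) mpoly ring"
  interpret R: cring ?R by (rule poly_ring_cring)
  interpret I: ideal "adj_ideal (cell ` A)" ?R by (rule adj_ideal_ideal)
  have add: "f + g \<in> adj_ideal (cell ` A)"
    if "f \<in> adj_ideal (cell ` A)" "g \<in> adj_ideal (cell ` A)" for f g :: "(point, 'k) mpoly"
    using I.a_closed[OF that] by simp
  have neg: "- f \<in> adj_ideal (cell ` A)" if "f \<in> adj_ideal (cell ` A)" for f :: "(point, 'k) mpoly"
    using I.a_inv_closed[OF that] poly_ring_a_inv[OF I.a_Hcarr[OF that]] by simp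
  show ?thesis using assms
  proof (induction rule: cong.induct)
    case (cong_refl u)
    then show ?case using I.zero_closed by simp
  next
    case (cong_sym u v)
    then show ?case using neg[of "Poly_Mapping.single u c - Poly_Mapping.single v c"] by simp
  next
    case (cong_trans u v w)
    then show ?case
      using add[of "Poly_Mapping.single u c - Poly_Mapping.single v c"
          "Poly_Mapping.single v c - Poly_Mapping.single w c"] by simp
  next
    case (cong_move p t)
    have "Poly_Mapping.single t c * adj_minor p \<in> adj_ideal (cell ` A)"
      if "Poly_Mapping.keys t \<subseteq> corner_set A"
      using I.I_l_closed[OF adj_minor_in_adj_ideal[OF cong_move] single_carrier[OF that]] by simp
    then show ?case using keys_diag[OF cong_move] keys_anti[OF cong_move]
      by (auto simp: adj_minor_eq keys_add_nat mult_single right_diff_distrib add.commute)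
  qed
qed

text \<open>A class with coefficient sum 0 cannot meet the support in a single monomial. Subtracting
  a multiple of the difference of two congruent monomials removes one of them from the support and
  adds none.\<close>

lemma vanishing_adj_ideal:
  fixes f :: "(point, 'k::field) mpoly"
  assumes "f \<in> carrier (poly_ring (corner_set A))" "vanishing A f"
  shows "f \<in> adj_ideal (cell ` A)"
  using assms
proof (induction "card (Poly_Mapping.keys f)" arbitrary: f rule: less_induct)
  case (less f)
  let ?R = "poly_ring (corner_set A) :: (point, 'k) mpoly ring"
  interpret R: cring ?R by (rule poly_ring_cring)
  interpret I: ideal "adj_ideal (cell ` A)" ?R by (rule adj_ideal_ideal)
  show ?case
  proof (cases "f = 0")
    case True
    then show ?thesis using I.zero_closed by simp
  next
    case False
    then obtain u where u: "u \<in> Poly_Mapping.keys f" by fastforce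
    have ex: "\<exists>v\<in>Poly_Mapping.keys f. v \<noteq> u \<and> cong A u v"
    proof (rule ccontr)
      assume "\<not> ?thesis"
      then have "coeff_sum (cong A u) f = (\<Sum>m\<in>{u}. Poly_Mapping.lookup f m)"
        unfolding coeff_sum_def using u by (intro sum.mono_neutral_cong_right) (auto intro: cong_refl)
      then show False using less.prems(2) u
        by (auto simp: vanishing_iff_classes in_keys_iff)
    qed
    then obtain v where v: "v \<in> Poly_Mapping.keys f" "v \<noteq> u" "cong A u v" by blast
    define c where "c = Poly_Mapping.lookup f u"
    define d where "d = Poly_Mapping.single u c - Poly_Mapping.single v c"
    have uV: "Poly_Mapping.keys u \<subseteq> corner_set A" using u less.prems(1) by (simp add: carrier_poly_ring)
    then have dI: "d \<in> adj_ideal (cell ` A)" unfolding d_def using cong_single_diff[OF v(3)] by blast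
    have lk: "Poly_Mapping.lookup (f - d) m = (if m = u then 0 else if m = v then
        Poly_Mapping.lookup f v + c else Poly_Mapping.lookup f m)" for m
      using v(2) by (auto simp: d_def c_def lookup_minus lookup_single)
    have keys: "Poly_Mapping.keys (f - d) \<subseteq> Poly_Mapping.keys f - {u}"
      using v(1) by (auto simp: in_keys_iff lk split: if_splits)
    have "card (Poly_Mapping.keys (f - d)) < card (Poly_Mapping.keys f)"
      using keys u by (intro psubset_card_mono) auto
    moreover have "f - d \<in> carrier ?R" using keys less.prems(1) by (auto simp: carrier_poly_ring)
    moreover have "vanishing A (f - d)"
      using less.prems(2) adj_ideal_vanishing[OF dI] by (simp add: vanishing_def coeff_sum_diff)
    ultimately have "f - d \<in> adj_ideal (cell ` A)" by (rule less.hyps)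
    from I.a_closed[OF this dI] show ?thesis by simp
  qed
qed

definition radical_at :: "'k::field itself \<Rightarrow> point set \<Rightarrow> bool" where
  "radical_at K A \<longleftrightarrow> (\<forall>f \<in> carrier (poly_ring (corner_set A)) :: (point, 'k) mpoly set. \<forall>n\<ge>1.
     vanishing A (f ^ n) \<longrightarrow> vanishing A f)"

lemma has_radical_iff: "has_radical_adj_ideal K (cell ` A) \<longleftrightarrow> radical_at K A"
proof -
  let ?R = "poly_ring (corner_set A) :: (point, 'a) mpoly ring"
  let ?I = "adj_ideal (cell ` A) :: (point, 'a) mpoly set"
  interpret R: cring ?R by (rule poly_ring_cring)
  interpret I: ideal ?I ?R by (rule adj_ideal_ideal)
  have I_iff: "f \<in> ?I \<longleftrightarrow> f \<in> carrier ?R \<and> vanishing A f" for f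
    using adj_ideal_vanishing vanishing_adj_ideal I.a_Hcarr by blast
  have pow: "f ^ n \<in> carrier ?R" if "f \<in> carrier ?R" for f :: "(point, 'a) mpoly" and n
    using R.nat_pow_closed[OF that, of n] by (simp add: poly_ring_pow)
  have sub: "?I \<subseteq> radical_of ?R ?I"
  proof
    fix f assume f: "f \<in> ?I"
    then have "f \<in> carrier ?R" "f [^]\<^bsub>?R\<^esub> (1::nat) \<in> ?I"
      using I.a_Hcarr by (simp_all add: poly_ring_pow)
    then show "f \<in> radical_of ?R ?I" unfolding radical_of_def by blast
  qed
  have "has_radical_adj_ideal K (cell ` A) \<longleftrightarrow> radical_of ?R ?I \<subseteq> ?I"
    unfolding has_radical_adj_ideal_def is_radical_def adj_ring_def vertices_cell_image
    using sub by blast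
  also have "\<dots> \<longleftrightarrow> radical_at K A"
    unfolding radical_at_def radical_of_def subset_iff mem_Collect_eq poly_ring_pow I_iff
    using pow by blast
  finally show ?thesis .
qed

section \<open>Squarefree normal forms\<close>

lemma lookup_coeff_sum: "Poly_Mapping.lookup f m = coeff_sum (\<lambda>x. x = m) f"
  unfolding coeff_sum_def by (simp add: sum.delta in_keys_iff)

lemma coeff_sum_eq_0: "(\<And>m. m \<in> Poly_Mapping.keys f \<Longrightarrow> \<not> P m) \<Longrightarrow> coeff_sum P f = 0"
  unfolding coeff_sum_def by simp

lemma coeff_sum_cong:
  "(\<And>m. m \<in> Poly_Mapping.keys f \<Longrightarrow> P m \<longleftrightarrow> Q m) \<Longrightarrow> coeff_sum P f = coeff_sum Q f"
  unfolding coeff_sum_def by (intro sum.cong) auto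

context
  fixes wt :: "('v::linorder \<Rightarrow>\<^sub>0 nat) \<Rightarrow> nat"
  assumes wt_add: "\<And>u v. wt (u + v) = wt u + wt v"
begin

text \<open>Ties in the weight are broken by the linear order on exponents. Both orders are
  compatible with addition, so a sum attains the maximum in one way only, as leading terms
  require.\<close>

lemma wkey_add_mono:
  assumes "(wt m, m) \<le> (wt a, a)" "(wt n, n) \<le> (wt b, b)"
  shows "(wt (m + n), m + n) \<le> (wt (a + b), a + b)"
    and "m + n = a + b \<Longrightarrow> m = a"
proof -
  have "m \<le> a \<Longrightarrow> n \<le> b \<Longrightarrow> m + n \<le> a + b" by (rule add_mono)
  moreover have "m < a \<Longrightarrow> n \<le> b \<Longrightarrow> m + n < a + b" by (rule add_less_le_mono)
  ultimately show "(wt (m + n), m + n) \<le> (wt (a + b), a + b)" "m + n = a + b \<Longrightarrow> m = a"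
    using assms wt_add[of m n] wt_add[of a b] by (force simp: less_eq_prod_def order_le_less)+
qed

lemma leading_mult:
  fixes g h :: "('v, 'k::comm_ring_1) mpoly"
  assumes g: "\<And>m. m \<in> Poly_Mapping.keys g \<Longrightarrow> (wt m, m) \<le> (wt a, a)"
    and h: "\<And>m. m \<in> Poly_Mapping.keys h \<Longrightarrow> (wt m, m) \<le> (wt b, b)"
  shows "m \<in> Poly_Mapping.keys (g * h) \<Longrightarrow> (wt m, m) \<le> (wt (a + b), a + b)"
    and "Poly_Mapping.lookup (g * h) (a + b) = Poly_Mapping.lookup g a * Poly_Mapping.lookup h b"
proof -
  show "(wt m, m) \<le> (wt (a + b), a + b)" if "m \<in> Poly_Mapping.keys (g * h)"
    using that keys_mult[of g h] wkey_add_mono(1) g h by blast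
  have 0: "coeff_sum (\<lambda>m. t + m = a + b) h = 0" if "t \<in> Poly_Mapping.keys g" "t \<noteq> a" for t
    using that wkey_add_mono(2)[OF g h] by (intro coeff_sum_eq_0) blast
  have "Poly_Mapping.lookup (g * h) (a + b) =
      (\<Sum>t\<in>Poly_Mapping.keys g. Poly_Mapping.lookup g t * coeff_sum (\<lambda>m. t + m = a + b) h)"
    by (simp add: lookup_coeff_sum[of "g * h"] coeff_sum_times)
  also have "\<dots> = (\<Sum>t\<in>Poly_Mapping.keys g.
      if t = a then Poly_Mapping.lookup g t * Poly_Mapping.lookup h b else 0)"
    using 0 by (intro sum.cong) (auto simp: lookup_coeff_sum[of h])
  also have "\<dots> = Poly_Mapping.lookup g a * Poly_Mapping.lookup h b"
    by (simp add: sum.delta in_keys_iff)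
  finally show "Poly_Mapping.lookup (g * h) (a + b) = \<dots>" .
qed

text \<open>The witness is the n-fold sum of \<open>u\<close>. Only its support is recorded, because
  the axiom \<open>squarefree\<close> looks at nothing else.\<close>

lemma leading_power:
  fixes g :: "('v, 'k::comm_ring_1) mpoly"
  assumes g: "\<And>m. m \<in> Poly_Mapping.keys g \<Longrightarrow> (wt m, m) \<le> (wt u, u)"
  shows "\<exists>v. Poly_Mapping.keys v \<subseteq> Poly_Mapping.keys u \<and>
    (\<forall>m\<in>Poly_Mapping.keys (g ^ n). (wt m, m) \<le> (wt v, v)) \<and>
    Poly_Mapping.lookup (g ^ n) v = Poly_Mapping.lookup g u ^ n"
proof (induction n)
  case 0
  show ?case by (rule exI[of _ 0]) (auto simp: lookup_one)
next
  case (Suc n)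
  then obtain v where v: "Poly_Mapping.keys v \<subseteq> Poly_Mapping.keys u"
    "\<And>m. m \<in> Poly_Mapping.keys (g ^ n) \<Longrightarrow> (wt m, m) \<le> (wt v, v)"
    "Poly_Mapping.lookup (g ^ n) v = Poly_Mapping.lookup g u ^ n" by blast
  show ?case
    using leading_mult[of g u "g ^ n" v, OF g v(2)] v(1,3)
    by (intro exI[of _ "u + v"]) (auto simp: keys_add_nat)
qed

end

text \<open>The normal forms of a binomial ideal that has a Groebner basis with squarefree initial terms:
  \<open>\<nu>\<close> maps a monomial to its normal form, or to \<open>None\<close> if it lies in the ideal.\<close>

locale squarefree_normal_form =
  fixes \<nu> :: "('v::linorder \<Rightarrow>\<^sub>0 nat) \<Rightarrow> ('v \<Rightarrow>\<^sub>0 nat) option"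
    and wt :: "('v \<Rightarrow>\<^sub>0 nat) \<Rightarrow> nat"
  assumes wt_add: "wt (u + v) = wt u + wt v"
    and decreasing: "\<nu> u = Some v \<Longrightarrow> v = u \<or> wt v < wt u"
    and idem: "\<nu> u = Some v \<Longrightarrow> \<nu> v = Some v"
    and add_cong: "\<nu> u = \<nu> v \<Longrightarrow> \<nu> (u + t) = \<nu> (v + t)"
    and add_None: "\<nu> u = None \<Longrightarrow> \<nu> (u + t) = None"
    and squarefree: "\<nu> u = Some u \<Longrightarrow> Poly_Mapping.keys v \<subseteq> Poly_Mapping.keys u \<Longrightarrow> \<nu> v = Some v"
begin

definition null :: "('v, 'k::comm_ring_1) mpoly \<Rightarrow> bool" where
  "null f \<longleftrightarrow> (\<forall>v. coeff_sum (\<lambda>m. \<nu> m = Some v) f = 0)"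

text \<open>Such a \<open>P\<close> is a union of fibres of \<open>\<nu>\<close> over normal
  monomials. The fibre of \<open>None\<close> has to be avoided, since \<open>null\<close> does not
  constrain coefficients there.\<close>

lemma null_saturated:
  assumes "null g" and P: "\<And>m n. \<nu> m = \<nu> n \<Longrightarrow> P m \<Longrightarrow> P n" and None: "\<And>m. \<nu> m = None \<Longrightarrow> \<not> P m"
  shows "coeff_sum P g = 0"
proof -
  define K where "K = {m \<in> Poly_Mapping.keys g. P m}"
  have "coeff_sum P g = (\<Sum>m\<in>K. Poly_Mapping.lookup g m)"
    unfolding coeff_sum_def K_def by (intro sum.mono_neutral_cong_right) auto
  also have "\<dots> = (\<Sum>y\<in>\<nu> ` K. \<Sum>m\<in>{m \<in> K. \<nu> m = y}. Poly_Mapping.lookup g m)"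
    by (rule sum.image_gen) (simp add: K_def)
  also have "\<dots> = 0"
  proof (rule sum.neutral, safe)
    fix u assume u: "u \<in> K"
    then obtain v where v: "\<nu> u = Some v" using None by (auto simp: K_def)
    have "{m \<in> K. \<nu> m = \<nu> u} = {m \<in> Poly_Mapping.keys g. \<nu> m = Some v}"
      using u P[of u] v by (auto simp: K_def)
    then have "(\<Sum>m\<in>{m \<in> K. \<nu> m = \<nu> u}. Poly_Mapping.lookup g m) =
        coeff_sum (\<lambda>m. \<nu> m = Some v) g"
      unfolding coeff_sum_def by (simp, intro sum.mono_neutral_cong_left) auto
    then show "(\<Sum>m\<in>{m \<in> K. \<nu> m = \<nu> u}. Poly_Mapping.lookup g m) = 0"
      using assms(1) by (simp add: null_def)
  qed
  finally show ?thesis .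
qed

lemma null_times:
  assumes "null g" shows "null (f * g)"
proof -
  have "coeff_sum (\<lambda>m. \<nu> (t + m) = Some v) g = 0" for t v
    by (rule null_saturated[OF assms]) (metis add.commute add_cong, metis add.commute add_None option.distinct(1))
  then show ?thesis by (simp add: null_def coeff_sum_times)
qed

lemma null_add: "null f \<Longrightarrow> null g \<Longrightarrow> null (f + g)"
  by (simp add: null_def coeff_sum_add)

lemma null_power_diff:
  assumes "null (f - g)" shows "null (f ^ n - g ^ n)"
proof (induction n)
  case (Suc n)
  have "f ^ Suc n - g ^ Suc n = f * (f ^ n - g ^ n) + g ^ n * (f - g)"
    by (simp add: algebra_simps)
  then show ?case using null_add null_times Suc assms by metis
qed (simp add: null_def)

text \<open>Replace f by its normal form g. If g is nonzero, its leading monomial \<open>u\<close>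
  is normal, and so is the leading monomial \<open>v\<close> of \<open>g ^ n\<close>, which has no
  further variables. Reduction lowers the weight, so no other monomial of \<open>g ^ n\<close>
  reduces to \<open>v\<close>, and the coefficient there is a power of a nonzero element of a
  domain.\<close>

lemma null_power:
  fixes f :: "('v, 'k::idom) mpoly"
  assumes "null (f ^ n)" shows "null f"
proof -
  define g where "g = (\<Sum>m\<in>Poly_Mapping.keys f.
    case \<nu> m of None \<Rightarrow> 0 | Some v \<Rightarrow> Poly_Mapping.single v (Poly_Mapping.lookup f m))"
  have "coeff_sum (\<lambda>m. \<nu> m = Some v) g = coeff_sum (\<lambda>m. \<nu> m = Some v) f" for v
    unfolding g_def coeff_sum_sum coeff_sum_def[of _ f]
    using idem by (intro sum.cong) (auto split: option.splits)
  then have fg: "null (f - g)" by (simp add: null_def coeff_sum_diff)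
  have normal: "\<nu> m = Some m" if "m \<in> Poly_Mapping.keys g" for m
    using that keys_sum[of _ "Poly_Mapping.keys f"] idem unfolding g_def
    by (fastforce split: option.splits if_splits)
  have "g = 0"
  proof (rule ccontr)
    assume "g \<noteq> 0"
    define M where "M = (\<lambda>m. (wt m, m)) ` Poly_Mapping.keys g"
    have M: "finite M" "M \<noteq> {}" using \<open>g \<noteq> 0\<close> by (auto simp: M_def)
    then have "Max M \<in> M" by (rule Max_in)
    then obtain u where u: "u \<in> Poly_Mapping.keys g" "Max M = (wt u, u)" by (auto simp: M_def)
    have max: "(wt m, m) \<le> (wt u, u)" if "m \<in> Poly_Mapping.keys g" for m
    proof -
      have "(wt m, m) \<in> M" using that by (simp add: M_def)
      from Max_ge[OF M(1) this] show ?thesis unfolding u(2) .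
    qed
    obtain v where v: "Poly_Mapping.keys v \<subseteq> Poly_Mapping.keys u"
      "\<And>m. m \<in> Poly_Mapping.keys (g ^ n) \<Longrightarrow> (wt m, m) \<le> (wt v, v)"
      "Poly_Mapping.lookup (g ^ n) v = Poly_Mapping.lookup g u ^ n"
      using leading_power[OF wt_add, of g u n] max by blast
    have nv: "\<nu> v = Some v" using squarefree[OF normal[OF u(1)] v(1)] .
    have "coeff_sum (\<lambda>m. \<nu> m = Some v) (g ^ n) = coeff_sum (\<lambda>m. m = v) (g ^ n)"
    proof (rule coeff_sum_cong)
      fix m assume "m \<in> Poly_Mapping.keys (g ^ n)"
      then have "(wt m, m) \<le> (wt v, v)" by (rule v(2))
      then show "\<nu> m = Some v \<longleftrightarrow> m = v" using decreasing[of m v] nv by (auto simp: less_eq_prod_def)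
    qed
    also have "\<dots> = Poly_Mapping.lookup g u ^ n" by (simp add: lookup_coeff_sum[symmetric] v(3))
    finally have "coeff_sum (\<lambda>m. \<nu> m = Some v) (g ^ n) \<noteq> 0" using u(1) by (simp add: in_keys_iff)
    moreover have "null (g ^ n)"
    proof -
      have "null (f ^ n - (f ^ n - g ^ n))"
        using assms null_power_diff[OF fg, of n] by (simp add: null_def coeff_sum_diff)
      then show ?thesis by simp
    qed
    ultimately show False by (simp add: null_def)
  qed
  then show ?thesis using fg by simp
qed

end

section \<open>Binomial rewriting\<close>

text \<open>A rule \<open>(l, Some r)\<close> stands for the binomial \<open>l - r\<close>, a rule \<open>(l, None)\<close> for the monomial
  \<open>l\<close>.\<close>

type_synonym 'v rule = "('v \<Rightarrow>\<^sub>0 nat) \<times> ('v \<Rightarrow>\<^sub>0 nat) option"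

definition rstep :: "'v rule set \<Rightarrow> (('v \<Rightarrow>\<^sub>0 nat) option) rel" where
  "rstep R = {(Some (l + t), map_option (\<lambda>r. r + t) ro) | l ro t. (l, ro) \<in> R}"

definition joinable :: "'v rule set \<Rightarrow> ('v \<Rightarrow>\<^sub>0 nat) option \<Rightarrow> ('v \<Rightarrow>\<^sub>0 nat) option \<Rightarrow> bool" where
  "joinable R x y \<longleftrightarrow> (\<exists>z. (x, z) \<in> (rstep R)\<^sup>* \<and> (y, z) \<in> (rstep R)\<^sup>*)"

lemma rstep_add:
  assumes "(x, y) \<in> rstep R"
  shows "(map_option (\<lambda>u. u + t) x, map_option (\<lambda>u. u + t) y) \<in> rstep R"
proof -
  obtain l ro s where *: "x = Some (l + s)" "y = map_option (\<lambda>r. r + s) ro" "(l, ro) \<in> R"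
    using assms by (auto simp: rstep_def)
  then have "map_option (\<lambda>u. u + t) x = Some (l + (s + t))"
    "map_option (\<lambda>u. u + t) y = map_option (\<lambda>r. r + (s + t)) ro"
    by (simp_all add: add.assoc option.map_comp comp_def)
  then show ?thesis using *(3) unfolding rstep_def by blast
qed

lemma rsteps_add:
  "(x, y) \<in> (rstep R)\<^sup>* \<Longrightarrow>
    (map_option (\<lambda>u. u + t) x, map_option (\<lambda>u. u + t) y) \<in> (rstep R)\<^sup>*"
proof (induction rule: rtrancl_induct)
  case (step y z)
  then show ?case using rstep_add[OF step(2)] by (rule_tac rtrancl_into_rtrancl)
qed simp

lemma joinable_add:
  "joinable R x y \<Longrightarrow> joinable R (map_option (\<lambda>u. u + t) x) (map_option (\<lambda>u. u + t) y)"
  unfolding joinable_def using rsteps_add by blast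

text \<open>The condition \<open>overlap\<close> is the reduction of S-pairs. It is demanded only
  for leads with a common variable; the remaining pairs are covered by Buchberger's product
  criterion.\<close>

locale rewriting =
  fixes R :: "'v::linorder rule set" and wt :: "('v \<Rightarrow>\<^sub>0 nat) \<Rightarrow> nat"
  assumes wt_add: "wt (u + v) = wt u + wt v"
    and wt_rule: "(l, Some r) \<in> R \<Longrightarrow> wt r < wt l"
    and overlap: "(l1, r1) \<in> R \<Longrightarrow> (l2, r2) \<in> R \<Longrightarrow> (l1, r1) \<noteq> (l2, r2) \<Longrightarrow>
      Poly_Mapping.keys l1 \<inter> Poly_Mapping.keys l2 \<noteq> {} \<Longrightarrow>
      joinable R (map_option (\<lambda>r. r + (l2 - l1)) r1) (map_option (\<lambda>r. r + (l1 - l2)) r2)"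
begin

lemma rstep_wt: "(Some u, Some v) \<in> rstep R \<Longrightarrow> wt v < wt u"
proof -
  assume "(Some u, Some v) \<in> rstep R"
  then obtain l ro t where "(l, ro) \<in> R" "u = l + t" "Some v = map_option (\<lambda>r. r + t) ro"
    by (auto simp: rstep_def)
  moreover from this obtain r where "ro = Some r" "v = r + t" by (cases ro) auto
  ultimately show ?thesis using wt_rule by (simp add: wt_add)
qed

lemma wf_rstep: "wf ((rstep R)\<inverse>)"
proof (rule wf_subset)
  show "wf (measure (\<lambda>x. case x of None \<Rightarrow> 0 | Some u \<Rightarrow> Suc (wt u)))" by simp
  show "(rstep R)\<inverse> \<subseteq> measure (\<lambda>x. case x of None \<Rightarrow> 0 | Some u \<Rightarrow> Suc (wt u))"
    using rstep_wt by (auto split: option.splits) (auto simp: rstep_def)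
qed

lemma local_confluence:
  assumes "(x, y) \<in> rstep R" "(x, z) \<in> rstep R"
  shows "joinable R y z"
proof -
  obtain l1 r1 t1 where 1: "x = Some (l1 + t1)" "y = map_option (\<lambda>r. r + t1) r1" "(l1, r1) \<in> R"
    using assms(1) by (auto simp: rstep_def)
  obtain l2 r2 t2 where 2: "x = Some (l2 + t2)" "z = map_option (\<lambda>r. r + t2) r2" "(l2, r2) \<in> R"
    using assms(2) by (auto simp: rstep_def)
  have eq: "l1 + t1 = l2 + t2" using 1 2 by simp
  then have lk: "Poly_Mapping.lookup l1 v + Poly_Mapping.lookup t1 v =
    Poly_Mapping.lookup l2 v + Poly_Mapping.lookup t2 v" for v
    by (metis lookup_add)
  \<comment> \<open>Differences of exponents are truncated, so \<open>l1 + (l2 - l1)\<close> is the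
    least common multiple of the leads, and \<open>s\<close> is the cofactor common to both
    steps.\<close>
  define s where "s = t1 - (l2 - l1)"
  have "Poly_Mapping.lookup t1 v = Poly_Mapping.lookup ((l2 - l1) + s) v" for v
    using lk[of v] by (simp add: s_def lookup_add lookup_minus)
  then have t1: "t1 = (l2 - l1) + s" by (intro poly_mapping_eqI)
  have "Poly_Mapping.lookup t2 v = Poly_Mapping.lookup ((l1 - l2) + s) v" for v
    using lk[of v] by (simp add: s_def lookup_add lookup_minus)
  then have t2: "t2 = (l1 - l2) + s" by (intro poly_mapping_eqI)
  consider "(l1, r1) = (l2, r2)" | "(l1, r1) \<noteq> (l2, r2)" "Poly_Mapping.keys l1 \<inter> Poly_Mapping.keys l2 \<noteq> {}"
    | "Poly_Mapping.keys l1 \<inter> Poly_Mapping.keys l2 = {}" by blast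
  then show ?thesis
  proof cases
    case 1
    then show ?thesis using eq \<open>y = _\<close> \<open>z = _\<close> by (auto simp: joinable_def)
  next
    case 2
    have "joinable R (map_option (\<lambda>u. u + s) (map_option (\<lambda>r. r + (l2 - l1)) r1))
        (map_option (\<lambda>u. u + s) (map_option (\<lambda>r. r + (l1 - l2)) r2))"
      by (intro joinable_add overlap 2 \<open>(l1, r1) \<in> R\<close> \<open>(l2, r2) \<in> R\<close>)
    then show ?thesis
      by (simp add: \<open>y = _\<close> \<open>z = _\<close> t1 t2 option.map_comp comp_def add.assoc)
  next
    \<comment> \<open>Coprime leads: each rule still applies after the other one, and both orders
      give \<open>w\<close>.\<close>
    case 3
    have "Poly_Mapping.lookup l1 v = 0 \<or> Poly_Mapping.lookup l2 v = 0" for v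
      using 3 by (auto simp: disjoint_iff in_keys_iff)
    then have "Poly_Mapping.lookup (l2 - l1) v = Poly_Mapping.lookup l2 v"
      "Poly_Mapping.lookup (l1 - l2) v = Poly_Mapping.lookup l1 v" for v
      unfolding lookup_minus by (metis diff_0_eq_0 minus_nat.diff_0)+
    then have "l2 - l1 = l2" "l1 - l2 = l1" by (simp_all add: poly_mapping_eqI)
    then have t: "t1 = l2 + s" "t2 = l1 + s" using t1 t2 by simp_all
    define w where "w = (case (r1, r2) of (Some a, Some b) \<Rightarrow> Some (a + b + s) | _ \<Rightarrow> None)"
    have "(y, w) \<in> (rstep R)\<^sup>*"
    proof (cases r1)
      case (Some a)
      have "(Some (l2 + (a + s)), map_option (\<lambda>r. r + (a + s)) r2) \<in> rstep R"
        using \<open>(l2, r2) \<in> R\<close> unfolding rstep_def by blast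
      moreover have "map_option (\<lambda>r. r + (a + s)) r2 = w"
        by (cases r2) (simp_all add: w_def Some ac_simps)
      ultimately show ?thesis by (auto simp: \<open>y = _\<close> t Some ac_simps)
    qed (simp add: w_def \<open>y = _\<close>)
    moreover have "(z, w) \<in> (rstep R)\<^sup>*"
    proof (cases r2)
      case (Some b)
      have "(Some (l1 + (b + s)), map_option (\<lambda>r. r + (b + s)) r1) \<in> rstep R"
        using \<open>(l1, r1) \<in> R\<close> unfolding rstep_def by blast
      moreover have "map_option (\<lambda>r. r + (b + s)) r1 = w"
        by (cases r1) (simp_all add: w_def Some ac_simps)
      ultimately show ?thesis by (auto simp: \<open>z = _\<close> t Some ac_simps)
    qed (simp add: w_def \<open>z = _\<close> split: option.splits)
    ultimately show ?thesis unfolding joinable_def by blast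
  qed
qed

text \<open>Newman's lemma: local confluence and termination imply confluence.\<close>

lemma confluence: "(x, y) \<in> (rstep R)\<^sup>* \<Longrightarrow> (x, z) \<in> (rstep R)\<^sup>* \<Longrightarrow> joinable R y z"
proof (induction x arbitrary: y z rule: wf_induct_rule[OF wf_rstep])
  case (1 x)
  show ?case
  proof (cases "x = y \<or> x = z")
    case True
    then show ?thesis using 1(2,3) unfolding joinable_def by blast
  next
    case False
    then obtain y' z' where y': "(x, y') \<in> rstep R" "(y', y) \<in> (rstep R)\<^sup>*"
      and z': "(x, z') \<in> rstep R" "(z', z) \<in> (rstep R)\<^sup>*"
      using 1(2,3) by (metis converse_rtranclE)
    obtain w where w: "(y', w) \<in> (rstep R)\<^sup>*" "(z', w) \<in> (rstep R)\<^sup>*"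
      using local_confluence[OF y'(1) z'(1)] unfolding joinable_def by blast
    obtain a where a: "(y, a) \<in> (rstep R)\<^sup>*" "(w, a) \<in> (rstep R)\<^sup>*"
      using 1(1)[of y' y w] y' w unfolding joinable_def by blast
    obtain b where "(a, b) \<in> (rstep R)\<^sup>*" "(z, b) \<in> (rstep R)\<^sup>*"
      using 1(1)[of z' a z] z' w(2) a(2) unfolding joinable_def by (meson converse_iff rtrancl_trans)
    then show ?thesis using a(1) unfolding joinable_def by (meson rtrancl_trans)
  qed
qed

definition norm_form :: "('v \<Rightarrow>\<^sub>0 nat) option \<Rightarrow> ('v \<Rightarrow>\<^sub>0 nat) option" where
  "norm_form x = (SOME y. (x, y) \<in> (rstep R)\<^sup>* \<and> y \<notin> Domain (rstep R))"

lemma norm_form: "(x, norm_form x) \<in> (rstep R)\<^sup>*" "norm_form x \<notin> Domain (rstep R)"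
proof -
  have "\<exists>y. (x, y) \<in> (rstep R)\<^sup>* \<and> y \<notin> Domain (rstep R)"
    using wfE_min[OF wf_rstep, of x "(rstep R)\<^sup>* `` {x}"]
    by (metis Domain.cases Image_singleton_iff converse_iff rtrancl.simps)
  then show "(x, norm_form x) \<in> (rstep R)\<^sup>*" "norm_form x \<notin> Domain (rstep R)"
    unfolding norm_form_def by (metis (mono_tags, lifting) someI_ex)+
qed

lemma norm_form_unique:
  assumes "(x, y) \<in> (rstep R)\<^sup>*" "y \<notin> Domain (rstep R)"
  shows "norm_form x = y"
proof -
  obtain z where "(norm_form x, z) \<in> (rstep R)\<^sup>*" "(y, z) \<in> (rstep R)\<^sup>*"
    using confluence[OF norm_form(1) assms(1)] unfolding joinable_def by blast
  then show ?thesis using norm_form(2) assms(2) by (metis Domain.intros converse_rtranclE)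
qed

lemma norm_form_rsteps: "(x, y) \<in> (rstep R)\<^sup>* \<Longrightarrow> norm_form x = norm_form y"
  by (rule norm_form_unique[OF rtrancl_trans[OF _ norm_form(1)] norm_form(2)])

lemma norm_form_joinable: "joinable R x y \<Longrightarrow> norm_form x = norm_form y"
  unfolding joinable_def by (metis norm_form_rsteps)

lemma norm_form_None [simp]: "norm_form None = None"
  by (rule norm_form_unique) (auto simp: rstep_def)

lemma norm_form_add:
  assumes "norm_form x = norm_form y"
  shows "norm_form (map_option (\<lambda>u. u + t) x) = norm_form (map_option (\<lambda>u. u + t) y)"
  using norm_form_rsteps[OF rsteps_add[OF norm_form(1)[of x]], of t]
    norm_form_rsteps[OF rsteps_add[OF norm_form(1)[of y]], of t] assms by simp

lemma norm_form_decreasing: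
  assumes "norm_form (Some u) = Some v" shows "v = u \<or> wt v < wt u"
proof -
  have "x \<noteq> None \<and> (the x = u \<or> wt (the x) < wt u)" if "(Some u, x) \<in> (rstep R)\<^sup>*" "x \<noteq> None" for x
    using that
  proof (induction rule: rtrancl_induct)
    case (step x y)
    then obtain a b where "x = Some a" "y = Some b" by (auto simp: rstep_def)
    then show ?case using step rstep_wt[of a b] by auto
  qed simp
  from this[OF norm_form(1)[of "Some u", unfolded assms]] show ?thesis by simp
qed

end

locale squarefree_rewriting = rewriting +
  assumes rule_squarefree: "(l, ro) \<in> R \<Longrightarrow> Poly_Mapping.lookup l v \<le> 1"
begin

text \<open>A squarefree lead divides a monomial as soon as its variables occur in it. Reducibility
  thus depends on the support alone, which yields the axiom \<open>squarefree\<close> below.\<close>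

lemma reducible_iff:
  "Some u \<in> Domain (rstep R) \<longleftrightarrow> (\<exists>(l, ro) \<in> R. Poly_Mapping.keys l \<subseteq> Poly_Mapping.keys u)"
proof
  assume "Some u \<in> Domain (rstep R)"
  then show "\<exists>(l, ro) \<in> R. Poly_Mapping.keys l \<subseteq> Poly_Mapping.keys u"
    by (fastforce simp: rstep_def keys_add_nat)
next
  assume "\<exists>(l, ro) \<in> R. Poly_Mapping.keys l \<subseteq> Poly_Mapping.keys u"
  then obtain l ro where l: "(l, ro) \<in> R" "Poly_Mapping.keys l \<subseteq> Poly_Mapping.keys u" by blast
  have "u = l + (u - l)"
  proof (rule poly_mapping_eqI)
    fix v
    show "Poly_Mapping.lookup u v = Poly_Mapping.lookup (l + (u - l)) v"
    proof (cases "v \<in> Poly_Mapping.keys l")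
      case True
      then have "Poly_Mapping.lookup u v \<noteq> 0" using subsetD[OF l(2)] by (simp add: in_keys_iff)
      then show ?thesis
        using rule_squarefree[OF l(1), of v] by (simp add: lookup_add lookup_minus)
    qed (simp add: lookup_add lookup_minus in_keys_iff)
  qed
  then show "Some u \<in> Domain (rstep R)" using l(1) unfolding rstep_def by blast
qed

sublocale squarefree_normal_form "\<lambda>u. norm_form (Some u)" wt
proof
  show "wt (u + v) = wt u + wt v" for u v by (rule wt_add)
  show "v = u \<or> wt v < wt u" if "norm_form (Some u) = Some v" for u v
    by (rule norm_form_decreasing[OF that])
  show "norm_form (Some v) = Some v" if "norm_form (Some u) = Some v" for u v
    using norm_form_rsteps[OF norm_form(1)] that by metis
  show "norm_form (Some (u + t)) = norm_form (Some (v + t))"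
    if "norm_form (Some u) = norm_form (Some v)" for u v t
    using norm_form_add[OF that, of t] by simp
  show "norm_form (Some (u + t)) = None" if "norm_form (Some u) = None" for u t
    using norm_form_add[of "Some u" None t] that by simp
  show "norm_form (Some v) = Some v"
    if "norm_form (Some u) = Some u" "Poly_Mapping.keys v \<subseteq> Poly_Mapping.keys u" for u v
  proof (rule norm_form_unique)
    have "Some u \<notin> Domain (rstep R)" using norm_form(2)[of "Some u"] that(1) by simp
    then show "Some v \<notin> Domain (rstep R)" using that(2) by (auto simp: reducible_iff)
  qed simp
qed

end

definition mweight :: "('v \<Rightarrow> nat) \<Rightarrow> ('v \<Rightarrow>\<^sub>0 nat) \<Rightarrow> nat" where
  "mweight w m = (\<Sum>v\<in>Poly_Mapping.keys m. Poly_Mapping.lookup m v * w v)"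

lemma mweight_superset:
  assumes "finite B" "Poly_Mapping.keys m \<subseteq> B"
  shows "mweight w m = (\<Sum>v\<in>B. Poly_Mapping.lookup m v * w v)"
  unfolding mweight_def using assms by (intro sum.mono_neutral_left) (auto simp: in_keys_iff)

lemma mweight_add: "mweight w (u + v) = mweight w u + mweight w v"
  using mweight_superset[of "Poly_Mapping.keys (u + v)" u w]
    mweight_superset[of "Poly_Mapping.keys (u + v)" v w]
  by (simp add: keys_add_nat mweight_def[of w "u + v"] lookup_add distrib_right sum.distrib)

lemma mweight_zero [simp]: "mweight w 0 = 0"
  by (simp add: mweight_def)

lemma mweight_single [simp]: "mweight w (Poly_Mapping.single v n) = n * w v"
  by (simp add: mweight_def)

section \<open>Radicality criteria\<close>

lemma null_if_vanishing:
  assumes "squarefree_normal_form \<nu> wt"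
    and "\<And>p. p \<in> A \<Longrightarrow> \<nu> (diag p) = \<nu> (anti p)" "vanishing A f"
  shows "squarefree_normal_form.null \<nu> f"
proof -
  interpret squarefree_normal_form \<nu> wt by fact
  have "move_closed A (\<lambda>m. \<nu> m = Some v)" for v
    unfolding move_closed_def using add_cong[OF assms(2)] by simp
  then show ?thesis using assms(3) by (simp add: null_def vanishing_def)
qed

text \<open>With \<open>h = 0\<close> the rules belong to the ideal itself; other \<open>h\<close>
  admit rules that belong to it only after multiplication by \<open>h\<close>, that is, to a
  saturation.\<close>

lemma rsteps_cong:
  assumes "\<And>l ro. (l, ro) \<in> R \<Longrightarrow> \<exists>r. ro = Some r \<and> cong A (h + l) (h + r)"
    and "(Some u, x) \<in> (rstep R)\<^sup>*"
  shows "\<exists>v. x = Some v \<and> cong A (h + u) (h + v)"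
  using assms(2)
proof (induction rule: rtrancl_induct)
  case base
  show ?case by (auto intro: cong_refl)
next
  case (step y z)
  then obtain v where v: "y = Some v" "cong A (h + u) (h + v)" by blast
  from step(2) v(1) obtain l ro t where l: "(l, ro) \<in> R" "v = l + t" "z = map_option (\<lambda>r. r + t) ro"
    by (auto simp: rstep_def)
  then obtain r where r: "ro = Some r" "cong A (h + l) (h + r)" using assms(1) by blast
  have "cong A (h + v) (h + (r + t))" using cong_add[OF r(2), of t] l(2) by (simp add: add.assoc)
  then show ?case using v(2) l(3) r(1) cong_trans by auto
qed

lemma norm_form_cong:
  assumes "rewriting R wt"
    and rules: "\<And>l ro. (l, ro) \<in> R \<Longrightarrow> \<exists>r. ro = Some r \<and> cong A (h + l) (h + r)"
    and eq: "rewriting.norm_form R (Some u) = rewriting.norm_form R (Some v)"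
  shows "cong A (h + u) (h + v)"
proof -
  interpret rewriting R wt by fact
  obtain a where a: "norm_form (Some u) = Some a" "cong A (h + u) (h + a)"
    using rsteps_cong[OF rules norm_form(1)[of "Some u"]] by auto
  obtain b where "norm_form (Some v) = Some b" "cong A (h + v) (h + b)"
    using rsteps_cong[OF rules norm_form(1)[of "Some v"]] by auto
  then show ?thesis using a eq cong_sym cong_trans by (metis option.inject)
qed

text \<open>By \<open>rules\<close> the rewriting system stays inside the ideal and by
  \<open>moves\<close> it generates the ideal, so its normal forms represent exactly the classes of
  \<open>cong\<close>.\<close>

lemma radical_at_of_rewriting:
  assumes "squarefree_rewriting R wt"
    and rules: "\<And>l ro. (l, ro) \<in> R \<Longrightarrow> \<exists>r. ro = Some r \<and> cong A l r"
    and moves: "\<And>p. p \<in> A \<Longrightarrow> joinable R (Some (diag p)) (Some (anti p))"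
  shows "radical_at K A"
proof -
  interpret squarefree_rewriting R wt by fact
  have rules': "\<exists>r. ro = Some r \<and> cong A (0 + l) (0 + r)" if "(l, ro) \<in> R" for l ro
    using rules[OF that] by simp
  show ?thesis unfolding radical_at_def
  proof (intro ballI allI impI)
    fix f :: "(point, 'a) mpoly" and n :: nat
    assume "vanishing A (f ^ n)"
    then have "null (f ^ n)"
      using null_if_vanishing[OF squarefree_normal_form_axioms] norm_form_joinable[OF moves] by blast
    then have "null f" by (rule null_power)
    show "vanishing A f" unfolding vanishing_def
    proof (intro allI impI)
      fix P assume P: "move_closed A P"
      show "coeff_sum P f = 0"
      proof (rule null_saturated[OF \<open>null f\<close>])
        show "P v" if "norm_form (Some u) = norm_form (Some v)" "P u" for u v
          using norm_form_cong[OF rewriting_axioms rules' that(1)] move_closed_cong[OF P] that(2) by simp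
        show "\<not> P u" if "norm_form (Some u) = None" for u
          using rsteps_cong[OF rules' norm_form(1)[of "Some u"]] that by simp
      qed
    qed
  qed
qed

definition lead :: "(point \<Rightarrow> bool) \<Rightarrow> point \<Rightarrow> point \<Rightarrow>\<^sub>0 nat" where
  "lead d p = (if d p then diag p else anti p)"

definition trail :: "(point \<Rightarrow> bool) \<Rightarrow> point \<Rightarrow> point \<Rightarrow>\<^sub>0 nat" where
  "trail d p = (if d p then anti p else diag p)"

lemma lookup_two_vars_le:
  "a \<noteq> b \<Longrightarrow> Poly_Mapping.lookup (var_exp a + var_exp b) v \<le> 1"
  by (auto simp: lookup_add lookup_single when_def)

lemma lookup_diag_le: "Poly_Mapping.lookup (diag p) v \<le> 1"
  and lookup_anti_le: "Poly_Mapping.lookup (anti p) v \<le> 1"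
  by (cases p, simp only: diag.simps anti.simps, intro lookup_two_vars_le, simp)+

lemma cong_lead_trail: "p \<in> A \<Longrightarrow> cong A (lead d p) (trail d p)"
  using cong_move[of p A 0] cong_sym by (simp add: lead_def trail_def)

text \<open>Disjoint leads leave no overlap to resolve, so the minors themselves form a Groebner
  basis.\<close>

lemma radical_at_of_disjoint_leads:
  assumes disj: "\<And>p q. p \<in> A \<Longrightarrow> q \<in> A \<Longrightarrow> p \<noteq> q \<Longrightarrow>
      Poly_Mapping.keys (lead d p) \<inter> Poly_Mapping.keys (lead d q) = {}"
    and wt: "\<And>p. p \<in> A \<Longrightarrow> mweight w (trail d p) < mweight w (lead d p)"
  shows "radical_at K A"
proof (rule radical_at_of_rewriting)
  let ?R = "(\<lambda>p. (lead d p, Some (trail d p))) ` A"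
  show "squarefree_rewriting ?R (mweight w)"
  proof
    show "joinable ?R (map_option (\<lambda>r. r + (l2 - l1)) r1) (map_option (\<lambda>r. r + (l1 - l2)) r2)"
      if "(l1, r1) \<in> ?R" "(l2, r2) \<in> ?R" "(l1, r1) \<noteq> (l2, r2)"
        "Poly_Mapping.keys l1 \<inter> Poly_Mapping.keys l2 \<noteq> {}" for l1 r1 l2 r2
      using that disj by blast
    show "mweight w r < mweight w l" if "(l, Some r) \<in> ?R" for l r
      using that wt by blast
    show "Poly_Mapping.lookup l v \<le> 1" if "(l, ro) \<in> ?R" for l ro v
    proof -
      from that obtain p where "l = lead d p" by blast
      then show ?thesis using lookup_diag_le[of p v] lookup_anti_le[of p v] by (simp add: lead_def)
    qed
  qed (rule mweight_add)
  show "\<exists>r. ro = Some r \<and> cong A l r" if "(l, ro) \<in> ?R" for l ro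
    using that cong_lead_trail by blast
  show "joinable ?R (Some (diag p)) (Some (anti p))" if "p \<in> A" for p
  proof -
    have "(Some (lead d p + 0), map_option (\<lambda>r. r + 0) (Some (trail d p))) \<in> rstep ?R"
      unfolding rstep_def using that by blast
    then show ?thesis unfolding joinable_def lead_def trail_def
      by (cases "d p") (auto intro: r_into_rtrancl)
  qed
qed

section \<open>Executable monomials\<close>

text \<open>Lists serve as multisets of variables. Their order is immaterial, so equality of
  monomials is tested by \<open>take_out\<close> and not by equality of lists.\<close>

fun mon_of :: "'v list \<Rightarrow> 'v \<Rightarrow>\<^sub>0 nat" where
  "mon_of [] = 0"
| "mon_of (x # xs) = var_exp x + mon_of xs"

lemma mon_append: "mon_of (xs @ ys) = mon_of xs + mon_of ys"
  by (induction xs) (simp_all add: add.assoc)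

lemma lookup_mon: "Poly_Mapping.lookup (mon_of xs) v = count_list xs v"
  by (induction xs) (simp_all add: lookup_add lookup_single when_def)

lemma keys_mon: "Poly_Mapping.keys (mon_of xs) = set xs"
  by (induction xs) (simp_all add: keys_add_nat)

lemma mweight_mon: "mweight w (mon_of xs) = sum_list (map w xs)"
  by (induction xs) (simp_all add: mweight_add)

lemma mon_remove1: "mon_of (remove1 x xs) = mon_of xs - var_exp x"
  by (rule poly_mapping_eqI, induction xs)
    (auto simp: lookup_minus lookup_add lookup_single when_def lookup_mon)

lemma mon_fold_remove1: "mon_of (fold remove1 ys xs) = mon_of xs - mon_of ys"
  by (induction ys arbitrary: xs) (simp_all add: mon_remove1 diff_diff_add)

fun take_out :: "'v list \<Rightarrow> 'v list \<Rightarrow> 'v list option" where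
  "take_out [] ys = Some ys"
| "take_out (x # xs) ys = (if List.member ys x then take_out xs (remove1 x ys) else None)"

lemma mon_remove1_member: "x \<in> set xs \<Longrightarrow> mon_of xs = var_exp x + mon_of (remove1 x xs)"
  by (induction xs) (auto simp: ac_simps)

lemma take_out_mon: "take_out xs ys = Some zs \<Longrightarrow> mon_of ys = mon_of xs + mon_of zs"
  by (induction xs arbitrary: ys)
    (auto simp: add.assoc mon_remove1_member split: if_splits)

type_synonym 'v list_rule = "'v list \<times> 'v list option"

definition rules_of :: "'v list_rule list \<Rightarrow> 'v rule set" where
  "rules_of rs = (\<lambda>(l, ro). (mon_of l, map_option mon_of ro)) ` set rs"

fun rewrite1 :: "'v list_rule list \<Rightarrow> 'v list \<Rightarrow> 'v list option option" where
  "rewrite1 [] u = None"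
| "rewrite1 ((l, ro) # rs) u = (case take_out l u of
      None \<Rightarrow> rewrite1 rs u | Some s \<Rightarrow> Some (map_option (\<lambda>r. r @ s) ro))"

fun list_nf :: "nat \<Rightarrow> 'v list_rule list \<Rightarrow> 'v list option \<Rightarrow> 'v list option" where
  "list_nf 0 rs x = x"
| "list_nf (Suc k) rs x = (case x of None \<Rightarrow> None | Some u \<Rightarrow>
      (case rewrite1 rs u of None \<Rightarrow> x | Some y \<Rightarrow> list_nf k rs y))"

lemma rewrite1_rstep:
  "rewrite1 rs u = Some y \<Longrightarrow> (Some (mon_of u), map_option mon_of y) \<in> rstep (rules_of rs)"
proof (induction rs u rule: rewrite1.induct)
  case (2 l ro rs u)
  show ?case
  proof (cases "take_out l u")
    case None
    then show ?thesis using 2 unfolding rstep_def rules_of_def by fastforce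
  next
    case (Some s)
    then have "mon_of u = mon_of l + mon_of s" "y = map_option (\<lambda>r. r @ s) ro"
      using 2(2) take_out_mon by auto
    then have "Some (mon_of u) = Some (mon_of l + mon_of s)"
      "map_option mon_of y = map_option (\<lambda>r. r + mon_of s) (map_option mon_of ro)"
      by (simp_all add: option.map_comp comp_def mon_append)
    moreover have "(mon_of l, map_option mon_of ro) \<in> rules_of ((l, ro) # rs)" by (auto simp: rules_of_def)
    ultimately show ?thesis unfolding rstep_def by blast
  qed
qed simp

lemma normalize_rsteps:
  "(map_option mon_of x, map_option mon_of (list_nf k rs x)) \<in> (rstep (rules_of rs))\<^sup>*"
proof (induction k rs x rule: list_nf.induct)
  case (2 k rs x)
  show ?case
  proof (cases x)
    case (Some u)
    show ?thesis
    proof (cases "rewrite1 rs u")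
      case (Some y)
      from converse_rtrancl_into_rtrancl[OF rewrite1_rstep[OF this] 2[OF \<open>x = Some u\<close> this]]
      show ?thesis by (simp add: \<open>x = Some u\<close> Some)
    qed (simp add: Some)
  qed simp
qed simp

fun same_mon :: "'v list option \<Rightarrow> 'v list option \<Rightarrow> bool" where
  "same_mon None None = True"
| "same_mon (Some u) (Some v) = (take_out u v = Some [])"
| "same_mon _ _ = False"

lemma same_mon: "same_mon x y \<Longrightarrow> map_option mon_of x = map_option mon_of y"
  by (induction x y rule: same_mon.induct) (auto dest: take_out_mon)

text \<open>The number 20 bounds the rewriting steps. A bound that is too small can only make the
  check fail, as \<open>normalize_rsteps\<close> holds for every bound.\<close>

definition check_joinable :: "'v list_rule list \<Rightarrow> 'v list option \<Rightarrow> 'v list option \<Rightarrow> bool" where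
  "check_joinable rs x y \<longleftrightarrow> same_mon (list_nf 20 rs x) (list_nf 20 rs y)"

lemma check_joinable:
  "check_joinable rs x y \<Longrightarrow> joinable (rules_of rs) (map_option mon_of x) (map_option mon_of y)"
  unfolding joinable_def check_joinable_def using normalize_rsteps same_mon by metis

definition weight_of :: "('v \<times> nat) list \<Rightarrow> 'v \<Rightarrow> nat" where
  "weight_of ws v = (case map_of ws v of None \<Rightarrow> 0 | Some n \<Rightarrow> n)"

definition check_rules :: "('v \<times> nat) list \<Rightarrow> 'v list_rule list \<Rightarrow> bool" where
  "check_rules ws rs \<longleftrightarrow>
     list_all (\<lambda>(l, ro). case ro of None \<Rightarrow> True |
       Some r \<Rightarrow> sum_list (map (weight_of ws) r) < sum_list (map (weight_of ws) l)) rs \<and>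
     list_all (\<lambda>(l1, r1). list_all (\<lambda>(l2, r2).
       list_all (\<lambda>x. \<not> List.member l2 x) l1 \<or>
       check_joinable rs (map_option (\<lambda>r. r @ fold remove1 l1 l2) r1)
         (map_option (\<lambda>r. r @ fold remove1 l2 l1) r2)) rs) rs"

lemma check_rules_rewriting:
  fixes rs :: "'v::linorder list_rule list"
  assumes "check_rules ws rs"
  shows "rewriting (rules_of rs) (mweight (weight_of ws))"
proof
  fix l r
  assume "(l, Some r) \<in> rules_of rs"
  then obtain a bo where "(a, bo) \<in> set rs" "l = mon_of a" "Some r = map_option mon_of bo"
    unfolding rules_of_def by auto
  moreover from this obtain b where "bo = Some b" "r = mon_of b" by (cases bo) auto
  ultimately have *: "(a, Some b) \<in> set rs" "l = mon_of a" "r = mon_of b" by auto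
  from *(1) have "sum_list (map (weight_of ws) b) < sum_list (map (weight_of ws) a)"
    using assms unfolding check_rules_def list_all_iff by fastforce
  then show "mweight (weight_of ws) r < mweight (weight_of ws) l"
    by (simp add: * mweight_mon)
next
  fix l1 r1 l2 r2
  assume R: "(l1, r1) \<in> rules_of rs" "(l2, r2) \<in> rules_of rs"
    and ov: "Poly_Mapping.keys l1 \<inter> Poly_Mapping.keys l2 \<noteq> {}"
  obtain a1 b1 a2 b2 where *: "(a1, b1) \<in> set rs" "l1 = mon_of a1" "r1 = map_option mon_of b1"
    "(a2, b2) \<in> set rs" "l2 = mon_of a2" "r2 = map_option mon_of b2"
    using R unfolding rules_of_def by auto
  have "check_joinable rs (map_option (\<lambda>r. r @ fold remove1 a1 a2) b1)
      (map_option (\<lambda>r. r @ fold remove1 a2 a1) b2)"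
    using assms ov * unfolding check_rules_def by (fastforce simp: list_all_iff keys_mon)
  from check_joinable[OF this]
  show "joinable (rules_of rs) (map_option (\<lambda>r. r + (l2 - l1)) r1) (map_option (\<lambda>r. r + (l1 - l2)) r2)"
    by (simp add: * option.map_comp comp_def mon_append mon_fold_remove1)
qed (rule mweight_add)

lemma distinct_count_list: "distinct xs \<Longrightarrow> count_list xs v \<le> 1"
  by (induction xs) auto

lemma check_rules_squarefree_rewriting:
  fixes rs :: "'v::linorder list_rule list"
  assumes "check_rules ws rs" "list_all (\<lambda>(l, ro). distinct l) rs"
  shows "squarefree_rewriting (rules_of rs) (mweight (weight_of ws))"
proof -
  interpret rewriting "rules_of rs" "mweight (weight_of ws)"
    by (rule check_rules_rewriting[OF assms(1)])
  show ?thesis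
  proof
    show "Poly_Mapping.lookup l v \<le> 1" if "(l, ro) \<in> rules_of rs" for l ro v
      using that assms(2) using distinct_count_list by (fastforce simp: rules_of_def lookup_mon list_all_iff)
  qed
qed

fun diag_list :: "point \<Rightarrow> point list" where
  "diag_list (i, j) = [(i, j), (i + 1, j + 1)]"

fun anti_list :: "point \<Rightarrow> point list" where
  "anti_list (i, j) = [(i, j + 1), (i + 1, j)]"

lemma mon_of_diag_list: "mon_of (diag_list p) = diag p"
  and mon_of_anti_list: "mon_of (anti_list p) = anti p"
  by (cases p; simp add: diag.simps anti.simps)+

definition replaces :: "point list \<Rightarrow> point list \<Rightarrow> point list \<Rightarrow> point list \<Rightarrow> bool" where
  "replaces l r u v \<longleftrightarrow> (case take_out l u of None \<Rightarrow> False | Some s \<Rightarrow> take_out (r @ s) v = Some [])"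

definition move_step :: "point list \<Rightarrow> point list \<Rightarrow> point list \<Rightarrow> bool" where
  "move_step A u v \<longleftrightarrow> list_ex (\<lambda>p. replaces (diag_list p) (anti_list p) u v \<or>
     replaces (anti_list p) (diag_list p) u v) A"

fun move_path :: "point list \<Rightarrow> point list list \<Rightarrow> bool" where
  "move_path A [] = True"
| "move_path A [u] = True"
| "move_path A (u # v # us) = (move_step A u v \<and> move_path A (v # us))"

lemma replaces_mon:
  "replaces l r u v \<Longrightarrow> \<exists>t. mon_of u = mon_of l + t \<and> mon_of v = mon_of r + t"
  unfolding replaces_def by (auto dest!: take_out_mon simp: mon_append split: option.splits)

lemma move_step_cong:
  assumes "move_step A u v" shows "cong (set A) (mon_of u) (mon_of v)"
proof -
  obtain p where p: "p \<in> set A"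
    "replaces (diag_list p) (anti_list p) u v \<or> replaces (anti_list p) (diag_list p) u v"
    using assms unfolding move_step_def list_ex_iff by blast
  then obtain t where "mon_of u = diag p + t \<and> mon_of v = anti p + t \<or>
      mon_of u = anti p + t \<and> mon_of v = diag p + t"
    using replaces_mon unfolding mon_of_diag_list[symmetric] mon_of_anti_list[symmetric] by blast
  then show ?thesis using cong_move[OF p(1), of t] cong_sym by auto
qed

lemma move_path_cong: "move_path A (u # us) \<Longrightarrow> cong (set A) (mon_of u) (mon_of (last (u # us)))"
proof (induction us arbitrary: u)
  case (Cons v us)
  then show ?case using move_step_cong[of A u v] cong_trans by auto
qed (simp add: cong_refl)

lemma move_path_hd_last:
  "move_path A us \<Longrightarrow> us \<noteq> [] \<Longrightarrow> cong (set A) (mon_of (hd us)) (mon_of (last us))"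
  using move_path_cong[of A "hd us" "tl us"] by simp

definition path_rules :: "point list list list \<Rightarrow> point list_rule list" where
  "path_rules = map (\<lambda>us. (hd us, Some (last us)))"

definition check_moves :: "point list_rule list \<Rightarrow> point list \<Rightarrow> bool" where
  "check_moves rs A \<longleftrightarrow> list_all (\<lambda>p. check_joinable rs (Some (diag_list p)) (Some (anti_list p))) A"

lemma check_moves:
  "check_moves rs A \<Longrightarrow> p \<in> set A \<Longrightarrow> joinable (rules_of rs) (Some (diag p)) (Some (anti p))"
  unfolding check_moves_def list_all_iff
  using check_joinable[of rs "Some (diag_list p)" "Some (anti_list p)"]
  by (simp add: mon_of_diag_list mon_of_anti_list)

definition check_squarefree :: "point list_rule list \<Rightarrow> bool" where
  "check_squarefree rs \<longleftrightarrow> list_all (\<lambda>(l, ro). distinct l) rs"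

definition check_paths :: "point list \<Rightarrow> point list list list \<Rightarrow> bool" where
  "check_paths A ps \<longleftrightarrow> list_all (\<lambda>us. us \<noteq> [] \<and> move_path A us) ps"

lemma radical_at_of_check:
  assumes "check_rules ws (path_rules ps)" "check_squarefree (path_rules ps)"
    "check_paths A ps" "check_moves (path_rules ps) A"
  shows "radical_at K (set A)"
proof (rule radical_at_of_rewriting)
  show "squarefree_rewriting (rules_of (path_rules ps)) (mweight (weight_of ws))"
    using check_rules_squarefree_rewriting assms(1,2) unfolding check_squarefree_def .
  show "\<exists>r. ro = Some r \<and> cong (set A) l r" if "(l, ro) \<in> rules_of (path_rules ps)" for l ro
    using that move_path_hd_last[of A] assms(3)
    unfolding rules_of_def path_rules_def check_paths_def by (fastforce simp: list_all_iff)
  show "joinable (rules_of (path_rules ps)) (Some (diag p)) (Some (anti p))" if "p \<in> set A" for p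
    using check_moves[OF assms(4) that] .
qed

section \<open>Gluing two reduced quotients\<close>

lemma coeff_sum_split:
  "coeff_sum P f = coeff_sum (\<lambda>m. P m \<and> Q m) f + coeff_sum (\<lambda>m. P m \<and> \<not> Q m) f"
proof -
  have "coeff_sum P f = (\<Sum>m\<in>Poly_Mapping.keys f.
      (if P m \<and> Q m then Poly_Mapping.lookup f m else 0) +
      (if P m \<and> \<not> Q m then Poly_Mapping.lookup f m else 0))"
    unfolding coeff_sum_def by (rule sum.cong) simp_all
  then show ?thesis by (simp only: coeff_sum_def sum.distrib)
qed

text \<open>A reduced quotient in which the monomial \<open>h\<close> is killed and a reduced quotient that is
  injective on the multiples of \<open>h\<close> together detect nilpotents.\<close>

lemma radical_at_glue:
  fixes h :: "point \<Rightarrow>\<^sub>0 nat"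
  assumes H: "squarefree_normal_form \<nu>H wH" and J: "squarefree_normal_form \<nu>J wJ"
    and moves: "\<And>p. p \<in> A \<Longrightarrow> \<nu>H (diag p) = \<nu>H (anti p)" "\<And>p. p \<in> A \<Longrightarrow> \<nu>J (diag p) = \<nu>J (anti p)"
    and H_cong: "\<And>u v. \<nu>H u = \<nu>H v \<Longrightarrow> \<nu>H u \<noteq> None \<Longrightarrow> cong A u v"
    and H_None: "\<And>u. \<nu>H u = None \<Longrightarrow> \<exists>u'. cong A u (h + u')"
    and J_cong: "\<And>u v. \<nu>J (h + u) = \<nu>J (h + v) \<Longrightarrow> cong A (h + u) (h + v)"
    and J_total: "\<And>u. \<nu>J u \<noteq> None"
  shows "radical_at K A"
  unfolding radical_at_def
proof (intro ballI allI impI)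
  interpret H: squarefree_normal_form \<nu>H wH by (rule H)
  interpret J: squarefree_normal_form \<nu>J wJ by (rule J)
  fix f :: "(point, 'a) mpoly" and n :: nat
  assume "vanishing A (f ^ n)"
  then have fnH: "H.null (f ^ n)" and fnJ: "J.null (f ^ n)"
    using null_if_vanishing[OF H moves(1), of A "f ^ n"] null_if_vanishing[OF J moves(2), of A "f ^ n"]
    by simp_all
  have fH: "H.null f" by (rule H.null_power[OF fnH])
  have fJ: "J.null f" by (rule J.null_power[OF fnJ])
  have \<nu>H_eq: "\<nu>H u = \<nu>H v" if "cong A u v" for u v
    using that
  proof (induction rule: cong.induct)
    case (cong_move p t)
    then show ?case using H.add_cong moves(1) by blast
  qed simp_all
  have \<nu>J_eq: "\<nu>J u = \<nu>J v" if "cong A u v" for u v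
    using that
  proof (induction rule: cong.induct)
    case (cong_move p t)
    then show ?case using J.add_cong moves(2) by blast
  qed simp_all
  let ?Q = "\<lambda>m. \<nu>H m \<noteq> None"
  have Q: "coeff_sum (\<lambda>m. P m \<and> ?Q m) f = 0" if P: "move_closed A P" for P
  proof (rule H.null_saturated[OF fH])
    show "P v \<and> ?Q v" if "\<nu>H u = \<nu>H v" "P u \<and> ?Q u" for u v
      using that H_cong[of u v] move_closed_cong[OF P, of u v] by auto
  qed simp
  show "vanishing A f" unfolding vanishing_def
  proof (intro allI impI)
    fix P assume P: "move_closed A P"
    \<comment> \<open>\<open>P\<close> need not be a union of fibres of \<open>\<nu>J\<close>.
      \<open>P'\<close> is the union of those fibres that meet \<open>P\<close> in a monomial killed
      by \<open>\<nu>H\<close>; on killed monomials, which are congruent to multiples of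
      \<open>h\<close>, it agrees with \<open>P\<close>, and on the others \<open>Q\<close>
      applies.\<close>
    define P' where "P' m \<longleftrightarrow> (\<exists>u. P u \<and> \<nu>H u = None \<and> \<nu>J m = \<nu>J u)" for m
    have "coeff_sum P' f = 0"
      by (rule J.null_saturated[OF fJ]) (auto simp: P'_def J_total)
    moreover have "coeff_sum (\<lambda>m. P' m \<and> ?Q m) f = 0"
    proof (rule Q)
      show "move_closed A P'" unfolding move_closed_def P'_def
        using \<nu>J_eq[OF cong_move] by simp
    qed
    moreover have "P' m \<and> \<not> ?Q m \<longleftrightarrow> P m \<and> \<not> ?Q m" for m
    proof
      assume m: "P' m \<and> \<not> ?Q m"
      then obtain u where u: "P u" "\<nu>H u = None" "\<nu>J m = \<nu>J u" by (auto simp: P'_def)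
      obtain m' u' where mu: "cong A m (h + m')" "cong A u (h + u')"
        using H_None m u(2) by blast
      then have "\<nu>J (h + m') = \<nu>J (h + u')" using \<nu>J_eq u(3) by metis
      then have "cong A (h + m') (h + u')" by (rule J_cong)
      then have "cong A m u" using cong_trans[OF mu(1)] cong_trans[OF _ cong_sym[OF mu(2)]] by blast
      then show "P m \<and> \<not> ?Q m" using m move_closed_cong[OF P] u(1) by blast
    qed (auto simp: P'_def)
    ultimately have "coeff_sum (\<lambda>m. P m \<and> \<not> ?Q m) f = 0"
      using coeff_sum_split[of P' f ?Q] by simp
    then show "coeff_sum P f = 0" using Q[OF P] coeff_sum_split[of P f ?Q] by simp
  qed
qed

lemma rsteps_cong_None:
  assumes Some: "\<And>l r. (l, Some r) \<in> R \<Longrightarrow> cong A l r"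
    and None: "\<And>l. (l, None) \<in> R \<Longrightarrow> \<exists>s. cong A l (h + s)"
    and "(Some u, x) \<in> (rstep R)\<^sup>*"
  shows "case x of Some v \<Rightarrow> cong A u v | None \<Rightarrow> \<exists>s. cong A u (h + s)"
  using assms(3)
proof (induction rule: rtrancl_induct)
  case base
  show ?case by (simp add: cong_refl)
next
  case (step y z)
  from step(2) obtain l ro t where l: "(l, ro) \<in> R" "y = Some (l + t)" "z = map_option (\<lambda>r. r + t) ro"
    by (auto simp: rstep_def)
  then have u: "cong A u (l + t)" using step(3) by simp
  show ?case
  proof (cases ro)
    case None
    then obtain s where "cong A l (h + s)" using l(1) assms(2) by blast
    from cong_trans[OF u cong_add[OF this, of t]] show ?thesis
      by (auto simp: l(3) None add.assoc)
  next
    case (Some r)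
    then have "cong A l r" using l(1) assms(1) by blast
    from cong_trans[OF u cong_add[OF this, of t]] show ?thesis by (simp add: l(3) Some)
  qed
qed

lemma (in rewriting) norm_form_preserved:
  assumes "\<And>l ro. (l, ro) \<in> S \<Longrightarrow> joinable R (Some l) ro" "(x, y) \<in> (rstep S)\<^sup>*"
  shows "norm_form x = norm_form y"
  using assms(2)
proof (induction rule: rtrancl_induct)
  case (step y z)
  from step(2) obtain l ro t where "(l, ro) \<in> S" "y = Some (l + t)" "z = map_option (\<lambda>r. r + t) ro"
    by (auto simp: rstep_def)
  then show ?case using norm_form_add[OF norm_form_joinable[OF assms(1)], of l ro t] step(3) by simp
qed simp

text \<open>If no lead contains \<open>x\<close>, then multiplication by \<open>x\<close> keeps
  normal monomials normal and commutes with taking normal forms. Hence \<open>x\<close> is not a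
  zero divisor in the quotient.\<close>

lemma (in rewriting) norm_form_add_var:
  assumes "\<And>l ro. (l, ro) \<in> R \<Longrightarrow> x \<notin> Poly_Mapping.keys l"
    and eq: "norm_form (Some (var_exp x + u)) = norm_form (Some (var_exp x + v))"
  shows "norm_form (Some u) = norm_form (Some v)"
proof -
  have *: "norm_form (Some (var_exp x + u)) = map_option (\<lambda>w. w + var_exp x) (norm_form (Some u))" for u
  proof (rule norm_form_unique)
    show "(Some (var_exp x + u), map_option (\<lambda>w. w + var_exp x) (norm_form (Some u))) \<in> (rstep R)\<^sup>*"
      using rsteps_add[OF norm_form(1)[of "Some u"], of "var_exp x"] by (simp add: add.commute)
    show "map_option (\<lambda>w. w + var_exp x) (norm_form (Some u)) \<notin> Domain (rstep R)"
    proof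
      assume "map_option (\<lambda>w. w + var_exp x) (norm_form (Some u)) \<in> Domain (rstep R)"
      then obtain w l ro t where w: "norm_form (Some u) = Some w" "w + var_exp x = l + t" "(l, ro) \<in> R"
        by (auto simp: rstep_def)
      then have l0: "Poly_Mapping.lookup l x = 0" using assms(1) by (simp add: in_keys_iff)
      \<comment> \<open>The variable \<open>x\<close> on the left of
        \<open>w + var_exp x = l + t\<close> must come from \<open>t\<close>, so the truncated
        difference loses nothing.\<close>
      have "w = l + (t - var_exp x)"
      proof (rule poly_mapping_eqI)
        fix y
        have "Poly_Mapping.lookup (w + var_exp x) y = Poly_Mapping.lookup (l + t) y" using w(2) by simp
        then show "Poly_Mapping.lookup w y = Poly_Mapping.lookup (l + (t - var_exp x)) y"
          using l0 by (cases "y = x") (auto simp: lookup_add lookup_minus lookup_single when_def)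
      qed
      then have "norm_form (Some u) \<in> Domain (rstep R)" using w unfolding rstep_def by blast
      then show False using norm_form(2) by blast
    qed
  qed
  have "inj (map_option (\<lambda>w. w + var_exp x))" by (intro option.inj_map injI) simp
  then show ?thesis using eq unfolding * by (rule injD)
qed

text \<open>Two bases of one ideal share the work: squarefree leads in \<open>J\<close> make the
  quotient reduced, and leads in \<open>J'\<close> that avoid \<open>h\<close> make \<open>h\<close>
  cancellable. \<open>J'\<close> may then have leads with squares.\<close>

lemma radical_at_of_check_glue:
  assumes J: "check_rules wsJ (map (\<lambda>(l, r). (l, Some r)) J)" "check_squarefree (map (\<lambda>(l, r). (l, Some r)) J)"
      "check_moves (map (\<lambda>(l, r). (l, Some r)) J) A"
    and J_paths: "list_all2 (\<lambda>(l, r) us. us \<noteq> [] \<and> hd us = h # l \<and> last us = h # r \<and> move_path A us) J pJ"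
    and J': "check_rules wsJ' (map (\<lambda>(l, r). (l, Some r)) J')"
      "list_all (\<lambda>(l, r). \<not> List.member l h) J'"
      "list_all (\<lambda>(l, r). check_joinable (map (\<lambda>(l, r). (l, Some r)) J) (Some l) (Some r)) J'"
      "list_all (\<lambda>(l, r). check_joinable (map (\<lambda>(l, r). (l, Some r)) J') (Some l) (Some r)) J"
    and H: "check_rules wsH (path_rules pH @ map (\<lambda>us. (hd us, None)) pN)"
      "check_squarefree (path_rules pH @ map (\<lambda>us. (hd us, None)) pN)"
      "check_moves (path_rules pH @ map (\<lambda>us. (hd us, None)) pN) A"
      "check_paths A (pH @ pN)" "list_all (\<lambda>us. List.member (last us) h) pN"
  shows "radical_at K (set A)"
proof -
  let ?J = "rules_of (map (\<lambda>(l, r). (l, Some r)) J)" and ?J' = "rules_of (map (\<lambda>(l, r). (l, Some r)) J')"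
  let ?H = "rules_of (path_rules pH @ map (\<lambda>us. (hd us, None)) pN)"
  interpret J: squarefree_rewriting ?J "mweight (weight_of wsJ)"
    using check_rules_squarefree_rewriting J(1,2) unfolding check_squarefree_def .
  interpret J': rewriting ?J' "mweight (weight_of wsJ')"
    using check_rules_rewriting J'(1) .
  interpret H: squarefree_rewriting ?H "mweight (weight_of wsH)"
    using check_rules_squarefree_rewriting H(1,2) unfolding check_squarefree_def .
  have J_rules: "\<exists>r. ro = Some r \<and> cong (set A) (var_exp h + l) (var_exp h + r)"
    if lro: "(l, ro) \<in> ?J" for l ro
  proof -
    from lro obtain a b where ab: "(a, b) \<in> set J" "l = mon_of a" "ro = Some (mon_of b)"
      by (auto simp: rules_of_def)
    then obtain i where i: "i < length J" "J ! i = (a, b)" by (auto simp: in_set_conv_nth)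
    define us where "us = pJ ! i"
    have "us \<noteq> []" "hd us = h # a" "last us = h # b" "move_path A us"
      using list_all2_nthD[OF J_paths i(1)] by (simp_all add: i(2) us_def)
    then show ?thesis using move_path_hd_last[of A us] ab by simp
  qed
  have J'_J: "joinable ?J (Some l) ro" if lro: "(l, ro) \<in> ?J'" for l ro
  proof -
    from lro obtain a b where "(a, b) \<in> set J'" "l = mon_of a" "ro = Some (mon_of b)"
      by (auto simp: rules_of_def)
    then show ?thesis using J'(3) check_joinable[of "map (\<lambda>(l, r). (l, Some r)) J" "Some a" "Some b"]
      by (auto simp: list_all_iff)
  qed
  have J_J': "joinable ?J' (Some l) ro" if lro: "(l, ro) \<in> ?J" for l ro
  proof -
    from lro obtain a b where "(a, b) \<in> set J" "l = mon_of a" "ro = Some (mon_of b)"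
      by (auto simp: rules_of_def)
    then show ?thesis using J'(4) check_joinable[of "map (\<lambda>(l, r). (l, Some r)) J'" "Some a" "Some b"]
      by (auto simp: list_all_iff)
  qed
  have cancel: "J.norm_form (Some u) = J.norm_form (Some v)"
    if "J.norm_form (Some (var_exp h + u)) = J.norm_form (Some (var_exp h + v))" for u v
  proof -
    \<comment> \<open>Each system preserves the normal forms of the other, so an equation can be
      carried to \<open>J'\<close>, cancelled there, and carried back.\<close>
    have *: "J'.norm_form x = J'.norm_form (J.norm_form x)" for x
      using J'.norm_form_preserved[OF J_J' J.norm_form(1)] .
    have **: "J.norm_form x = J.norm_form (J'.norm_form x)" for x
      using J.norm_form_preserved[OF J'_J J'.norm_form(1)] .
    have "J'.norm_form (Some (var_exp h + u)) = J'.norm_form (Some (var_exp h + v))"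
      using *[of "Some (var_exp h + u)"] *[of "Some (var_exp h + v)"] that by simp
    moreover have "h \<notin> Poly_Mapping.keys l" if "(l, ro) \<in> ?J'" for l ro
      using that J'(2) by (auto simp: rules_of_def list_all_iff keys_mon)
    ultimately have "J'.norm_form (Some u) = J'.norm_form (Some v)"
      using J'.norm_form_add_var by blast
    then show ?thesis using **[of "Some u"] **[of "Some v"] by simp
  qed
  have H_Some: "cong (set A) l r" if lr: "(l, Some r) \<in> ?H" for l r
  proof -
    from lr obtain us where "us \<in> set pH" "l = mon_of (hd us)" "r = mon_of (last us)"
      by (auto simp: rules_of_def path_rules_def)
    then show ?thesis using H(4) move_path_hd_last[of A us] by (auto simp: check_paths_def list_all_iff)
  qed
  have H_None: "\<exists>s. cong (set A) l (var_exp h + s)" if l: "(l, None) \<in> ?H" for l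
  proof -
    from l obtain us where us: "us \<in> set pN" "l = mon_of (hd us)"
      by (auto simp: rules_of_def path_rules_def)
    then have "cong (set A) l (mon_of (last us))"
      using H(4) move_path_hd_last[of A us] by (auto simp: check_paths_def list_all_iff)
    moreover have "h \<in> set (last us)" using us(1) H(5) by (auto simp: list_all_iff)
    ultimately show ?thesis using mon_remove1_member by metis
  qed
  note H_steps = rsteps_cong_None[of ?H "set A", OF H_Some H_None H.norm_form(1)]
  show ?thesis
  proof (rule radical_at_glue[where h = "var_exp h"])
    show "squarefree_normal_form (\<lambda>u. H.norm_form (Some u)) (mweight (weight_of wsH))"
      by (rule H.squarefree_normal_form_axioms)
    show "squarefree_normal_form (\<lambda>u. J.norm_form (Some u)) (mweight (weight_of wsJ))"
      by (rule J.squarefree_normal_form_axioms)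
    show "H.norm_form (Some (diag p)) = H.norm_form (Some (anti p))" if "p \<in> set A" for p
      using H.norm_form_joinable[OF check_moves[OF H(3) that]] .
    show "J.norm_form (Some (diag p)) = J.norm_form (Some (anti p))" if "p \<in> set A" for p
      using J.norm_form_joinable[OF check_moves[OF J(3) that]] .
    show "cong (set A) u v" if eq: "H.norm_form (Some u) = H.norm_form (Some v)" "H.norm_form (Some u) \<noteq> None" for u v
    proof -
      obtain w where "H.norm_form (Some u) = Some w" using eq(2) by auto
      then have "cong (set A) u w" "cong (set A) v w"
        using H_steps[of u] H_steps[of v] eq(1) by simp_all
      then show ?thesis using cong_sym cong_trans by blast
    qed
    show "\<exists>u'. cong (set A) u (var_exp h + u')" if "H.norm_form (Some u) = None" for u
      using H_steps[of u] that by simp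
    show "cong (set A) (var_exp h + u) (var_exp h + v)"
      if "J.norm_form (Some (var_exp h + u)) = J.norm_form (Some (var_exp h + v))" for u v
      by (rule norm_form_cong[OF J.rewriting_axioms J_rules cancel[OF that]])
    show "J.norm_form (Some u) \<noteq> None" for u
      using rsteps_cong[OF J_rules J.norm_form(1)[of "Some u"]] by auto
  qed
qed

definition U_cells :: "point list" where
  "U_cells = [(0, 0), (0, 1), (0, 2), (1, 0), (1, 2)]"

text \<open>Four cells around the empty position (1, 1), consecutive ones meeting in a vertex, and
  the corner cell (0, 0).\<close>

definition ring_cells :: "point list" where
  "ring_cells = [(0, 0), (0, 1), (1, 0), (1, 2), (2, 1)]"

text \<open>The first and last monomials of the paths in \<open>ps\<close> form a Groebner basis, the weights \<open>ws\<close>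
  select the initial terms, and each path writes its binomial as a sum of multiples of minors.\<close>

lemma radical_at_U: "radical_at K (set U_cells)"
proof (rule radical_at_of_check)
  define ws :: "(point \<times> nat) list" where "ws =
    [((0, 0), 26), ((0, 1), 22), ((0, 2), 0), ((0, 3), 34), ((1, 0), 34), ((1, 1), 39), ((1, 2), 50),
     ((1, 3), 39), ((2, 0), 21), ((2, 1), 29), ((2, 2), 38), ((2, 3), 1)]"
  define ps :: "point list list list" where "ps = [
    [[(0, 0), (1, 1)], [(0, 1), (1, 0)]],
    [[(0, 1), (1, 2)], [(0, 2), (1, 1)]],
    [[(0, 3), (1, 2)], [(0, 2), (1, 3)]],
    [[(1, 0), (2, 1)], [(1, 1), (2, 0)]],
    [[(1, 3), (2, 2)], [(1, 2), (2, 3)]],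
    [[(0, 2), (0, 3), (1, 1)], [(0, 1), (0, 3), (1, 2)], [(0, 1), (0, 2), (1, 3)]],
    [[(0, 1), (0, 2), (0, 3), (1, 0)], [(0, 0), (0, 2), (0, 3), (1, 1)],
     [(0, 0), (0, 1), (0, 3), (1, 2)], [(0, 0), (0, 1), (0, 2), (1, 3)]],
    [[(0, 0), (0, 1), (0, 2), (1, 3), (2, 1)], [(0, 0), (0, 1), (0, 3), (1, 2), (2, 1)],
     [(0, 0), (0, 2), (0, 3), (1, 1), (2, 1)], [(0, 1), (0, 2), (0, 3), (1, 0), (2, 1)],
     [(0, 1), (0, 2), (0, 3), (1, 1), (2, 0)], [(0, 1), (0, 1), (0, 3), (1, 2), (2, 0)],
     [(0, 1), (0, 1), (0, 2), (1, 3), (2, 0)]]]"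
  show "check_rules ws (path_rules ps)" unfolding ws_def ps_def by code_simp
  show "check_squarefree (path_rules ps)" unfolding ps_def by code_simp
  show "check_paths U_cells ps" unfolding ps_def by code_simp
  show "check_moves (path_rules ps) U_cells" unfolding ps_def by code_simp
qed

text \<open>\<open>J\<close> generates the saturation of the ideal by the variable \<open>h\<close> at \<open>(0, 1)\<close>. It is a Groebner
  basis with squarefree initial terms, and \<open>J'\<close> is a second Groebner basis of the same ideal, whose
  initial terms do not contain \<open>h\<close>, so that \<open>h\<close> can be cancelled. The rules from \<open>pH\<close> and \<open>pN\<close>
  describe the ideal after adding \<open>h\<close>.\<close>

lemma radical_at_ring: "radical_at K (set ring_cells)"
proof (rule radical_at_of_check_glue[where h = "(0, 1)"])
  define wsJ :: "(point \<times> nat) list" where "wsJ =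
    [((0, 1), 6), ((1, 0), 3), ((1, 1), 3), ((1, 2), 1), ((1, 3), 7), ((2, 0), 7), ((2, 1), 2),
     ((2, 3), 2), ((3, 1), 3), ((3, 2), 2)]"
  \<comment> \<open>The sixth binomial is the minor on the rows 0 and 2 of the vertical domino
    formed by (0, 0) and (0, 1). Its product with the middle-row variable (0, 1) lies in the ideal
    by two moves.\<close>
  define J :: "(point list \<times> point list) list" where "J = [
    ([(0, 1), (1, 0)], [(0, 0), (1, 1)]), ([(0, 1), (1, 2)], [(0, 2), (1, 1)]),
    ([(1, 1), (2, 0)], [(1, 0), (2, 1)]), ([(1, 3), (2, 2)], [(1, 2), (2, 3)]),
    ([(2, 1), (3, 2)], [(2, 2), (3, 1)]), ([(0, 2), (1, 0)], [(0, 0), (1, 2)])]"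
  define pJ :: "point list list list" where "pJ = [
    [[(0, 1), (0, 1), (1, 0)], [(0, 1), (0, 0), (1, 1)]],
    [[(0, 1), (0, 1), (1, 2)], [(0, 1), (0, 2), (1, 1)]],
    [[(0, 1), (1, 1), (2, 0)], [(0, 1), (1, 0), (2, 1)]],
    [[(0, 1), (1, 3), (2, 2)], [(0, 1), (1, 2), (2, 3)]],
    [[(0, 1), (2, 1), (3, 2)], [(0, 1), (2, 2), (3, 1)]],
    [[(0, 1), (0, 2), (1, 0)], [(0, 0), (0, 2), (1, 1)], [(0, 1), (0, 0), (1, 2)]]]"
  define wsJ' :: "(point \<times> nat) list" where "wsJ' =
    [((0, 0), 235), ((0, 1), 0), ((0, 2), 230), ((1, 0), 246), ((1, 1), 204), ((1, 2), 254), ((1, 3), 260),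
     ((2, 0), 225), ((2, 1), 250), ((2, 2), 246), ((2, 3), 256), ((3, 1), 202), ((3, 2), 229)]"
  define J' :: "(point list \<times> point list) list" where "J' = [
    ([(0, 0), (1, 1)], [(0, 1), (1, 0)]), ([(0, 2), (1, 1)], [(0, 1), (1, 2)]),
    ([(1, 0), (2, 1)], [(1, 1), (2, 0)]), ([(1, 2), (2, 3)], [(1, 3), (2, 2)]),
    ([(2, 1), (3, 2)], [(2, 2), (3, 1)]), ([(1, 0), (2, 2), (3, 1)], [(1, 1), (2, 0), (3, 2)]),
    ([(0, 0), (1, 2)], [(0, 2), (1, 0)]), ([(0, 0), (1, 3), (2, 2)], [(0, 2), (1, 0), (2, 3)]),
    ([(0, 2), (1, 0), (1, 0), (2, 3), (3, 1)], [(0, 1), (1, 0), (1, 3), (2, 0), (3, 2)])]"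
  define wsH :: "(point \<times> nat) list" where "wsH = [((1, 0), 1), ((2, 3), 1), ((2, 2), 1), ((3, 1), 1), ((1, 2), 1)]"
  define pH :: "point list list list" where "pH = [
    [[(1, 0), (2, 1)], [(1, 1), (2, 0)]], [[(1, 2), (2, 3)], [(1, 3), (2, 2)]],
    [[(2, 2), (3, 1)], [(2, 1), (3, 2)]]]"
  \<comment> \<open>Modulo the variable at (0, 1), the minors of the two cells containing this
    vertex shrink to monomials; the other three minors remain as \<open>pH\<close>.\<close>
  define pN :: "point list list list" where "pN = [
    [[(0, 1)]], [[(0, 0), (1, 1)], [(0, 1), (1, 0)]], [[(0, 2), (1, 1)], [(0, 1), (1, 2)]]]"
  note defs = wsJ_def J_def pJ_def wsJ'_def J'_def wsH_def pH_def pN_def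
  show "check_rules wsJ (map (\<lambda>(l, r). (l, Some r)) J)" unfolding defs by code_simp
  show "check_squarefree (map (\<lambda>(l, r). (l, Some r)) J)" unfolding defs by code_simp
  show "check_moves (map (\<lambda>(l, r). (l, Some r)) J) ring_cells" unfolding defs by code_simp
  show "list_all2 (\<lambda>(l, r) us. us \<noteq> [] \<and> hd us = (0, 1) # l \<and> last us = (0, 1) # r \<and>
      move_path ring_cells us) J pJ" unfolding defs by code_simp
  show "check_rules wsJ' (map (\<lambda>(l, r). (l, Some r)) J')" unfolding defs by code_simp
  show "list_all (\<lambda>(l, r). \<not> List.member l (0, 1)) J'" unfolding defs by code_simp
  show "list_all (\<lambda>(l, r). check_joinable (map (\<lambda>(l, r). (l, Some r)) J) (Some l) (Some r)) J'"
    unfolding defs by code_simp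
  show "list_all (\<lambda>(l, r). check_joinable (map (\<lambda>(l, r). (l, Some r)) J') (Some l) (Some r)) J"
    unfolding defs by code_simp
  show "check_rules wsH (path_rules pH @ map (\<lambda>us. (hd us, None)) pN)" unfolding defs by code_simp
  show "check_squarefree (path_rules pH @ map (\<lambda>us. (hd us, None)) pN)" unfolding defs by code_simp
  show "check_moves (path_rules pH @ map (\<lambda>us. (hd us, None)) pN) ring_cells" unfolding defs by code_simp
  show "check_paths ring_cells (pH @ pN)" unfolding defs by code_simp
  show "list_all (\<lambda>us. List.member (last us) (0, 1)) pN" unfolding defs by code_simp
qed

section \<open>Symmetries\<close>

lemma cell_keys: "cell p = Poly_Mapping.keys (diag p) \<union> Poly_Mapping.keys (anti p)"
  by (cases p) (auto simp: cell.simps diag.simps anti.simps keys_add_nat)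

lemma map_key_times:
  fixes f g :: "('v, 'k::comm_ring_1) mpoly"
  assumes "bij \<rho>" and add: "\<And>u v. \<rho> (u + v) = \<rho> u + \<rho> v"
  shows "Poly_Mapping.map_key \<rho> (f * g) = Poly_Mapping.map_key \<rho> f * Poly_Mapping.map_key \<rho> g"
proof -
  have inj: "inj \<rho>" and surj: "\<And>m. \<exists>n. m = \<rho> n" using assms(1) by (auto simp: bij_def surj_def)
  have mono: "Poly_Mapping.map_key \<rho> (Poly_Mapping.single a c * Poly_Mapping.single b d) =
      Poly_Mapping.map_key \<rho> (Poly_Mapping.single a c) * Poly_Mapping.map_key \<rho> (Poly_Mapping.single b d)"
    for a b and c d :: 'k
  proof -
    obtain a' b' where "a = \<rho> a'" "b = \<rho> b'" using surj by blast
    then show ?thesis using inj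
      by (simp add: mult_single add[symmetric] map_key_single)
  qed
  have sum: "Poly_Mapping.map_key \<rho> (sum h I) = (\<Sum>i\<in>I. Poly_Mapping.map_key \<rho> (h i))"
    for h :: "('v \<Rightarrow>\<^sub>0 nat) \<Rightarrow> ('v, 'k) mpoly" and I
    by (induction I rule: infinite_finite_induct) (simp_all add: map_key_plus inj)
  have left: "Poly_Mapping.map_key \<rho> (Poly_Mapping.single a c * g) =
      Poly_Mapping.map_key \<rho> (Poly_Mapping.single a c) * Poly_Mapping.map_key \<rho> g" for a and c :: 'k
    by (subst (1 2) sum_single_lookup[symmetric, of g]) (simp add: sum_distrib_left sum mono)
  show ?thesis
    by (subst (1 2) sum_single_lookup[symmetric, of f]) (simp add: sum_distrib_right sum left)
qed

text \<open>A permutation of the vertices that carries the diagonals of each cell to those of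
  another cell, possibly exchanged, preserves minors up to sign. Since \<open>map_key\<close>
  composes with its argument, the hypothesis is phrased with the inverse
  \<open>\<psi>\<close>.\<close>

lemma radical_at_transport:
  fixes \<phi> \<psi> \<sigma> :: "point \<Rightarrow> point"
  assumes inv: "\<And>x. \<psi> (\<phi> x) = x" "\<And>x. \<phi> (\<psi> x) = x"
    and \<sigma>: "\<And>p. p \<in> A \<Longrightarrow>
      (Poly_Mapping.map_key \<psi> (diag p), Poly_Mapping.map_key \<psi> (anti p)) = (diag (\<sigma> p), anti (\<sigma> p)) \<or>
      (Poly_Mapping.map_key \<psi> (diag p), Poly_Mapping.map_key \<psi> (anti p)) = (anti (\<sigma> p), diag (\<sigma> p))"
    and rad: "radical_at K A"
  shows "radical_at K (\<sigma> ` A)"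
  unfolding radical_at_def
proof (intro ballI allI impI)
  define \<rho> :: "(point \<Rightarrow>\<^sub>0 nat) \<Rightarrow> _" where "\<rho> = Poly_Mapping.map_key \<psi>"
  have inj\<psi>: "inj \<psi>" and inj\<phi>: "inj \<phi>" using inv by (metis injI)+
  have lookup_\<rho>: "Poly_Mapping.lookup (\<rho> m) x = Poly_Mapping.lookup m (\<psi> x)" for m x
    using inj\<psi> by (simp add: \<rho>_def map_key.rep_eq)
  have \<rho>_inv: "\<rho> (Poly_Mapping.map_key \<phi> m) = m" "Poly_Mapping.map_key \<phi> (\<rho> m) = m" for m
    using inj\<psi> inj\<phi> inv by (auto intro!: poly_mapping_eqI simp: \<rho>_def map_key.rep_eq)
  have bij: "bij \<rho>" using \<rho>_inv by (metis bijI')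
  then have inj: "inj \<rho>" by (simp add: bij_def)
  have add: "\<rho> (u + v) = \<rho> u + \<rho> v" for u v by (simp add: \<rho>_def map_key_plus inj\<psi>)
  have keys_\<rho>: "x \<in> Poly_Mapping.keys (\<rho> m) \<longleftrightarrow> \<psi> x \<in> Poly_Mapping.keys m" for m x
    by (simp add: in_keys_iff lookup_\<rho>)
  \<comment> \<open>Precomposition with \<open>\<rho>\<close> takes polynomials for the image
    collection back to polynomials for \<open>A\<close>.\<close>
  define pull :: "(point, 'a) mpoly \<Rightarrow> (point, 'a) mpoly" where "pull = Poly_Mapping.map_key \<rho>"
  have lookup_pull: "Poly_Mapping.lookup (pull f) m = Poly_Mapping.lookup f (\<rho> m)" for f m
    using inj by (simp add: pull_def map_key.rep_eq)
  have pull_power: "pull (f ^ n) = pull f ^ n" for f n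
  proof (induction n)
    case 0
    have "\<rho> m = 0 \<longleftrightarrow> m = 0" for m using add[of 0 0] inj by (metis add_cancel_left_right injD)
    then show ?case
      by (intro poly_mapping_eqI) (simp add: lookup_pull lookup_one when_def)
  next
    case (Suc n)
    then show ?case using map_key_times[OF bij add, of f "f ^ n"] by (simp add: pull_def)
  qed
  have pull_sum: "coeff_sum P (pull f) = coeff_sum (\<lambda>m. P (Poly_Mapping.map_key \<phi> m)) f" for P f
    unfolding coeff_sum_def
  proof (rule sum.reindex_bij_witness[where i = "Poly_Mapping.map_key \<phi>" and j = \<rho>])
    show "Poly_Mapping.map_key \<phi> b \<in> Poly_Mapping.keys (pull f)" if "b \<in> Poly_Mapping.keys f" for b
      using that by (simp add: in_keys_iff lookup_pull \<rho>_inv)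
  qed (simp_all add: \<rho>_inv in_keys_iff lookup_pull)
  have closed: "move_closed A P \<longleftrightarrow> move_closed (\<sigma> ` A) (\<lambda>m. P (Poly_Mapping.map_key \<phi> m))" for P
  proof -
    have "(\<forall>t. P (diag p + t) \<longleftrightarrow> P (anti p + t)) \<longleftrightarrow>
      (\<forall>t. P (Poly_Mapping.map_key \<phi> (diag (\<sigma> p) + t)) \<longleftrightarrow> P (Poly_Mapping.map_key \<phi> (anti (\<sigma> p) + t)))"
      if p: "p \<in> A" for p
    proof -
      have *: "(\<forall>t. Q t) \<longleftrightarrow> (\<forall>t. Q (Poly_Mapping.map_key \<phi> t))" for Q :: "(point \<Rightarrow>\<^sub>0 nat) \<Rightarrow> bool"
        using \<rho>_inv(2) by metis
      show ?thesis
        using \<sigma>[OF p] \<rho>_inv(2)[of "diag p"] \<rho>_inv(2)[of "anti p"]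
        by (subst *) (auto simp: map_key_plus[OF inj\<phi>] \<rho>_def)
    qed
    then show ?thesis unfolding move_closed_def by auto
  qed
  have vanish: "vanishing A (pull f) \<longleftrightarrow> vanishing (\<sigma> ` A) f" for f
  proof
    assume *: "vanishing A (pull f)"
    show "vanishing (\<sigma> ` A) f" unfolding vanishing_def
    proof (intro allI impI)
      fix P assume "move_closed (\<sigma> ` A) P"
      then have "move_closed A (\<lambda>m. P (\<rho> m))" by (simp add: closed \<rho>_inv)
      then have "coeff_sum (\<lambda>m. P (\<rho> m)) (pull f) = 0" using * by (simp add: vanishing_def)
      then show "coeff_sum P f = 0" by (simp add: pull_sum \<rho>_inv)
    qed
  qed (simp add: vanishing_def pull_sum closed)
  have "x \<in> cell (\<sigma> p) \<longleftrightarrow> \<psi> x \<in> cell p" if "p \<in> A" for p x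
    using \<sigma>[OF that] keys_\<rho>[of x "diag p"] keys_\<rho>[of x "anti p"]
    by (auto simp: cell_keys \<rho>_def)
  then have corner: "x \<in> corner_set A" if "\<phi> x \<in> corner_set (\<sigma> ` A)" for x
    using that by (auto simp: corner_set_def inv)
  fix f :: "(point, 'a) mpoly" and n :: nat
  assume f: "f \<in> carrier (poly_ring (corner_set (\<sigma> ` A)))" and n: "1 \<le> n"
    and "vanishing (\<sigma> ` A) (f ^ n)"
  then have "vanishing A (pull f ^ n)" by (simp add: vanish pull_power[symmetric])
  moreover have "pull f \<in> carrier (poly_ring (corner_set A))"
    unfolding carrier_poly_ring
  proof (intro ballI subsetI)
    fix m x assume m: "m \<in> Poly_Mapping.keys (pull f)" "x \<in> Poly_Mapping.keys m"
    then have "\<rho> m \<in> Poly_Mapping.keys f" "\<phi> x \<in> Poly_Mapping.keys (\<rho> m)"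
      by (simp_all add: in_keys_iff lookup_pull lookup_\<rho> inv)
    then have "\<phi> x \<in> corner_set (\<sigma> ` A)" using f unfolding carrier_poly_ring by blast
    then show "x \<in> corner_set A" by (rule corner)
  qed
  ultimately have "vanishing A (pull f)" using rad n unfolding radical_at_def by blast
  then show "vanishing (\<sigma> ` A) f" by (simp add: vanish)
qed

lemma map_key_single':
  assumes "inj \<psi>" "\<psi> y = x"
  shows "Poly_Mapping.map_key \<psi> (Poly_Mapping.single x n) = Poly_Mapping.single y n"
  using assms map_key_single[of \<psi> y n] by simp

definition shift :: "point \<Rightarrow> point \<Rightarrow> point" where
  "shift e p = (fst e + fst p, snd e + snd p)"

lemma radical_at_shift:
  assumes "radical_at K A" shows "radical_at K (shift e ` A)"
proof (rule radical_at_transport[where \<phi> = "shift e" and \<psi> = "\<lambda>x. (fst x - fst e, snd x - snd e)",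
      OF _ _ _ assms])
  let ?\<psi> = "\<lambda>x. (fst x - fst e, snd x - snd e)"
  show "?\<psi> (shift e x) = x" "shift e (?\<psi> x) = x" for x by (simp_all add: shift_def)
  have inj: "inj ?\<psi>" by (auto simp: inj_def prod_eq_iff)
  have single: "Poly_Mapping.map_key ?\<psi> (Poly_Mapping.single x n) = Poly_Mapping.single (shift e x) n"
    for x and n :: nat
    by (rule map_key_single'[OF inj]) (simp add: shift_def)
  have "Poly_Mapping.map_key ?\<psi> (diag p) = diag (shift e p)" for p
    by (cases p) (simp add: diag.simps map_key_plus inj single shift_def add.assoc)
  moreover have "Poly_Mapping.map_key ?\<psi> (anti p) = anti (shift e p)" for p
    by (cases p) (simp add: anti.simps map_key_plus inj single shift_def add.assoc)
  ultimately show "(Poly_Mapping.map_key ?\<psi> (diag p), Poly_Mapping.map_key ?\<psi> (anti p)) =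
      (diag (shift e p), anti (shift e p)) \<or>
      (Poly_Mapping.map_key ?\<psi> (diag p), Poly_Mapping.map_key ?\<psi> (anti p)) =
      (anti (shift e p), diag (shift e p))" for p by simp
qed

definition flip :: "point \<Rightarrow> point" where "flip p = (- fst p, snd p)"

lemma radical_at_flip:
  assumes "radical_at K A" shows "radical_at K (flip ` A)"
proof -
  have inj: "inj flip" by (auto simp: inj_def prod_eq_iff flip_def)
  have single: "Poly_Mapping.map_key flip (Poly_Mapping.single x n) = Poly_Mapping.single (flip x) n"
    for x and n :: nat
    by (rule map_key_single'[OF inj]) (simp add: flip_def)
  \<comment> \<open>Reflection moves the lower right corner of a cell to the lower left one, hence
    the offset -1; the final shift by (1, 0) removes it.\<close>
  let ?\<sigma> = "\<lambda>p. (- fst p - 1, snd p)"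
  have "radical_at K (?\<sigma> ` A)"
  proof (rule radical_at_transport[where \<phi> = flip and \<psi> = flip, OF _ _ _ assms])
    show "flip (flip x) = x" "flip (flip x) = x" for x by (simp_all add: flip_def)
    have "Poly_Mapping.map_key flip (diag p) = anti (?\<sigma> p)" for p
      by (cases p) (simp add: diag.simps anti.simps map_key_plus inj single flip_def add.commute)
    moreover have "Poly_Mapping.map_key flip (anti p) = diag (?\<sigma> p)" for p
      by (cases p) (simp add: diag.simps anti.simps map_key_plus inj single flip_def add.commute)
    ultimately show "(Poly_Mapping.map_key flip (diag p), Poly_Mapping.map_key flip (anti p)) =
        (diag (?\<sigma> p), anti (?\<sigma> p)) \<or>
        (Poly_Mapping.map_key flip (diag p), Poly_Mapping.map_key flip (anti p)) =
        (anti (?\<sigma> p), diag (?\<sigma> p))" for p by simp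
  qed
  from radical_at_shift[OF this, of "(1, 0)"] show ?thesis
    by (simp add: image_image shift_def flip_def)
qed

lemma radical_at_swap:
  assumes "radical_at K A" shows "radical_at K (prod.swap ` A)"
proof (rule radical_at_transport[where \<phi> = prod.swap and \<psi> = prod.swap, OF _ _ _ assms])
  have inj: "inj prod.swap" by simp
  have single: "Poly_Mapping.map_key prod.swap (Poly_Mapping.single x n) = Poly_Mapping.single (prod.swap x) n"
    for x :: point and n :: nat
    by (rule map_key_single'[OF inj]) simp
  have "Poly_Mapping.map_key prod.swap (diag p) = diag (prod.swap p)" for p :: point
    by (cases p) (simp add: diag.simps map_key_plus inj single)
  moreover have "Poly_Mapping.map_key prod.swap (anti p) = anti (prod.swap p)" for p :: point
    by (cases p) (simp add: anti.simps map_key_plus inj single add.commute)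
  ultimately show "(Poly_Mapping.map_key prod.swap (diag p), Poly_Mapping.map_key prod.swap (anti p)) =
      (diag (prod.swap p), anti (prod.swap p)) \<or>
      (Poly_Mapping.map_key prod.swap (diag p), Poly_Mapping.map_key prod.swap (anti p)) =
      (anti (prod.swap p), diag (prod.swap p))" for p :: point by simp
qed simp_all

text \<open>The dihedral group of order 8, written as words in two reflections.\<close>

definition syms :: "(point \<Rightarrow> point) list" where
  "syms = [id, flip, prod.swap, flip \<circ> prod.swap, prod.swap \<circ> flip, flip \<circ> prod.swap \<circ> flip,
     prod.swap \<circ> flip \<circ> prod.swap, flip \<circ> prod.swap \<circ> flip \<circ> prod.swap]"

lemma radical_at_sym:
  assumes "g \<in> set syms" shows "radical_at K (g ` A) \<longleftrightarrow> radical_at K A"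
proof -
  have F: "radical_at K (flip ` A) \<longleftrightarrow> radical_at K A" for A
    using radical_at_flip[of K A] radical_at_flip[of K "flip ` A"] by (auto simp: image_image flip_def)
  have S: "radical_at K (prod.swap ` A) \<longleftrightarrow> radical_at K A" for A
    using radical_at_swap[of K A] radical_at_swap[of K "prod.swap ` A"] by (auto simp: image_image)
  show ?thesis using assms unfolding syms_def set_simps insert_iff empty_iff
    by (elim disjE) (simp_all only: image_id id_apply image_comp[symmetric] F S)
qed

lemma radical_at_shift_iff: "radical_at K (shift e ` A) \<longleftrightarrow> radical_at K A"
proof -
  have "shift (- fst e, - snd e) ` shift e ` A = A" by (simp add: image_image shift_def)
  then show ?thesis using radical_at_shift[of K A e]
      radical_at_shift[of K "shift e ` A" "(- fst e, - snd e)"] by auto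
qed

section \<open>Non-radical ideals\<close>

lemma not_radical_at:
  assumes uv: "cong A (u + u) (u + v)" "cong A (u + v) (v + v)"
    and P: "move_closed A P" "P u" "\<not> P v"
    and keys: "Poly_Mapping.keys u \<subseteq> corner_set A" "Poly_Mapping.keys v \<subseteq> corner_set A"
  shows "\<not> radical_at K A"
proof
  assume rad: "radical_at K A"
  define f :: "(point, 'a) mpoly" where "f = Poly_Mapping.single u 1 - Poly_Mapping.single v 1"
  have f: "f \<in> carrier (poly_ring (corner_set A))"
    using keys keys_diff[of "Poly_Mapping.single u (1::'a)" "Poly_Mapping.single v 1"]
    by (auto simp: carrier_poly_ring f_def)
  \<comment> \<open>The middle term is split into two copies of \<open>u v\<close> and not collected
    as twice a monomial, so the argument is the same in characteristic 2.\<close>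
  have "f ^ 2 = Poly_Mapping.single (u + u) 1 - Poly_Mapping.single (u + v) 1 -
      (Poly_Mapping.single (u + v) 1 - Poly_Mapping.single (v + v) 1)"
    by (simp add: f_def power2_eq_square left_diff_distrib right_diff_distrib mult_single add.commute)
  then have "coeff_sum P' (f ^ 2) = 0" if "move_closed A P'" for P'
    using move_closed_cong[OF that uv(1)] move_closed_cong[OF that uv(2)]
    by (simp only: coeff_sum_diff coeff_sum_single) simp
  then have "vanishing A (f ^ 2)" by (simp add: vanishing_def)
  then have "vanishing A f" using rad f unfolding radical_at_def by (metis one_le_numeral)
  then show False using P by (auto simp: vanishing_def f_def coeff_sum_diff)
qed

section \<open>Orientations of cells\<close>

fun peel :: "nat \<Rightarrow> (point list \<times> point list) list \<Rightarrow> bool" where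
  "peel 0 cs \<longleftrightarrow> cs = []"
| "peel (Suc k) cs \<longleftrightarrow> cs = [] \<or> (let N = concat (map snd cs) in
    peel k (filter (\<lambda>c. list_all (\<lambda>x. x \<in> set N) (fst c)) cs))"

text \<open>The leads discarded by \<open>peel\<close> contain a variable that occurs in no trail; such variables
  can be given a large weight.\<close>

lemma peel_weights:
  "peel k cs \<Longrightarrow> \<exists>w. \<forall>(l, t)\<in>set cs. sum_list (map w t) < (sum_list (map w l) :: nat)"
proof (induction k arbitrary: cs)
  case (Suc k)
  define N where "N = set (concat (map snd cs))"
  let ?rest = "\<lambda>c. list_all (\<lambda>x. x \<in> N) (fst c)"
  show ?case
  proof (cases "cs = []")
    case False
    then have "peel k (filter ?rest cs)" using Suc.prems by (simp add: N_def)
    then obtain w where w: "sum_list (map w t) < (sum_list (map w l) :: nat)"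
      if "(l, t) \<in> set cs" "?rest (l, t)" for l t
      using Suc.IH by fastforce
    define M where "M = Suc (\<Sum>c\<in>set cs. sum_list (map w (snd c)))"
    define w' where "w' x = (if x \<in> N then w x else M)" for x
    have t: "map w' t = map w t" if "(l, t) \<in> set cs" for l t
      using that by (force simp: w'_def N_def)
    have "sum_list (map w' t) < sum_list (map w' l)" if c: "(l, t) \<in> set cs" for l t
    proof (cases "?rest (l, t)")
      case True
      then have "map w' l = map w l" by (auto simp: w'_def list_all_iff)
      then show ?thesis using w[OF c True] unfolding t[OF c] by (simp only:)
    next
      case False
      then obtain x where x: "x \<in> set l" "x \<notin> N" by (auto simp: list_all_iff)
      have "sum_list (map w' t) = sum_list (map w (snd (l, t)))" by (simp only: snd_conv t[OF c])
      also have "\<dots> \<le> (\<Sum>c\<in>set cs. sum_list (map w (snd c)))"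
        using c by (intro member_le_sum) simp_all
      also have "\<dots> < w' x" using x(2) by (simp add: w'_def M_def)
      also have "w' x \<le> sum_list (map w' l)" using x(1) by (intro member_le_sum_list) simp_all
      finally show ?thesis .
    qed
    then show ?thesis by blast
  qed simp
qed simp

text \<open>Backtracking over both diagonals of each cell. Peeling to depth 3 makes this a
  sufficient test only; failing it says nothing about radicality.\<close>

fun orientable :: "point list \<Rightarrow> point list \<Rightarrow> (point list \<times> point list) list \<Rightarrow> bool" where
  "orientable [] used cs \<longleftrightarrow> peel 3 cs"
| "orientable (p # ps) used cs \<longleftrightarrow> (let d = diag_list p; a = anti_list p in
     (list_all (\<lambda>x. \<not> List.member used x) d \<and> orientable ps (d @ used) ((d, a) # cs)) \<or>
     (list_all (\<lambda>x. \<not> List.member used x) a \<and> orientable ps (a @ used) ((a, d) # cs)))"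

definition lead_list :: "(point \<Rightarrow> bool) \<Rightarrow> point \<Rightarrow> point list" where
  "lead_list d p = (if d p then diag_list p else anti_list p)"

definition trail_list :: "(point \<Rightarrow> bool) \<Rightarrow> point \<Rightarrow> point list" where
  "trail_list d p = (if d p then anti_list p else diag_list p)"

lemma mon_of_lead_list: "mon_of (lead_list d p) = lead d p"
  and mon_of_trail_list: "mon_of (trail_list d p) = trail d p"
  by (simp_all add: lead_list_def lead_def trail_list_def trail_def mon_of_diag_list mon_of_anti_list
      del: diag_list.simps anti_list.simps)

definition disjoint_leads :: "(point \<Rightarrow> bool) \<Rightarrow> point set \<Rightarrow> bool" where
  "disjoint_leads d A \<longleftrightarrow> (\<forall>p\<in>A. \<forall>q\<in>A. p \<noteq> q \<longrightarrow> set (lead_list d p) \<inter> set (lead_list d q) = {})"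

lemma orientable_leads:
  assumes "orientable ps used (map (\<lambda>q. (lead_list d q, trail_list d q)) qs)"
    and "distinct (ps @ qs)" "set used = (\<Union>q\<in>set qs. set (lead_list d q))" "disjoint_leads d (set qs)"
  shows "\<exists>d' rs. set rs = set ps \<union> set qs \<and> disjoint_leads d' (set rs) \<and>
    peel 3 (map (\<lambda>q. (lead_list d' q, trail_list d' q)) rs)"
  using assms
proof (induction ps arbitrary: used d qs)
  case Nil
  then show ?case by (intro exI[of _ d] exI[of _ qs]) simp
next
  case (Cons p ps)
  have step: ?case
    if b: "list_all (\<lambda>x. \<not> List.member used x) (lead_list (\<lambda>_. b) p)"
      "orientable ps (lead_list (\<lambda>_. b) p @ used) ((lead_list (\<lambda>_. b) p, trail_list (\<lambda>_. b) p) #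
        map (\<lambda>q. (lead_list d q, trail_list d q)) qs)" for b
  proof -
    define d' where "d' = d(p := b)"
    have p: "p \<notin> set qs" using Cons.prems(2) by simp
    have d': "lead_list d' q = lead_list d q" "trail_list d' q = trail_list d q" if "q \<in> set qs" for q
      using that p by (auto simp: d'_def lead_list_def trail_list_def)
    have dp: "lead_list d' p = lead_list (\<lambda>_. b) p" "trail_list d' p = trail_list (\<lambda>_. b) p"
      by (simp_all add: d'_def lead_list_def trail_list_def)
    have "orientable ps (lead_list d' p @ used) (map (\<lambda>q. (lead_list d' q, trail_list d' q)) (p # qs))"
      using b(2) d' by (simp add: dp cong: map_cong)
    moreover have "set (lead_list d' p @ used) = (\<Union>q\<in>set (p # qs). set (lead_list d' q))"
      using Cons.prems(3) d' by simp
    moreover have "disjoint_leads d' (set (p # qs))"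
    proof -
      have "set (lead_list d' p) \<inter> set (lead_list d' q) = {}" if "q \<in> set qs" for q
        using b(1) Cons.prems(3) that d'(1)[OF that] by (auto simp: dp list_all_iff)
      then show ?thesis using Cons.prems(4) d'(1) by (auto simp: disjoint_leads_def)
    qed
    ultimately show ?thesis using Cons.IH[of "lead_list d' p @ used" d' "p # qs"] Cons.prems(2) by auto
  qed
  show ?case
    using Cons.prems(1) step[of True] step[of False]
    by (auto simp: Let_def lead_list_def trail_list_def simp del: diag_list.simps anti_list.simps)
qed

lemma radical_at_of_weighted_leads:
  assumes "disjoint_leads d A"
    and "\<And>p. p \<in> A \<Longrightarrow> sum_list (map w (trail_list d p)) < (sum_list (map w (lead_list d p)) :: nat)"
  shows "radical_at K A"
proof (rule radical_at_of_disjoint_leads)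
  show "Poly_Mapping.keys (lead d p) \<inter> Poly_Mapping.keys (lead d q) = {}"
    if "p \<in> A" "q \<in> A" "p \<noteq> q" for p q
    using assms(1) that by (simp add: disjoint_leads_def mon_of_lead_list[symmetric] keys_mon)
  show "mweight w (trail d p) < mweight w (lead d p)" if "p \<in> A" for p
    using assms(2)[OF that] by (simp add: mon_of_lead_list[symmetric] mon_of_trail_list[symmetric] mweight_mon)
qed

lemma radical_at_of_orientable:
  assumes "orientable ps [] []" "distinct ps" shows "radical_at K (set ps)"
proof -
  obtain d rs where rs: "set rs = set ps" "disjoint_leads d (set rs)"
    "peel 3 (map (\<lambda>q. (lead_list d q, trail_list d q)) rs)"
    using orientable_leads[of ps "[]" "\<lambda>_. True" "[]"] assms by (auto simp: disjoint_leads_def)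
  obtain w where "\<forall>(l, t)\<in>set (map (\<lambda>q. (lead_list d q, trail_list d q)) rs).
      sum_list (map w t) < (sum_list (map w l) :: nat)"
    using peel_weights[OF rs(3)] by blast
  then show ?thesis using radical_at_of_weighted_leads[of d "set ps" w] rs by simp
qed

section \<open>Enumeration of connected collections\<close>

definition nbr :: "point \<Rightarrow> point \<Rightarrow> bool" where
  "nbr p q \<longleftrightarrow> \<bar>fst p - fst q\<bar> \<le> 1 \<and> \<bar>snd p - snd q\<bar> \<le> 1"

definition connected_cells :: "point set \<Rightarrow> bool" where
  "connected_cells A \<longleftrightarrow> (\<forall>p\<in>A. \<forall>q\<in>A. (p, q) \<in> {(a, b). a \<in> A \<and> b \<in> A \<and> nbr a b}\<^sup>*)"

lemma cell_Times: "cell (i, j) = {i..i + 1} \<times> {j..j + 1}"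
proof -
  have "{k..k + 1} = {k, k + 1}" for k :: int by auto
  then show ?thesis by (auto simp: cell.simps)
qed

text \<open>A common edge contains a common vertex, so only vertex contact counts, and unit squares
  meet iff their corners are at most a king's move apart.\<close>

lemma touching_cell_iff: "touching (cell p) (cell q) \<longleftrightarrow> nbr p q"
proof -
  obtain i j k l where pq: "p = (i, j)" "q = (k, l)" by fastforce
  have "cell p \<inter> cell q \<noteq> {}" if "edges (cell p) \<inter> edges (cell q) \<noteq> {}"
  proof -
    have sub: "e \<subseteq> C \<and> e \<noteq> {}" if "e \<in> edges C" for e C
      using that by (auto simp: edges_def cell.simps)
    show ?thesis using that sub by blast
  qed
  moreover have "cell p \<inter> cell q \<noteq> {} \<longleftrightarrow> nbr p q"
    unfolding pq nbr_def cell_Times Times_Int_Times by simp (simp add: abs_le_iff, linarith)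
  ultimately show ?thesis unfolding touching_def by blast
qed

lemma weakly_connected_image: "weakly_connected (cell ` A) \<longleftrightarrow> connected_cells A"
proof -
  let ?E = "{(a, b). a \<in> A \<and> b \<in> A \<and> nbr a b}"
  let ?E' = "{(C, D). C \<in> cell ` A \<and> D \<in> cell ` A \<and> touching C D}"
  have 1: "(cell p, cell q) \<in> ?E'\<^sup>*" if "(p, q) \<in> ?E\<^sup>*" for p q
    using that
  proof (induction rule: rtrancl_induct)
    case (step y z)
    then have "(cell y, cell z) \<in> ?E'" by (simp add: touching_cell_iff)
    then show ?case by (rule rtrancl_into_rtrancl[OF step.IH])
  qed simp
  have 2: "\<exists>q. D = cell q \<and> (p, q) \<in> ?E\<^sup>*" if "(cell p, D) \<in> ?E'\<^sup>*" for p D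
    using that
  proof (induction rule: rtrancl_induct)
    case (step y z)
    then obtain q where q: "y = cell q" "(p, q) \<in> ?E\<^sup>*" by blast
    from step.hyps(2) obtain r where r: "z = cell r" "r \<in> A" "cell q \<in> cell ` A" "nbr q r"
      by (auto simp: touching_cell_iff q(1))
    from r(3) have "q \<in> A" by (auto simp: cell_inject)
    then have "(q, r) \<in> ?E" using r by simp
    then show ?case using rtrancl_into_rtrancl[OF q(2)] r(1) by blast
  qed blast
  have "(cell p, cell q) \<in> ?E'\<^sup>* \<longleftrightarrow> (p, q) \<in> ?E\<^sup>*" for p q
    using 1[of p q] 2[of p "cell q"] by (auto simp: cell_inject)
  then show ?thesis unfolding weakly_connected_def connected_cells_def by simp
qed

lemma connected_cells_exit:
  assumes "connected_cells T" "S \<subseteq> T" "S \<noteq> {}" "S \<noteq> T"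
  shows "\<exists>x\<in>S. \<exists>y\<in>T - S. nbr x y"
proof (rule ccontr)
  assume no: "\<not> ?thesis"
  obtain s t where s: "s \<in> S" and t: "t \<in> T" "t \<notin> S" using assms by blast
  have "(s, t) \<in> {(a, b). a \<in> T \<and> b \<in> T \<and> nbr a b}\<^sup>*"
    using assms s t unfolding connected_cells_def by blast
  then have "t \<in> S"
    by (induction rule: rtrancl_induct) (use s no in auto)
  then show False using t by blast
qed

definition nbrs :: "point \<Rightarrow> point list" where
  "nbrs p = (case p of (i, j) \<Rightarrow> [(i - 1, j - 1), (i - 1, j), (i - 1, j + 1), (i, j - 1), (i, j + 1),
     (i + 1, j - 1), (i + 1, j), (i + 1, j + 1)])"

lemma set_nbrs:
  assumes "nbr p q" "p \<noteq> q" shows "q \<in> set (nbrs p)"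
proof -
  obtain i j k l where pq: "p = (i, j)" "q = (k, l)" by fastforce
  have "\<bar>i - k\<bar> \<le> 1" "\<bar>j - l\<bar> \<le> 1" using assms(1) by (simp_all add: nbr_def pq)
  then have "k = i - 1 \<or> k = i \<or> k = i + 1" "l = j - 1 \<or> l = j \<or> l = j + 1" by linarith+
  then show ?thesis using assms(2) unfolding pq nbrs_def by (elim disjE) simp_all
qed

text \<open>The positions lexicographically after the origin. Placing the least cell at the origin
  fixes one translate of each collection.\<close>

definition legal :: "point \<Rightarrow> bool" where
  "legal p = (case p of (i, j) \<Rightarrow> 0 < i \<or> (i = 0 \<and> 0 < j))"

text \<open>Redelmeier's enumeration: \<open>S\<close> is the current collection, \<open>U\<close> lists the cells that may
  still be added, and \<open>F\<close> the cells met so far.\<close>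

fun all_ext :: "(point list \<Rightarrow> bool) \<Rightarrow> nat \<Rightarrow> point list \<Rightarrow> point list \<Rightarrow> point list \<Rightarrow> bool" where
  "all_ext c 0 S U F = c S"
| "all_ext c (Suc n) S [] F = True"
| "all_ext c (Suc n) S (x # U) F =
     ((let N = filter (\<lambda>y. legal y \<and> \<not> List.member F y) (nbrs x)
       in all_ext c n (x # S) (N @ U) (N @ F)) \<and> all_ext c (Suc n) S U F)"

text \<open>The search is followed along the branch that leads to \<open>T\<close>: a candidate is
  added if it lies in \<open>T\<close> and rejected otherwise. Of the invariants,
  \<open>T \<inter> set F \<subseteq> set S \<union> set U\<close> says that no cell of
  \<open>T\<close> was rejected, and the last one that every legal neighbour of \<open>S\<close> has
  been met.\<close>

lemma all_ext_complete:
  assumes "all_ext c n S U F" "distinct S" "S \<noteq> []" "set S \<subseteq> T" "connected_cells T"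
    and "finite T" "card T = length S + n" "\<And>y. y \<in> T - set S \<Longrightarrow> legal y"
    and "set U \<inter> set S = {}" "distinct U" "set U \<subseteq> set F" "T \<inter> set F \<subseteq> set S \<union> set U" "set S \<subseteq> set F"
    and "\<And>x y. x \<in> set S \<Longrightarrow> nbr x y \<Longrightarrow> legal y \<Longrightarrow> y \<in> set F"
  shows "\<exists>S'. distinct S' \<and> set S' = T \<and> c S'"
  using assms
proof (induction c n S U F rule: all_ext.induct)
  case (1 c S U F)
  then have "set S = T" by (intro card_subset_eq) (simp_all add: distinct_card)
  then show ?case using 1 by auto
next
  case (2 c n S F)
  \<comment> \<open>With no candidates left, a neighbour through which \<open>T\<close> leaves
    \<open>S\<close> would have been met and would therefore lie in \<open>S\<close>.\<close>
  have "set S \<noteq> T" using 2(2,7) by (auto simp: distinct_card)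
  then obtain x y where xy: "x \<in> set S" "y \<in> T - set S" "nbr x y"
    using connected_cells_exit[OF 2(5,4)] 2(3) by auto
  have "y \<in> set F" using 2(14)[OF xy(1,3)] 2(8)[OF xy(2)] by simp
  then show ?case using 2(12) xy(2) by auto
next
  case (3 c n S x U F)
  let ?N = "filter (\<lambda>y. legal y \<and> \<not> List.member F y) (nbrs x)"
  have N: "y \<in> set ?N \<longleftrightarrow> y \<in> set (nbrs x) \<and> legal y \<and> y \<notin> set F" for y
    by auto
  have dN: "distinct ?N" by (cases x) (simp add: nbrs_def)
  have xS: "x \<notin> set S" "x \<notin> set U" "x \<in> set F" using 3(11-13) by auto
  have xN: "x \<notin> set ?N" using xS(3) N by blast
  show ?case
  proof (cases "x \<in> T")
    case True
    show ?thesis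
    proof (rule 3(1)[OF refl])
      show "all_ext c n (x # S) (?N @ U) (?N @ F)" using 3(3) by (simp add: Let_def)
      show "distinct (x # S)" using 3(4) xS by simp
      show "set (x # S) \<subseteq> T" using 3(6) True by simp
      show "card T = length (x # S) + n" using 3(9) by simp
      show "legal y" if "y \<in> T - set (x # S)" for y using 3(10)[of y] that by simp
      have "y \<notin> set S" if "y \<in> set ?N" for y using that N 3(15) by blast
      then show "set (?N @ U) \<inter> set (x # S) = {}" using 3(11) xS xN by auto
      have "y \<notin> set U" if "y \<in> set ?N" for y using that N 3(13) by auto
      then show "distinct (?N @ U)" using dN 3(12) by auto
      show "set (?N @ U) \<subseteq> set (?N @ F)" using 3(13) by auto
      show "T \<inter> set (?N @ F) \<subseteq> set (x # S) \<union> set (?N @ U)" using 3(14) by auto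
      show "set (x # S) \<subseteq> set (?N @ F)" using 3(15) xS by auto
      show "y \<in> set (?N @ F)" if y: "a \<in> set (x # S)" "nbr a y" "legal y" for a y
      proof (cases "y \<in> set F")
        case False
        then have "a = x" using 3(16)[of a y] y by auto
        moreover have "y \<noteq> x" using False xS by blast
        ultimately have "y \<in> set ?N" unfolding N using y False set_nbrs by blast
        then show ?thesis by simp
      qed simp
    qed (use 3(7,8) in simp_all)
  next
    case False
    show ?thesis
    proof (rule 3(2))
      show "all_ext c (Suc n) S U F" using 3(3) by simp
      show "T \<inter> set F \<subseteq> set S \<union> set U" using 3(14) False by auto
      show "legal y" if "y \<in> T - set S" for y using 3(10)[OF that] .
      show "y \<in> set F" if "a \<in> set S" "nbr a y" "legal y" for a y using 3(16)[OF that] .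
    qed (use 3(4-9,11-13,15) in auto)
  qed
qed

section \<open>Collections of at most five cells\<close>

lemma take_out_complete:
  "mon_of u = mon_of l + t \<Longrightarrow> \<exists>s. take_out l u = Some s \<and> mon_of s = t"
proof (induction l arbitrary: u)
  case (Cons x l)
  have x: "x \<in> set u" using Cons.prems keys_mon[of u] by (auto simp: keys_add_nat)
  then have "mon_of (remove1 x u) = mon_of l + t"
    using Cons.prems by (simp add: mon_remove1_member[OF x] add.assoc)
  then show ?case using Cons.IH[of "remove1 x u"] x by simp
qed simp

section \<open>Certificates for ideals that are not radical\<close>

definition closed_under :: "point list list \<Rightarrow> point list \<Rightarrow> point list \<Rightarrow> bool" where
  "closed_under Q l r \<longleftrightarrow> list_all (\<lambda>q. case take_out l q of None \<Rightarrow> True |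
     Some s \<Rightarrow> list_ex (\<lambda>q'. take_out (r @ s) q' = Some []) Q) Q"

text \<open>Although \<open>t\<close> is arbitrary, it is determined by the element of
  \<open>Q\<close> that it completes, so finitely many divisions suffice.\<close>

lemma closed_under:
  assumes "closed_under Q l r" "mon_of l + t \<in> mon_of ` set Q" shows "mon_of r + t \<in> mon_of ` set Q"
proof -
  obtain q where q: "q \<in> set Q" "mon_of q = mon_of l + t" using assms(2) by force
  obtain s where s: "take_out l q = Some s" "mon_of s = t" using take_out_complete[OF q(2)] by blast
  then obtain q' where q': "q' \<in> set Q" "take_out (r @ s) q' = Some []"
    using assms(1) q(1) by (fastforce simp: closed_under_def list_all_iff list_ex_iff)
  then have "mon_of q' = mon_of r + t" using take_out_mon[OF q'(2)] s(2) by (simp add: mon_append)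
  then show ?thesis using q'(1) by (metis imageI)
qed

text \<open>\<open>Q\<close> is the whole class of \<open>hd Q\<close>; \<open>us\<close> and \<open>vs\<close> are chains of moves from \<open>u\<^sup>2\<close> to \<open>u v\<close> and
  from \<open>u v\<close> to \<open>v\<^sup>2\<close>, where \<open>u = hd Q\<close>.\<close>

definition check_witness ::
  "point list \<Rightarrow> point list list \<Rightarrow> point list \<Rightarrow> point list list \<Rightarrow> point list list \<Rightarrow> bool" where
  "check_witness A Q v us vs \<longleftrightarrow>
     list_all (\<lambda>p. closed_under Q (diag_list p) (anti_list p) \<and> closed_under Q (anti_list p) (diag_list p)) A \<and>
     Q \<noteq> [] \<and> list_all (\<lambda>q. take_out q v \<noteq> Some []) Q \<and>
     list_all (\<lambda>x. list_ex (\<lambda>p. List.member (diag_list p @ anti_list p) x) A) (hd Q @ v) \<and>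
     us \<noteq> [] \<and> vs \<noteq> [] \<and> hd us = hd Q @ hd Q \<and> last us = hd Q @ v \<and> hd vs = hd Q @ v \<and> last vs = v @ v \<and>
     move_path A us \<and> move_path A vs"

lemma not_radical_at_of_witness:
  assumes "check_witness A Q v us vs" shows "\<not> radical_at K (set A)"
proof (rule not_radical_at[where u = "mon_of (hd Q)" and v = "mon_of v" and P = "\<lambda>m. m \<in> mon_of ` set Q"])
  note c = assms[unfolded check_witness_def]
  show "cong (set A) (mon_of (hd Q) + mon_of (hd Q)) (mon_of (hd Q) + mon_of v)"
    using move_path_hd_last[of A us] c by (simp add: mon_append)
  show "cong (set A) (mon_of (hd Q) + mon_of v) (mon_of v + mon_of v)"
    using move_path_hd_last[of A vs] c by (simp add: mon_append)
  show "move_closed (set A) (\<lambda>m. m \<in> mon_of ` set Q)"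
    unfolding move_closed_def
  proof (intro ballI allI)
    fix p t assume "p \<in> set A"
    then have "closed_under Q (diag_list p) (anti_list p)" "closed_under Q (anti_list p) (diag_list p)"
      using c by (auto simp: list_all_iff)
    from closed_under[OF this(1), of t] closed_under[OF this(2), of t]
    show "diag p + t \<in> mon_of ` set Q \<longleftrightarrow> anti p + t \<in> mon_of ` set Q"
      by (auto simp only: mon_of_diag_list mon_of_anti_list)
  qed
  show "mon_of (hd Q) \<in> mon_of ` set Q" using c by simp
  show "mon_of v \<notin> mon_of ` set Q"
  proof
    assume "mon_of v \<in> mon_of ` set Q"
    then obtain q where q: "q \<in> set Q" "mon_of v = mon_of q + 0" by auto
    from take_out_complete[OF q(2)] obtain s where s: "take_out q v = Some s" "mon_of s = 0" by blast
    then have "s = []" using keys_mon[of s] by simp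
    then show False using c q(1) s(1) by (auto simp: list_all_iff)
  qed
  have *: "x \<in> corner_set (set A)" if "x \<in> set (hd Q @ v)" for x
  proof -
    have "list_ex (\<lambda>p. List.member (diag_list p @ anti_list p) x) A"
      using c that unfolding list_all_iff by blast
    then obtain p where p: "p \<in> set A" "x \<in> set (diag_list p) \<union> set (anti_list p)"
      unfolding list_ex_iff by auto
    then have "x \<in> Poly_Mapping.keys (diag p) \<union> Poly_Mapping.keys (anti p)"
      by (simp only: keys_mon[symmetric] mon_of_diag_list mon_of_anti_list)
    then show ?thesis using p(1) by (auto simp: corner_set_def cell_keys)
  qed
  then show "Poly_Mapping.keys (mon_of (hd Q)) \<subseteq> corner_set (set A)"
    "Poly_Mapping.keys (mon_of v) \<subseteq> corner_set (set A)" by (auto simp: keys_mon)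
qed

definition square_cells :: "point list" where
  "square_cells = [(0, 0), (1, 0), (0, 1), (1, 1)]"

definition T_cells :: "point list" where
  "T_cells = [(0, 0), (0, 1), (0, -1), (1, 0)]"

lemma not_radical_at_square: "\<not> radical_at K (set square_cells)"
proof (rule not_radical_at_of_witness)
  show "check_witness square_cells
    [[(0, 0), (1, 1), (2, 2)], [(0, 1), (1, 0), (2, 2)], [(0, 0), (1, 2), (2, 1)]]
    [(0, 1), (1, 2), (2, 0)]
    [[(0, 0), (1, 1), (2, 2), (0, 0), (1, 1), (2, 2)], [(0, 0), (0, 1), (1, 0), (1, 1), (2, 2), (2, 2)],
     [(0, 0), (0, 1), (1, 0), (1, 2), (2, 1), (2, 2)], [(0, 0), (1, 1), (2, 2), (0, 1), (1, 2), (2, 0)]]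
    [[(0, 0), (1, 1), (2, 2), (0, 1), (1, 2), (2, 0)], [(0, 1), (0, 1), (1, 0), (1, 2), (2, 0), (2, 2)],
     [(0, 1), (0, 2), (1, 0), (1, 1), (2, 0), (2, 2)], [(0, 1), (0, 2), (1, 0), (1, 2), (2, 0), (2, 1)],
     [(0, 1), (0, 2), (1, 1), (1, 2), (2, 0), (2, 0)], [(0, 1), (1, 2), (2, 0), (0, 1), (1, 2), (2, 0)]]"
    by code_simp
qed

lemma not_radical_at_T: "\<not> radical_at K (set T_cells)"
proof (rule not_radical_at_of_witness)
  show "check_witness T_cells
    [[(0, -1), (1, 0), (1, 2), (2, 1)], [(0, 0), (1, -1), (1, 2), (2, 1)], [(0, -1), (1, 1), (1, 2), (2, 0)]]
    [(0, 1), (1, -1), (1, 2), (2, 0)]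
    [[(0, -1), (1, 0), (1, 2), (2, 1), (0, -1), (1, 0), (1, 2), (2, 1)],
     [(0, -1), (0, 0), (1, -1), (1, 0), (1, 2), (1, 2), (2, 1), (2, 1)],
     [(0, -1), (0, 0), (1, -1), (1, 1), (1, 2), (1, 2), (2, 0), (2, 1)],
     [(0, -1), (1, 0), (1, 2), (2, 1), (0, 1), (1, -1), (1, 2), (2, 0)]]
    [[(0, -1), (1, 0), (1, 2), (2, 1), (0, 1), (1, -1), (1, 2), (2, 0)],
     [(0, 0), (0, 1), (1, -1), (1, -1), (1, 2), (1, 2), (2, 0), (2, 1)],
     [(0, 0), (0, 2), (1, -1), (1, -1), (1, 1), (1, 2), (2, 0), (2, 1)],
     [(0, 1), (0, 2), (1, -1), (1, -1), (1, 0), (1, 2), (2, 0), (2, 1)],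
     [(0, 1), (0, 2), (1, -1), (1, -1), (1, 1), (1, 2), (2, 0), (2, 0)],
     [(0, 1), (1, -1), (1, 2), (2, 0), (0, 1), (1, -1), (1, 2), (2, 0)]]"
    by code_simp
qed

section \<open>Classification of the small collections\<close>

definition all_connected :: "(point list \<Rightarrow> bool) \<Rightarrow> nat \<Rightarrow> bool" where
  "all_connected c n \<longleftrightarrow> (let N = filter legal (nbrs (0, 0)) in all_ext c n [(0, 0)] N ((0, 0) # N))"

lemma connected_cells_shift:
  assumes "connected_cells A" shows "connected_cells (shift e ` A)"
proof -
  have "(shift e p, shift e q) \<in> {(a, b). a \<in> shift e ` A \<and> b \<in> shift e ` A \<and> nbr a b}\<^sup>*"
    if "(p, q) \<in> {(a, b). a \<in> A \<and> b \<in> A \<and> nbr a b}\<^sup>*" for p q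
    using that
  proof (induction rule: rtrancl_induct)
    case (step y z)
    then have "(shift e y, shift e z) \<in> {(a, b). a \<in> shift e ` A \<and> b \<in> shift e ` A \<and> nbr a b}"
      by (auto simp: nbr_def shift_def)
    then show ?case by (rule rtrancl_into_rtrancl[OF step.IH])
  qed simp
  then show ?thesis using assms unfolding connected_cells_def by simp
qed

lemma shift_shift: "shift e (shift (- fst e, - snd e) p) = p"
  by (simp add: shift_def)

lemma inj_shift: "inj (shift e)"
  by (auto simp: inj_def shift_def prod_eq_iff)

lemma all_connectedD:
  assumes "all_connected c n" "finite T" "connected_cells T" "card T = Suc n"
  shows "\<exists>S e. distinct S \<and> T = shift e ` set S \<and> c S"
proof -
  \<comment> \<open>The minimum is lexicographic; once it is moved to the origin, all other cells
    are \<open>legal\<close>.\<close>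
  define e where "e = Min T"
  have e: "e \<in> T" and min: "\<And>y. y \<in> T \<Longrightarrow> e \<le> y"
    using assms(2,4) by (auto simp: e_def intro!: Min_in)
  define T' where "T' = shift (- fst e, - snd e) ` T"
  let ?N = "filter legal (nbrs (0, 0))"
  have "\<exists>S. distinct S \<and> set S = T' \<and> c S"
  proof (rule all_ext_complete)
    show "all_ext c n [(0, 0)] ?N ((0, 0) # ?N)"
      using assms(1) by (simp add: all_connected_def Let_def)
    have "shift (- fst e, - snd e) e \<in> T'" using e unfolding T'_def by (rule imageI)
    then show "set [(0, 0)] \<subseteq> T'" by (simp add: shift_def)
    show "connected_cells T'" unfolding T'_def by (rule connected_cells_shift[OF assms(3)])
    show "finite T'" using assms(2) by (simp add: T'_def)
    show "card T' = length [(0, 0)] + n"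
      using assms(4) card_image[OF inj_on_subset[OF inj_shift subset_UNIV]] by (simp add: T'_def)
    show "legal y" if "y \<in> T' - set [(0, 0)]" for y
    proof -
      obtain x where x: "x \<in> T" "y = shift (- fst e, - snd e) x" using \<open>y \<in> _\<close> by (auto simp: T'_def)
      then have "e \<le> x" "y \<noteq> (0, 0)" using min that by auto
      then show ?thesis unfolding legal_def x(2) shift_def
        by (cases e; cases x) (auto simp: less_eq_prod_def)
    qed
    show "distinct ?N" by (simp add: nbrs_def)
    show "y \<in> set ((0, 0) # ?N)" if "x \<in> set [(0, 0)]" "nbr x y" "legal y" for x y
      using that set_nbrs[of x y] by (cases "x = y") auto
  qed (auto simp: nbrs_def)
  moreover have "T = shift e ` T'" by (simp add: T'_def image_image shift_shift)
  ultimately show ?thesis by blast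
qed

text \<open>Translations by elements of \<open>S\<close> suffice: the symmetries fix the origin, and
  each of the four patterns contains it.\<close>

definition embeds :: "point list \<Rightarrow> point list \<Rightarrow> bool" where
  "embeds B S \<longleftrightarrow> list_ex (\<lambda>g. list_ex (\<lambda>p. list_all (\<lambda>b. List.member S (shift p (g b))) B) S) syms"

definition classified :: "point list \<Rightarrow> bool" where
  "classified S \<longleftrightarrow> orientable S [] [] \<or>
     list_ex (\<lambda>B. embeds B S) [square_cells, T_cells, U_cells, ring_cells]"

lemma all_orientable_small:
  "all_connected (\<lambda>S. orientable S [] []) 0"
  "all_connected (\<lambda>S. orientable S [] []) 1"
  "all_connected (\<lambda>S. orientable S [] []) 2"
  by code_simp+

text \<open>The number 4 counts the cells added to the origin, so this treats collections of five
  cells.\<close>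

lemma all_classified: "all_connected classified 4"
  by code_simp


lemma collections_iff:
  "\<C> \<in> collections n \<longleftrightarrow> (\<exists>A. \<C> = cell ` A \<and> finite A \<and> card A = n \<and> connected_cells A)"
proof -
  have inj: "inj_on cell A" for A by (simp add: inj_on_def cell_inject)
  show ?thesis unfolding collections_def cells_def
    by (auto simp: subset_image_iff weakly_connected_image card_image[OF inj] finite_image_iff[OF inj])
qed

lemma radical_at_small:
  assumes "finite A" "connected_cells A" "card A \<in> {1, 2, 3}"
  shows "radical_at K A"
proof -
  obtain n where "all_connected (\<lambda>S. orientable S [] []) n" "card A = Suc n"
    using assms(3) all_orientable_small by (auto simp: numeral_eq_Suc)
  then obtain S e where "distinct S" "A = shift e ` set S" "orientable S [] []"
    using all_connectedD assms(1,2) by blast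
  then show ?thesis using radical_at_of_orientable by (simp add: radical_at_shift_iff)
qed

lemma nbr_sym:
  assumes "g \<in> set syms" shows "nbr (g p) (g q) \<longleftrightarrow> nbr p q"
  using assms unfolding syms_def by (auto simp: nbr_def flip_def)

lemma inj_sym:
  assumes "g \<in> set syms" shows "inj g"
proof -
  have "inj flip" by (auto simp: inj_def flip_def prod_eq_iff)
  then show ?thesis using assms unfolding syms_def
    by (auto intro!: inj_compose)
qed

lemma connected_cells_star:
  assumes "c \<in> A" "\<And>q. q \<in> A \<Longrightarrow> nbr c q" shows "connected_cells A"
  unfolding connected_cells_def
proof (intro ballI)
  fix p q assume "p \<in> A" "q \<in> A"
  moreover have "nbr p c" using assms(2)[OF \<open>p \<in> A\<close>] by (auto simp: nbr_def)
  ultimately have "(p, c) \<in> {(a, b). a \<in> A \<and> b \<in> A \<and> nbr a b}"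
    "(c, q) \<in> {(a, b). a \<in> A \<and> b \<in> A \<and> nbr a b}" using assms by auto
  then show "(p, q) \<in> {(a, b). a \<in> A \<and> b \<in> A \<and> nbr a b}\<^sup>*"
    by (rule converse_rtrancl_into_rtrancl[OF _ r_into_rtrancl])
qed

lemma embedsE:
  assumes "embeds B S"
  obtains g p where "g \<in> set syms" "(\<lambda>b. shift p (g b)) ` set B \<subseteq> set S"
  using assms unfolding embeds_def by (auto simp: list_ex_iff list_all_iff)

lemma radical_at_embedding:
  assumes "g \<in> set syms"
  shows "radical_at K ((\<lambda>b. shift e (shift p (g b))) ` B) \<longleftrightarrow> radical_at K B"
  using radical_at_sym[OF assms, of K B] radical_at_shift_iff[of K p "g ` B"]
    radical_at_shift_iff[of K e "shift p ` g ` B"] by (simp add: image_image)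

text \<open>An orientable collection is radical, and so is a copy of \<open>U_cells\<close> or
  \<open>ring_cells\<close>, which exhausts all five cells. A copy of the square or of the T leaves
  one cell over; deleting that cell gives a connected collection that is still not radical, against
  minimality.\<close>

lemma no_minimal_5:
  assumes "finite A" "card A = 5" "connected_cells A"
  shows "\<not> minimally_nonradical K (cell ` A)"
proof
  assume min: "minimally_nonradical K (cell ` A)"
  then have nonrad: "\<not> radical_at K A" by (simp add: minimally_nonradical_def has_radical_iff)
  have removal: "radical_at K (A - {x})" if "x \<in> A" "connected_cells (A - {x})" for x
  proof -
    have "cell ` A - {cell x} = cell ` (A - {x})" by (auto simp: cell_inject)
    then show ?thesis using min that
      by (auto simp: minimally_nonradical_def has_radical_iff[symmetric] weakly_connected_image[symmetric])
  qed
  obtain S e where S: "distinct S" "A = shift e ` set S" "classified S"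
    using all_connectedD[OF all_classified assms(1,3)] assms(2) by auto
  have card_S: "card (set S) = 5"
    using assms(2) S(2) card_image[OF inj_on_subset[OF inj_shift subset_UNIV]] by simp
  from S(3) consider "orientable S [] []" | B where "B \<in> {U_cells, ring_cells}" "embeds B S"
    | B where "B \<in> {square_cells, T_cells}" "embeds B S"
    unfolding classified_def by auto
  then show False
  proof cases
    case 1
    from radical_at_of_orientable[OF this S(1), of K] show False
      using nonrad S(2) by (simp add: radical_at_shift_iff)
  next
    case (2 B)
    from 2(2) obtain g p where g: "g \<in> set syms" "(\<lambda>b. shift p (g b)) ` set B \<subseteq> set S"
      by (rule embedsE)
    have inj: "inj (\<lambda>b. shift p (g b))"
      using inj_compose[OF inj_shift inj_sym[OF g(1)]] by (simp add: comp_def)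
    have "card (set B) = 5" using 2(1) by (auto simp: U_cells_def ring_cells_def)
    then have S_eq: "(\<lambda>b. shift p (g b)) ` set B = set S"
      using g(2) card_S card_image[OF inj_on_subset[OF inj subset_UNIV]] by (intro card_subset_eq) simp_all
    have "A = (\<lambda>b. shift e (shift p (g b))) ` set B"
      unfolding S(2) S_eq[symmetric] image_image ..
    moreover have "radical_at K (set B)" using 2(1) radical_at_U radical_at_ring by blast
    ultimately show False using nonrad radical_at_embedding[OF g(1), of K e p "set B"] by simp
  next
    case (3 B)
    from 3(2) obtain g p where g: "g \<in> set syms" "(\<lambda>b. shift p (g b)) ` set B \<subseteq> set S"
      by (rule embedsE)
    let ?f = "\<lambda>b. shift e (shift p (g b))"
    have inj: "inj ?f"
      using inj_compose[OF inj_shift inj_compose[OF inj_shift inj_sym[OF g(1)]]] by (simp add: comp_def)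
    \<comment> \<open>In both patterns the origin touches all other cells, which makes every copy
      connected.\<close>
    have B: "card (set B) = 4" "(0, 0) \<in> set B" "\<And>q. q \<in> set B \<Longrightarrow> nbr (0, 0) q"
      using 3(1) by (auto simp: square_cells_def T_cells_def nbr_def)
    have sub: "?f ` set B \<subseteq> A" using g(2) S(2) by auto
    moreover have "card (?f ` set B) = 4"
      using B(1) card_image[OF inj_on_subset[OF inj subset_UNIV]] by simp
    ultimately have "card (A - ?f ` set B) = 1" using assms(1,2) by (simp add: card_Diff_subset)
    then obtain x where "A - ?f ` set B = {x}" by (auto simp: card_1_singleton_iff)
    then have x: "x \<in> A" "A - {x} = ?f ` set B" using sub by auto
    have "connected_cells (?f ` set B)"
    proof (rule connected_cells_star)
      show "?f (0, 0) \<in> ?f ` set B" using B(2) by (rule imageI)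
      show "nbr (?f (0, 0)) q" if q: "q \<in> ?f ` set B" for q
      proof -
        obtain b where "b \<in> set B" "q = ?f b" using q by blast
        then have "nbr (g (0, 0)) (g b)" using B(3) nbr_sym[OF g(1)] by simp
        then show ?thesis by (simp add: \<open>q = ?f b\<close> nbr_def shift_def)
      qed
    qed
    then have "radical_at K (?f ` set B)" using removal[OF x(1)] x(2) by simp
    then have "radical_at K (set B)" using radical_at_embedding[OF g(1), of K e p "set B"] by simp
    then show False using 3(1) not_radical_at_square not_radical_at_T by blast
  qed
qed

text \<open>Minimality is free here: deleting a cell leaves three, and connected collections of
  three cells are radical.\<close>

lemma minimal_T: "\<exists>\<C> \<in> collections 4. minimally_nonradical K \<C>"
proof
  have conn: "connected_cells (set T_cells)"
    by (rule connected_cells_star[of "(0, 0)"]) (auto simp: T_cells_def nbr_def)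
  then show "cell ` set T_cells \<in> collections 4"
    unfolding collections_iff by (intro exI[of _ "set T_cells"]) (simp add: T_cells_def)
  show "minimally_nonradical K (cell ` set T_cells)"
    unfolding minimally_nonradical_def
  proof (intro conjI ballI impI)
    show "cell ` set T_cells \<subseteq> cells" by (auto simp: cells_def)
    show "weakly_connected (cell ` set T_cells)" using conn by (simp add: weakly_connected_image)
    show "\<not> has_radical_adj_ideal K (cell ` set T_cells)"
      by (simp add: has_radical_iff not_radical_at_T)
    fix C assume "C \<in> cell ` set T_cells"
      and "weakly_connected (cell ` set T_cells - {C})"
    moreover from this obtain x where x: "x \<in> set T_cells" "C = cell x" by blast
    moreover have "cell ` set T_cells - {cell x} = cell ` (set T_cells - {x})" by (auto simp: cell_inject)
    moreover have "card (set T_cells - {x}) = 3" using x(1) by (simp add: T_cells_def card_Diff_singleton)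
    ultimately show "has_radical_adj_ideal K (cell ` set T_cells - {C})"
      using radical_at_small[of "set T_cells - {x}" K] by (simp add: has_radical_iff weakly_connected_image)
  qed
qed

section \<open>Zigzags\<close>

text \<open>Cells alternate below and above the row 1. Consecutive ones share the vertex
  \<open>(i + 1, 1)\<close>, and the two vertices of \<open>zig i\<close> off this row lie in row
  \<open>2 * (i mod 2)\<close>. Its diagonals are told apart by which of \<open>(i, 1)\<close> and
  \<open>(i + 1, 1)\<close> they contain.\<close>

definition zig :: "int \<Rightarrow> point" where "zig i = (i, i mod 2)"

text \<open>If \<open>zig 0\<close> led with (0, 1) and (1, 0), both side cells would need (0, 0).
  So it claims (1, 1), and then each \<open>zig i\<close> has to claim \<open>(i + 1, 1)\<close>. At
  the other end, once \<open>zig k\<close> claims \<open>(k + 1, 1)\<close>, both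
  \<open>zig (k + 1)\<close> and the cell \<open>(k + 1, k mod 2)\<close> need
  \<open>(k + 2, 1)\<close>.\<close>

definition family :: "int \<Rightarrow> point set" where
  "family k = zig ` {0..k + 1} \<union> {(-1, 0), (0, -1), (k + 1, k mod 2)}"

lemma mod_2_cases:
  fixes i :: int
  obtains "i mod 2 = 0" "(i + 1) mod 2 = 1" | "i mod 2 = 1" "(i + 1) mod 2 = 0"
proof -
  have "i mod 2 = 0 \<and> (i + 1) mod 2 = 1 \<or> i mod 2 = 1 \<and> (i + 1) mod 2 = 0" by presburger
  then show ?thesis by (elim disjE conjE) (rule that; assumption)+
qed

lemma cong_zig:
  assumes "zig i \<in> A"
  shows "cong A (var_exp (i, 1) + var_exp (i + 1, 2 * (i mod 2)) + t)
    (var_exp (i + 1, 1) + var_exp (i, 2 * (i mod 2)) + t)"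
proof (cases i rule: mod_2_cases)
  case 1
  then show ?thesis using cong_sym[OF cong_move[OF assms, of t]]
    by (simp add: zig_def diag.simps anti.simps add.commute)
next
  case 2
  then show ?thesis using cong_move[OF assms, of t]
    by (simp add: zig_def diag.simps anti.simps add.commute)
qed

lemma cong_tail:
  assumes "(k + 1, k mod 2) \<in> A"
  shows "cong A (var_exp (k + 1, 1) + var_exp (k + 2, 2 * (k mod 2)) + t)
    (var_exp (k + 2, 1) + var_exp (k + 1, 2 * (k mod 2)) + t)"
proof (cases k rule: mod_2_cases)
  case 1
  then show ?thesis using cong_sym[OF cong_move[OF assms, of t]]
    by (simp add: diag.simps anti.simps add.commute)
next
  case 2
  then show ?thesis using cong_move[OF assms, of t]
    by (simp add: diag.simps anti.simps add.commute)
qed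

text \<open>If \<open>n + n\<close> is equivalent to a multiple of \<open>r\<close>, and \<open>r\<close> does not distinguish \<open>a\<close> and \<open>b\<close>, then
  the binomial \<open>a n - b n\<close> squares to zero.\<close>

lemma cong_square_zero:
  assumes n: "cong A (n + n) (r + w)" and r: "\<And>t. cong A (r + a + t) (r + b + t)"
  shows "cong A ((a + n) + (a + n)) ((a + n) + (b + n))" "cong A ((a + n) + (b + n)) ((b + n) + (b + n))"
proof -
  have *: "cong A ((c + n) + (d + n)) (r + w + (c + d))" for c d
    using cong_add[OF n, of "c + d"] by (simp add: ac_simps)
  have "cong A (r + w + (a + a)) (r + w + (a + b))"
    using r[of "a + w"] by (simp add: ac_simps)
  then show "cong A ((a + n) + (a + n)) ((a + n) + (b + n))"
    using *[of a a] *[of a b] cong_sym cong_trans by blast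
  have "cong A (r + w + (a + b)) (r + w + (b + b))"
    using r[of "b + w"] by (simp add: ac_simps)
  then show "cong A ((a + n) + (b + n)) ((b + n) + (b + n))"
    using *[of a b] *[of b b] cong_sym cong_trans by blast
qed

text \<open>One factor from each of the cells \<open>zig 1\<close>, ..., \<open>zig n\<close>,
  namely the partner of the left vertex in row 1. Each factor pays for pushing the middle-row
  variable one column to the right.\<close>

definition chain_vars :: "nat \<Rightarrow> point \<Rightarrow>\<^sub>0 nat" where
  "chain_vars n = (\<Sum>i<n. var_exp (int i + 2, 2 * ((int i + 1) mod 2)))"

lemma cong_chain:
  assumes "\<And>i. 0 \<le> i \<Longrightarrow> i \<le> int n \<Longrightarrow> zig i \<in> A"
  shows "\<exists>w. cong A (var_exp (1, 1) + chain_vars n) (var_exp (int n + 1, 1) + w)"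
  using assms
proof (induction n)
  case 0
  show ?case by (rule exI[of _ 0]) (simp add: chain_vars_def cong_refl)
next
  case (Suc n)
  then obtain w where w: "cong A (var_exp (1, 1) + chain_vars n) (var_exp (int n + 1, 1) + w)" by auto
  let ?v = "var_exp (int n + 2, 2 * ((int n + 1) mod 2))"
  have 1: "cong A (var_exp (1, 1) + chain_vars (Suc n)) (var_exp (int n + 1, 1) + ?v + w)"
    using cong_add[OF w, of ?v] by (simp add: chain_vars_def ac_simps)
  have "zig (int n + 1) \<in> A" using Suc.prems by simp
  from cong_zig[OF this, of w]
  have 2: "cong A (var_exp (int n + 1, 1) + ?v + w)
      (var_exp (int n + 2, 1) + (var_exp (int n + 1, 2 * ((int n + 1) mod 2)) + w))"
    by (simp add: add.assoc)
  have "int n + 2 = int (Suc n) + 1" by simp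
  then show ?case using cong_trans[OF 1 2] by metis
qed

text \<open>Weights from 2 on need not be told apart: a cofactor never brings them back to 1. This
  is the relation that the square of an infinitesimal is zero.\<close>

lemma move_closed_mweight:
  assumes "\<And>p. p \<in> A \<Longrightarrow> min 2 (mweight w (diag p)) = min 2 (mweight w (anti p))"
  shows "move_closed A (\<lambda>m. mweight w m = 1)"
  unfolding move_closed_def
proof (intro ballI allI)
  fix p t assume "p \<in> A"
  then show "mweight w (diag p + t) = 1 \<longleftrightarrow> mweight w (anti p + t) = 1"
    using assms[of p] by (auto simp: mweight_add min_def split: if_splits)
qed

text \<open>The weight \<open>w\<close> below evaluates the variables at \<open>1\<close>, \<open>\<epsilon>\<close> and \<open>\<epsilon>\<^sup>2 = 0\<close>; this is a
  point of the dual numbers at which all adjacent minors vanish.\<close>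

lemma not_radical_at_family:
  assumes "1 \<le> n" shows "\<not> radical_at K (family (int n))"
proof -
  define k where "k = int n"
  have k: "1 \<le> k" using assms by (simp add: k_def)
  let ?A = "family k"
  have zig: "zig i \<in> ?A" if "0 \<le> i" "i \<le> k + 1" for i using that by (simp add: family_def)
  have left: "(-1, 0) \<in> ?A" and below: "(0, -1) \<in> ?A" and tail: "(k + 1, k mod 2) \<in> ?A"
    by (simp_all add: family_def)
  \<comment> \<open>\<open>a - b\<close> is, up to sign, the minor on the rows 0 and 2 of the
    vertical domino in column \<open>k + 1\<close>. A middle-row variable times this minor lies in
    the ideal.\<close>
  define a where "a = var_exp (k + 1, 2 * (k mod 2)) + var_exp (k + 2, 2 * ((k + 1) mod 2))"
  define b where "b = var_exp (k + 2, 2 * (k mod 2)) + var_exp (k + 1, 2 * ((k + 1) mod 2))"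
  \<comment> \<open>\<open>y\<close> contains (1, 0) and is congruent to a monomial containing (0,
    1). Hence two copies together produce the anti-diagonal of \<open>zig 0\<close> and, by a move,
    the variable at (1, 1), from which \<open>chain_vars\<close> leads to
    \<open>(k + 1, 1)\<close>.\<close>
  define y where "y = var_exp (1, 0) + var_exp (-1, 1) + var_exp ((0, -1) :: point)"
  define N where "N = chain_vars n + y"
  have r: "cong ?A (var_exp (k + 1, 1) + a + t) (var_exp (k + 1, 1) + b + t)" for t
  proof -
    have "cong ?A (var_exp (k + 1, 1) + a + t)
        (var_exp (k + 2, 1) + var_exp (k + 1, 2 * ((k + 1) mod 2)) + (var_exp (k + 1, 2 * (k mod 2)) + t))"
      using cong_zig[OF zig[of "k + 1"], of "var_exp (k + 1, 2 * (k mod 2)) + t"] k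
      by (simp add: a_def ac_simps)
    moreover have "cong ?A (var_exp (k + 1, 1) + b + t)
        (var_exp (k + 2, 1) + var_exp (k + 1, 2 * ((k + 1) mod 2)) + (var_exp (k + 1, 2 * (k mod 2)) + t))"
      using cong_tail[OF tail, of "var_exp (k + 1, 2 * ((k + 1) mod 2)) + t"]
      by (simp add: b_def ac_simps)
    ultimately show ?thesis using cong_sym cong_trans by blast
  qed
  have "\<exists>w. cong ?A (N + N) (var_exp (k + 1, 1) + w)"
  proof -
    obtain w where w: "cong ?A (var_exp (1, 1) + chain_vars n) (var_exp (k + 1, 1) + w)"
      using cong_chain[of n ?A] zig by (auto simp: k_def)
    define s where "s = var_exp (1, -1) + var_exp (-1, 0) + var_exp (-1, 1) + var_exp ((0, -1) :: point)"
    have "cong ?A (y + y) (var_exp (0, 0) + var_exp (-1, 1) + (var_exp (1, -1) + y))"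
      using cong_move[OF below, of "var_exp (-1, 1) + y"]
      by (simp add: y_def diag.simps anti.simps ac_simps)
    moreover have "cong ?A (var_exp (0, 0) + var_exp (-1, 1) + (var_exp (1, -1) + y))
        (var_exp (0, 1) + var_exp (1, 0) + s)"
      using cong_sym[OF cong_move[OF left, of "var_exp (1, -1) + y"]]
      by (simp add: y_def s_def diag.simps anti.simps ac_simps)
    moreover have "cong ?A (var_exp (0, 1) + var_exp (1, 0) + s) (var_exp (1, 1) + (var_exp (0, 0) + s))"
      using cong_zig[OF zig[of 0], of s] k by (simp add: ac_simps)
    ultimately have "cong ?A (y + y) (var_exp (1, 1) + (var_exp (0, 0) + s))"
      using cong_trans by blast
    from cong_add[OF this, of "chain_vars n + chain_vars n"]
    have "cong ?A (N + N) (var_exp (1, 1) + chain_vars n + (var_exp (0, 0) + s + chain_vars n))"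
      by (simp add: N_def ac_simps)
    moreover have "cong ?A (var_exp (1, 1) + chain_vars n + (var_exp (0, 0) + s + chain_vars n))
        (var_exp (k + 1, 1) + (w + (var_exp (0, 0) + s + chain_vars n)))"
      using cong_add[OF w, of "var_exp (0, 0) + s + chain_vars n"] by (simp add: add.assoc)
    ultimately show ?thesis using cong_trans by blast
  qed
  then obtain W where W: "cong ?A (N + N) (var_exp (k + 1, 1) + W)" by blast
  define w where "w p = (if snd p = 1 \<and> 1 \<le> fst p then 2 else
    if p \<in> {(1, 0), (0, 0), (0, 1)} then 1 else if p = (k + 2, 2 * (k mod 2)) then 2 else (0::nat))" for p :: point
  have sum_list: "mweight w (sum f I) = (\<Sum>i\<in>I. mweight w (f i))" for f :: "nat \<Rightarrow> point \<Rightarrow>\<^sub>0 nat" and I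
    by (induction I rule: infinite_finite_induct) (simp_all add: mweight_add)
  have "2 * z \<noteq> 1" for z :: int by presburger
  then have chain: "mweight w (chain_vars n) = 0"
    unfolding chain_vars_def sum_list by (intro sum.neutral) (auto simp: w_def k_def)
  show ?thesis unfolding k_def[symmetric]
  proof (rule not_radical_at[OF cong_square_zero[OF W r]])
    show "move_closed ?A (\<lambda>m. mweight w m = 1)"
    proof (rule move_closed_mweight)
      fix p assume "p \<in> ?A"
      then consider i where "0 \<le> i" "i \<le> k + 1" "p = zig i" | "p = (-1, 0)" | "p = (0, -1)" | "p = (k + 1, k mod 2)"
        unfolding family_def by auto
      then show "min 2 (mweight w (diag p)) = min 2 (mweight w (anti p))"
      proof cases
        case 1
        then show ?thesis using k
          by (cases i rule: mod_2_cases; cases "i = 0") (auto simp: zig_def diag.simps anti.simps mweight_add w_def)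
      next
        case 4
        then show ?thesis using k
          by (cases k rule: mod_2_cases) (auto simp: diag.simps anti.simps mweight_add w_def)
      qed (use k in \<open>auto simp: diag.simps anti.simps mweight_add w_def\<close>)
    qed
    show "mweight w (a + N) = 1"
      using k by (cases k rule: mod_2_cases) (auto simp: a_def N_def y_def mweight_add chain w_def)
    show "mweight w (b + N) \<noteq> 1"
      using k by (auto simp: b_def N_def y_def mweight_add w_def)
    have corner: "q \<in> corner_set ?A" if "p \<in> ?A" "q \<in> cell p" for p q
      using that by (auto simp: corner_set_def)
    have zig_corner: "(i, 2 * (i mod 2)) \<in> corner_set ?A" "(i + 1, 2 * (i mod 2)) \<in> corner_set ?A"
      if "0 \<le> i" "i \<le> k + 1" for i
      using corner[OF zig[OF that]] by (cases i rule: mod_2_cases; simp add: zig_def cell.simps)+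
    have tail_corner: "(k + 2, 2 * (k mod 2)) \<in> corner_set ?A"
      using corner[OF tail] by (cases k rule: mod_2_cases) (simp_all add: cell.simps)
    have "Poly_Mapping.keys (chain_vars n) \<subseteq> corner_set ?A"
    proof
      fix q assume "q \<in> Poly_Mapping.keys (chain_vars n)"
      then obtain i where "i < n" "q = (int i + 2, 2 * ((int i + 1) mod 2))"
        using keys_sum[of "\<lambda>i. var_exp (int i + 2, 2 * ((int i + 1) mod 2))" "{..<n}"]
        unfolding chain_vars_def by auto
      then show "q \<in> corner_set ?A" using zig_corner(2)[of "int i + 1"] by (simp add: k_def add.commute)
    qed
    moreover have "Poly_Mapping.keys y \<subseteq> corner_set ?A"
      using corner[OF left] corner[OF below] by (auto simp: y_def keys_add_nat cell.simps)
    ultimately have N: "Poly_Mapping.keys N \<subseteq> corner_set ?A" by (simp add: N_def keys_add_nat)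
    show "Poly_Mapping.keys (a + N) \<subseteq> corner_set ?A" "Poly_Mapping.keys (b + N) \<subseteq> corner_set ?A"
      using N k tail_corner zig_corner[of k] zig_corner[of "k + 1"]
      by (auto simp: a_def b_def keys_add_nat add.commute)
  qed
qed

text \<open>Left of column \<open>j\<close> the cells are oriented as the corner at \<open>(0, 0)\<close> demands, right of it as
  the corner at \<open>(k + 1, k mod 2)\<close> demands. The two demands clash, unless a cell is missing.\<close>

definition cut_orient :: "int \<Rightarrow> int \<Rightarrow> point \<Rightarrow> bool" where
  "cut_orient k j p \<longleftrightarrow> (if fst p \<le> j then snd p \<le> 0 else if p = zig (k + 1) then snd p = 0 else snd p = 1)"

text \<open>A weight 1 on one vertex off the row 1 decides each zigzag cell. The outer vertices of
  the cells attached to the zigzag weigh 2 where they must outvote a weight 1 on a vertex shared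
  with the zigzag.\<close>

definition cut_weight :: "int \<Rightarrow> int \<Rightarrow> point \<Rightarrow> nat" where
  "cut_weight k j p = (case p of (x, y) \<Rightarrow>
     if p = (-1, 0) \<or> p = (0, -1) then (if 0 \<le> j then 2 else 0)
     else if p = (1, -1) \<or> p = (-1, 1) then (if 0 \<le> j then 0 else 2)
     else if p = (k + 2, 1) then (if k < j then 1 else 0)
     else if p = (k + 2, 2 * (k mod 2)) then (if k < j then 0 else 2)
     else if y = 1 \<or> x < 0 then 0
     else if y = 2 * (x mod 2) then (if x \<le> j \<or> x = k + 1 then 1 else 0)
     else (if x - 1 \<le> j \<or> x - 1 = k + 1 then 0 else 1))"

lemma cut_zig:
  "set (lead_list (cut_orient k j) (zig i)) = (if i \<le> j \<or> i = k + 1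
    then {(i + 1, 1), (i, 2 * (i mod 2))} else {(i, 1), (i + 1, 2 * (i mod 2))})"
  by (cases i rule: mod_2_cases) (auto simp: zig_def cut_orient_def lead_list_def)

lemma cut_left:
  "lead_list (cut_orient k j) (-1, 0) = (if -1 \<le> j then [(-1, 0), (0, 1)] else [(-1, 1), (0, 0)])"
  if "1 \<le> k"
  using that by (auto simp: zig_def cut_orient_def lead_list_def)

lemma cut_below:
  "lead_list (cut_orient k j) (0, -1) = (if 0 \<le> j then [(0, -1), (1, 0)] else [(0, 0), (1, -1)])"
  if "1 \<le> k"
  using that by (auto simp: zig_def cut_orient_def lead_list_def)

lemma cut_tail:
  "set (lead_list (cut_orient k j) (k + 1, k mod 2)) = (if k < j
    then {(k + 1, 2 * (k mod 2)), (k + 2, 1)} else {(k + 1, 1), (k + 2, 2 * (k mod 2))})"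
  by (cases k rule: mod_2_cases) (auto simp: zig_def cut_orient_def lead_list_def)

text \<open>If a side cell of the left corner is missing, all remaining cells follow the right
  corner. The value -2 puts even the cell (-1, 0) right of the cut, which -1 would not.\<close>

definition cut_at :: "int \<Rightarrow> point \<Rightarrow> int" where
  "cut_at k x = (if x = (-1, 0) \<or> x = (0, -1) then -2 else fst x)"

lemma family_cases:
  assumes "p \<in> family k"
  obtains i where "0 \<le> i" "i \<le> k + 1" "p = zig i" | "p = (-1, 0)" | "p = (0, -1)" | "p = (k + 1, k mod 2)"
  using assms unfolding family_def by auto

text \<open>If \<open>zig j\<close> is missing with \<open>0 < j < k\<close>, its neighbours
  \<open>zig (j - 1)\<close> and \<open>zig (j + 1)\<close> claim \<open>(j, 1)\<close> and
  \<open>(j + 1, 1)\<close>, the two middle-row vertices of the gap. A missing cell of a corner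
  frees the zigzag from the demand of that corner.\<close>

lemma radical_at_family_minus:
  assumes k: "1 \<le> k" and x: "x \<in> family k"
  shows "radical_at K (family k - {x})"
proof (rule radical_at_of_weighted_leads)
  define j where "j = cut_at k x"
  have par: "2 * z \<noteq> 1" for z :: int by presburger
  have x_cases: "(\<exists>i. 0 \<le> i \<and> i \<le> k + 1 \<and> x = zig i) \<or> x = (-1, 0) \<or> x = (0, -1) \<or>
      x = (k + 1, k mod 2)"
    using x unfolding family_def by auto
  \<comment> \<open>The bound is \<open>k\<close> and not \<open>k + 1\<close>: a cut in column
    \<open>k + 1\<close> may also mean that \<open>(k + 1, k mod 2)\<close> is missing while
    \<open>zig (k + 1)\<close> is present.\<close>
  have zig_ne: "i \<noteq> j" if "zig i \<in> family k - {x}" "0 \<le> i" "i \<le> k" for i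
    using x_cases that by (auto simp: j_def cut_at_def zig_def split: if_splits)
  have j0: "j = -2 \<or> 0 \<le> j" and j_le: "j \<le> k + 1"
    using x_cases k by (auto simp: j_def cut_at_def zig_def)
  have j_left: "x = (-1, 0) \<or> x = (0, -1)" if "j = -2"
    using x_cases k that by (auto simp: j_def cut_at_def zig_def)
  have j_tail: "x = zig (k + 1) \<or> x = (k + 1, k mod 2)" if "k < j"
  proof -
    have "i = k + 1" if "x = zig i" "i \<le> k + 1" for i
      using that \<open>k < j\<close> k by (auto simp: j_def cut_at_def zig_def split: if_splits)
    then show ?thesis using x_cases that k by (auto simp: j_def cut_at_def)
  qed
  show "disjoint_leads (cut_orient k j) (family k - {x})"
    unfolding disjoint_leads_def
  proof -
    have zz: "set (lead_list (cut_orient k j) (zig i)) \<inter> set (lead_list (cut_orient k j) (zig i')) = {}"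
      if "zig i \<in> family k - {x}" "0 \<le> i" "i < i'" "i' \<le> k + 1" for i i'
      using that zig_ne[of i] par unfolding cut_zig
      by (cases "i' = i + 1"; cases i rule: mod_2_cases) auto
    have zl: "set (lead_list (cut_orient k j) (zig i)) \<inter> set (lead_list (cut_orient k j) (-1, 0)) = {}" if "0 \<le> i" for i
      using that j0 k unfolding cut_zig cut_left[OF k] by (auto split: if_splits)
    have zb: "set (lead_list (cut_orient k j) (zig i)) \<inter> set (lead_list (cut_orient k j) (0, -1)) = {}"
      if "0 \<le> i" for i
      using that j0 k unfolding cut_zig cut_below[OF k]
      by (cases "i = 0"; cases "i = 1") (auto split: if_splits)
    have zt: "set (lead_list (cut_orient k j) (zig i)) \<inter> set (lead_list (cut_orient k j) (k + 1, k mod 2)) = {}"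
      if "zig i \<in> family k - {x}" "(k + 1, k mod 2) \<in> family k - {x}" "0 \<le> i" "i \<le> k + 1" for i
      using that zig_ne[of i] j_tail j_le unfolding cut_zig cut_tail
      by (cases "i = k + 1"; cases "i = k"; cases k rule: mod_2_cases) auto
    have lb: "set (lead_list (cut_orient k j) (-1, 0)) \<inter> set (lead_list (cut_orient k j) (0, -1)) = {}"
      if "(-1, 0) \<in> family k - {x}" "(0, -1) \<in> family k - {x}"
      using that j0 j_left k unfolding cut_left[OF k] cut_below[OF k] by auto
    have lt: "set (lead_list (cut_orient k j) (-1, 0)) \<inter> set (lead_list (cut_orient k j) (k + 1, k mod 2)) = {}"
      and bt: "set (lead_list (cut_orient k j) (0, -1)) \<inter> set (lead_list (cut_orient k j) (k + 1, k mod 2)) = {}"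
      using k unfolding cut_left[OF k] cut_below[OF k] cut_tail by auto
    show "\<forall>p\<in>family k - {x}. \<forall>q\<in>family k - {x}. p \<noteq> q \<longrightarrow>
        set (lead_list (cut_orient k j) p) \<inter> set (lead_list (cut_orient k j) q) = {}"
    proof (intro ballI impI)
      fix p q assume pq: "p \<in> family k - {x}" "q \<in> family k - {x}" "p \<noteq> q"
      have "p \<in> family k" "q \<in> family k" using pq by auto
      then show "set (lead_list (cut_orient k j) p) \<inter> set (lead_list (cut_orient k j) q) = {}"
      proof (elim family_cases, goal_cases)
        case (1 i i')
        then show ?case using pq zz[of i i'] zz[of i' i] by (cases i i' rule: linorder_cases) auto
      qed (use pq zl zb zt lb lt bt in \<open>simp_all add: Int_commute\<close>)
    qed
  qed
  show "sum_list (map (cut_weight k j) (trail_list (cut_orient k j) p)) <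
      sum_list (map (cut_weight k j) (lead_list (cut_orient k j) p))" if "p \<in> family k - {x}" for p
  proof -
    from that have "p \<in> family k" by simp
    then show ?thesis
    proof (cases rule: family_cases)
      case (1 i)
      then show ?thesis using k j0 j_le zig_ne[of i] j_tail that
        by (cases i rule: mod_2_cases; cases k rule: mod_2_cases; cases "i = k + 1")
          (auto simp: zig_def cut_orient_def cut_weight_def lead_list_def trail_list_def)
    next
      case 2
      then show ?thesis using k j0
        by (auto simp: zig_def cut_orient_def cut_weight_def lead_list_def trail_list_def)
    next
      case 3
      then show ?thesis using k j0
        by (auto simp: zig_def cut_orient_def cut_weight_def lead_list_def trail_list_def)
    next
      case 4
      then show ?thesis using k j0 j_le j_tail that
        by (cases k rule: mod_2_cases) (auto simp: zig_def cut_orient_def cut_weight_def lead_list_def trail_list_def)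
    qed
  qed
qed

section \<open>Connectedness and size of the zigzag family\<close>

lemma connected_cells_insert:
  assumes "connected_cells A" "p \<in> A" "nbr p q" shows "connected_cells (insert q A)"
proof -
  let ?E = "{(a, b). a \<in> insert q A \<and> b \<in> insert q A \<and> nbr a b}"
  have A: "(a, b) \<in> ?E\<^sup>*" if "a \<in> A" "b \<in> A" for a b
  proof -
    have "(a, b) \<in> {(a, b). a \<in> A \<and> b \<in> A \<and> nbr a b}\<^sup>*"
      using assms(1) that by (simp add: connected_cells_def)
    then show ?thesis by (rule rtrancl_mono[THEN subsetD, rotated]) auto
  qed
  have "nbr q p" using assms(3) by (auto simp: nbr_def)
  then have pq: "(p, q) \<in> ?E" "(q, p) \<in> ?E" using assms by auto
  have "(a, q) \<in> ?E\<^sup>*" "(q, a) \<in> ?E\<^sup>*" if "a \<in> A" for a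
    using rtrancl_into_rtrancl[OF A[OF that assms(2)] pq(1)]
      converse_rtrancl_into_rtrancl[OF pq(2) A[OF assms(2) that]] by simp_all
  then show ?thesis unfolding connected_cells_def using A by blast
qed

lemma connected_cells_zig: "connected_cells (zig ` {0..int n})"
proof (induction n)
  case 0
  show ?case by (rule connected_cells_star[of "zig 0"]) (auto simp: nbr_def)
next
  case (Suc n)
  have "zig ` {0..int (Suc n)} = insert (zig (int n + 1)) (zig ` {0..int n})"
    by (auto simp: image_iff) (metis add.commute atLeastAtMost_iff zle_add1_eq_le order_le_less)
  moreover have "\<bar>int n mod 2 - (int n + 1) mod 2\<bar> \<le> 1" by presburger
  then have "nbr (zig (int n)) (zig (int n + 1))" by (simp add: nbr_def zig_def)
  ultimately show ?case using connected_cells_insert[OF Suc, of "zig (int n)"] by simp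
qed

lemma connected_cells_family: "connected_cells (family (int n))"
proof -
  have eq: "family (int n) = insert (int n + 1, int n mod 2) (insert (0, -1) (insert (-1, 0)
      (zig ` {0..int (Suc n)})))"
    by (auto simp: family_def add.commute)
  have "connected_cells (insert (-1, 0) (zig ` {0..int (Suc n)}))"
    by (rule connected_cells_insert[OF connected_cells_zig, of "zig 0"]) (auto simp: zig_def nbr_def)
  then have "connected_cells (insert (0, -1) (insert (-1, 0) (zig ` {0..int (Suc n)})))"
    by (rule connected_cells_insert[of _ "zig 0"]) (auto simp: zig_def nbr_def)
  then show ?thesis unfolding eq
    by (rule connected_cells_insert[of _ "zig (int n)"]) (auto simp: zig_def nbr_def)
qed

lemma card_family: "finite (family (int n))" "card (family (int n)) = n + 5"
proof -
  show "finite (family (int n))" by (simp add: family_def)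
  have "inj zig" by (auto simp: inj_def zig_def)
  then have "card (zig ` {0..int n + 1}) = n + 2"
    using card_image[OF inj_on_subset[OF \<open>inj zig\<close> subset_UNIV], of "{0..int n + 1}"] by simp
  moreover have "(int n + 1) mod 2 \<noteq> int n mod 2" by presburger
  then have "(int n + 1, int n mod 2) \<notin> zig ` {0..int n + 1}" by (auto simp: zig_def)
  moreover have "(-1, 0) \<notin> zig ` {0..int n + 1}" "(0, -1) \<notin> zig ` {0..int n + 1}"
    by (auto simp: zig_def)
  moreover have "family (int n) = insert (int n + 1, int n mod 2) (insert (0, -1) (insert (-1, 0)
      (zig ` {0..int n + 1})))"
    by (auto simp: family_def)
  ultimately show "card (family (int n)) = n + 5" by (simp add: card_insert_if)
qed

lemma minimal_family:
  assumes "6 \<le> n" shows "\<exists>\<C> \<in> collections n. minimally_nonradical K \<C>"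
proof
  \<comment> \<open>The family has \<open>k + 5\<close> cells. For \<open>k = 0\<close> the two
    corners would share \<open>zig 0\<close>, and its row neighbours together with the cell below it
    would form a T-tetromino, so minimality needs \<open>k \<ge> 1\<close>.\<close>
  define k where "k = n - 5"
  have k: "1 \<le> k" "n = k + 5" using assms by (simp_all add: k_def)
  show "cell ` family (int k) \<in> collections n"
    unfolding collections_iff using card_family[of k] connected_cells_family[of k] k(2) by blast
  show "minimally_nonradical K (cell ` family (int k))"
    unfolding minimally_nonradical_def
  proof (intro conjI ballI impI)
    show "cell ` family (int k) \<subseteq> cells" by (auto simp: cells_def)
    show "weakly_connected (cell ` family (int k))"
      by (simp add: weakly_connected_image connected_cells_family)
    show "\<not> has_radical_adj_ideal K (cell ` family (int k))"
      by (simp add: has_radical_iff not_radical_at_family[OF k(1)])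
    fix C assume "C \<in> cell ` family (int k)"
    then obtain x where x: "x \<in> family (int k)" "C = cell x" by blast
    have "cell ` family (int k) - {cell x} = cell ` (family (int k) - {x})" by (auto simp: cell_inject)
    then show "has_radical_adj_ideal K (cell ` family (int k) - {C})"
      using radical_at_family_minus[OF _ x(1), of K] k(1) by (simp add: x(2) has_radical_iff)
  qed
qed

theorem theorem4p5:
  shows "(\<forall>\<C> \<in> collections 1 \<union> collections 2 \<union> collections 3.
            has_radical_adj_ideal TYPE('k::field) \<C>)
       \<and> \<not> (\<exists>\<C> \<in> collections 5. minimally_nonradical TYPE('k) \<C>)
       \<and> (\<forall>n::nat. n = 4 \<or> n \<ge> 6 \<longrightarrow>
            (\<exists>\<C> \<in> collections n. minimally_nonradical TYPE('k) \<C>))"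
proof (intro conjI ballI allI impI)
  fix \<C> assume "\<C> \<in> collections 1 \<union> collections 2 \<union> collections 3"
  then obtain A where "\<C> = cell ` A" "finite A" "connected_cells A" "card A \<in> {1, 2, 3}"
    by (auto simp: collections_iff)
  then show "has_radical_adj_ideal TYPE('k) \<C>"
    using radical_at_small[of A "TYPE('k)"] by (simp add: has_radical_iff)
next
  show "\<not> (\<exists>\<C> \<in> collections 5. minimally_nonradical TYPE('k) \<C>)"
    using no_minimal_5[where K = "TYPE('k)"] by (auto simp: collections_iff)
next
  fix n :: nat assume "n = 4 \<or> n \<ge> 6"
  then show "\<exists>\<C> \<in> collections n. minimally_nonradical TYPE('k) \<C>"
    using minimal_T minimal_family by blast
qed

end
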